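(* For every ordinal $\alpha\geq \omega$, $\mathbf{Dc}_{\alpha}$ is contained in the super amalgamation base of $\mathbf{RCA}_{\alpha}$.
   Context: For an ordinal $\gamma$, $\mathbf{CA}_\gamma$ is the class of cylindric algebras of dimension $\gamma$: algebras $(A,+,\cdot,-,0,1,\mathsf{c}_i,\mathsf{d}_{ij})_{i,j<\gamma}$ such that $(A,+,\cdot,-,0,1)$ is a Boolean algebra and for all $x,y\in A$, $i,j,k<\gamma$: $\mathsf{c}_i0=0$; $x\le \mathsf{c}_ix$; $\mathsf{c}_i(x\cdot \mathsf{c}_iy)=\mathsf{c}_ix\cdot \mathsf{c}_iy$; $\mathsf{c}_i\mathsf{c}_jx=\mathsf{c}_j\mathsf{c}_ix$; $\mathsf{d}_{ii}=1$; if $k\ne i,j$ then $\mathsf{d}_{ij}=\mathsf{c}_k(\mathsf{d}_{ik}\cdot \mathsf{d}_{kj})$; if $i\neq j$ then $\mathsf{c}_i(\mathsf{d}_{ij}\cdot x)\cdot \mathsf{c}_i(\mathsf{d}_{ij}\cdot -x)=0$. $\le$ is the Boolean order. $\mathbf{Dc}_\alpha$ is the class of dimension complemented algebras: those $\mathfrak{A}\in\mathbf{CA}_\alpha$ with $\Delta x\ne\alpha$ for all $x\in A$, where $\Delta x=\{i<\alpha:\mathsf{c}_ix\ne x\}$. $\mathbf{RCA}_\alpha$ is the class of representable cylindric algebras of dimension $\alpha$: algebras isomorphic to a subalgebra of a product of full cylindric set algebras $\wp({}^{\alpha}U)$, where $\mathsf{c}_iX=\{s\in{}^\alpha U: \exists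 t\in X,\ t_j=s_j \text{ for all } j\ne i\}$ and $\mathsf{d}_{ij}=\{s\in{}^\alpha U:s_i=s_j\}$. Super amalgamation base: for a class $K$ of algebras with Boolean reducts, $\mathfrak{A}_0\in K$ lies in the super amalgamation base of $K$ if for all $\mathfrak{A}_1,\mathfrak{A}_2\in K$ and monomorphisms (injective homomorphisms) $i_1:\mathfrak{A}_0\to\mathfrak{A}_1$, $i_2:\mathfrak{A}_0\to\mathfrak{A}_2$ there exist $\mathfrak{D}\in K$ and monomorphisms $m_1:\mathfrak{A}_1\to\mathfrak{D}$, $m_2:\mathfrak{A}_2\to\mathfrak{D}$ such that $m_1\circ i_1=m_2\circ i_2$ and, whenever $\{j,k\}=\{1,2\}$, for all $x\in A_j$ and $y\in A_k$, if $m_j(x)\le m_k(y)$ then there is $z\in A_0$ with $x\le i_j(z)$ and $i_k(z)\le y$. *)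

theory Defs
  imports "HOL-Library.FuncSet"
begin

unbundle cardinal_syntax

text \<open>
  Algebras of the similarity type of cylindric algebras.  An ordinal is a well-order
  \<open>\<alpha> :: 'i rel\<close>; the indices \<open>i < \<alpha>\<close> are the elements of
  \<open>J = Field \<alpha>\<close>, and the values of \<open>cyl\<close> and \<open>diag\<close> at indices
  outside \<open>J\<close> are irrelevant.
\<close>

record ('i, 'a) cyl_algebra =
  car :: "'a set"
  plus_of :: "'a \<Rightarrow> 'a \<Rightarrow> 'a"
  times_of :: "'a \<Rightarrow> 'a \<Rightarrow> 'a"
  compl_of :: "'a \<Rightarrow> 'a"
  zero_of :: "'a"
  one_of :: "'a"
  cyl :: "'i \<Rightarrow> 'a \<Rightarrow> 'a"
  diag :: "'i \<Rightarrow> 'i \<Rightarrow> 'a"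

definition closed_under_ops :: "'i set \<Rightarrow> 'a set \<Rightarrow> ('i, 'a) cyl_algebra \<Rightarrow> bool" where
  "closed_under_ops J S A \<longleftrightarrow>
     (\<forall>x\<in>S. \<forall>y\<in>S. plus_of A x y \<in> S \<and> times_of A x y \<in> S) \<and>
     (\<forall>x\<in>S. compl_of A x \<in> S) \<and>
     zero_of A \<in> S \<and> one_of A \<in> S \<and>
     (\<forall>i\<in>J. \<forall>x\<in>S. cyl A i x \<in> S) \<and>
     (\<forall>i\<in>J. \<forall>j\<in>J. diag A i j \<in> S)"

definition is_algebra :: "'i set \<Rightarrow> ('i, 'a) cyl_algebra \<Rightarrow> bool" where
  "is_algebra J A \<longleftrightarrow> closed_under_ops J (car A) A"

definition boolean_reduct :: "('i, 'a) cyl_algebra \<Rightarrow> bool" where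
  "boolean_reduct A \<longleftrightarrow>
     (\<forall>x\<in>car A. \<forall>y\<in>car A. \<forall>z\<in>car A.
        plus_of A (plus_of A x y) z = plus_of A x (plus_of A y z) \<and>
        times_of A (times_of A x y) z = times_of A x (times_of A y z) \<and>
        plus_of A x y = plus_of A y x \<and>
        times_of A x y = times_of A y x \<and>
        plus_of A x (times_of A y z) = times_of A (plus_of A x y) (plus_of A x z) \<and>
        times_of A x (plus_of A y z) = plus_of A (times_of A x y) (times_of A x z)) \<and>
     (\<forall>x\<in>car A.
        plus_of A x (zero_of A) = x \<and>
        times_of A x (one_of A) = x \<and>
        plus_of A x (compl_of A x) = one_of A \<and>
        times_of A x (compl_of A x) = zero_of A)"

definition le_of :: "('i, 'a) cyl_algebra \<Rightarrow> 'a \<Rightarrow> 'a \<Rightarrow> bool" where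
  "le_of A x y \<longleftrightarrow> plus_of A x y = y"

definition CA :: "'i set \<Rightarrow> ('i, 'a) cyl_algebra set" where
  "CA J = {A. is_algebra J A \<and> boolean_reduct A \<and>
     (\<forall>i\<in>J. cyl A i (zero_of A) = zero_of A) \<and>
     (\<forall>i\<in>J. \<forall>x\<in>car A. le_of A x (cyl A i x)) \<and>
     (\<forall>i\<in>J. \<forall>x\<in>car A. \<forall>y\<in>car A.
        cyl A i (times_of A x (cyl A i y)) = times_of A (cyl A i x) (cyl A i y)) \<and>
     (\<forall>i\<in>J. \<forall>j\<in>J. \<forall>x\<in>car A. cyl A i (cyl A j x) = cyl A j (cyl A i x)) \<and>
     (\<forall>i\<in>J. diag A i i = one_of A) \<and>
     (\<forall>i\<in>J. \<forall>j\<in>J. \<forall>k\<in>J. k \<noteq> i \<and> k \<noteq> j \<longrightarrow>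
        diag A i j = cyl A k (times_of A (diag A i k) (diag A k j))) \<and>
     (\<forall>i\<in>J. \<forall>j\<in>J. \<forall>x\<in>car A. i \<noteq> j \<longrightarrow>
        times_of A (cyl A i (times_of A (diag A i j) x))
                   (cyl A i (times_of A (diag A i j) (compl_of A x))) = zero_of A)}"

definition dim_set :: "'i set \<Rightarrow> ('i, 'a) cyl_algebra \<Rightarrow> 'a \<Rightarrow> 'i set" where
  "dim_set J A x = {i\<in>J. cyl A i x \<noteq> x}"

definition Dc :: "'i set \<Rightarrow> ('i, 'a) cyl_algebra set" where
  "Dc J = {A \<in> CA J. \<forall>x\<in>car A. dim_set J A x \<noteq> J}"

definition is_hom ::
  "'i set \<Rightarrow> ('i, 'a) cyl_algebra \<Rightarrow> ('i, 'b) cyl_algebra \<Rightarrow> ('a \<Rightarrow> 'b) \<Rightarrow> bool" where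
  "is_hom J A B h \<longleftrightarrow>
     h \<in> car A \<rightarrow> car B \<and>
     (\<forall>x\<in>car A. \<forall>y\<in>car A. h (plus_of A x y) = plus_of B (h x) (h y) \<and>
                           h (times_of A x y) = times_of B (h x) (h y)) \<and>
     (\<forall>x\<in>car A. h (compl_of A x) = compl_of B (h x)) \<and>
     h (zero_of A) = zero_of B \<and> h (one_of A) = one_of B \<and>
     (\<forall>i\<in>J. \<forall>x\<in>car A. h (cyl A i x) = cyl B i (h x)) \<and>
     (\<forall>i\<in>J. \<forall>j\<in>J. h (diag A i j) = diag B i j)"

definition is_mono ::
  "'i set \<Rightarrow> ('i, 'a) cyl_algebra \<Rightarrow> ('i, 'b) cyl_algebra \<Rightarrow> ('a \<Rightarrow> 'b) \<Rightarrow> bool" where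
  "is_mono J A B h \<longleftrightarrow> is_hom J A B h \<and> inj_on h (car A)"

definition isomorphic :: "'i set \<Rightarrow> ('i, 'a) cyl_algebra \<Rightarrow> ('i, 'b) cyl_algebra \<Rightarrow> bool" where
  "isomorphic J A B \<longleftrightarrow> (\<exists>h. is_hom J A B h \<and> bij_betw h (car A) (car B))"

text \<open>The members of \<open>J \<rightarrow>\<^sub>E U\<close> are the \<open>J\<close>-indexed sequences over \<open>U\<close>.\<close>

definition full_cs :: "'i set \<Rightarrow> 'x set \<Rightarrow> ('i, ('i \<Rightarrow> 'x) set) cyl_algebra" where
  "full_cs J U =
    \<lparr> car = Pow (J \<rightarrow>\<^sub>E U),
      plus_of = (\<union>),
      times_of = (\<inter>),
      compl_of = (\<lambda>X. (J \<rightarrow>\<^sub>E U) - X),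
      zero_of = {},
      one_of = J \<rightarrow>\<^sub>E U,
      cyl = (\<lambda>i X. {s \<in> J \<rightarrow>\<^sub>E U. \<exists>t\<in>X. \<forall>j\<in>J. j \<noteq> i \<longrightarrow> t j = s j}),
      diag = (\<lambda>i j. {s \<in> J \<rightarrow>\<^sub>E U. s i = s j}) \<rparr>"

definition prod_alg :: "'k set \<Rightarrow> ('k \<Rightarrow> ('i, 'a) cyl_algebra) \<Rightarrow> ('i, 'k \<Rightarrow> 'a) cyl_algebra" where
  "prod_alg I A =
    \<lparr> car = (\<Pi>\<^sub>E k\<in>I. car (A k)),
      plus_of = (\<lambda>f g. \<lambda>k\<in>I. plus_of (A k) (f k) (g k)),
      times_of = (\<lambda>f g. \<lambda>k\<in>I. times_of (A k) (f k) (g k)),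
      compl_of = (\<lambda>f. \<lambda>k\<in>I. compl_of (A k) (f k)),
      zero_of = (\<lambda>k\<in>I. zero_of (A k)),
      one_of = (\<lambda>k\<in>I. one_of (A k)),
      cyl = (\<lambda>i f. \<lambda>k\<in>I. cyl (A k) i (f k)),
      diag = (\<lambda>i j. \<lambda>k\<in>I. diag (A k) i j) \<rparr>"

definition is_subuniverse :: "'i set \<Rightarrow> 'a set \<Rightarrow> ('i, 'a) cyl_algebra \<Rightarrow> bool" where
  "is_subuniverse J S A \<longleftrightarrow> S \<subseteq> car A \<and> closed_under_ops J S A"

text \<open>
  A definition cannot quantify over types, so the type \<open>'x\<close> that supplies both the index
  set of the product and the bases of its factors is an explicit parameter.  An algebra is
  representable iff it belongs to \<open>RCA TYPE('x) J\<close> for some sufficiently large \<open>'x\<close>.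
\<close>

definition RCA :: "'x itself \<Rightarrow> 'i set \<Rightarrow> ('i, 'a) cyl_algebra set" where
  "RCA _ J = {A. is_algebra J A \<and>
     (\<exists>(I :: 'x set) (U :: 'x \<Rightarrow> 'x set) S.
        is_subuniverse J S (prod_alg I (\<lambda>k. full_cs J (U k))) \<and>
        isomorphic J A (prod_alg I (\<lambda>k. full_cs J (U k)) \<lparr>car := S\<rparr>))}"

text \<open>
  \<open>K0\<close>, \<open>K1\<close>, \<open>K2\<close>, \<open>KD\<close> stand for one and the same class \<open>K\<close> of algebras,
  instantiated at the element types of the four algebras involved (a bound variable \<open>K\<close>
  cannot be used at several types).
\<close>

definition super_amalgamation_base ::
  "'i set \<Rightarrow> ('i, 'a) cyl_algebra set \<Rightarrow> ('i, 'b) cyl_algebra set \<Rightarrow> ('i, 'c) cyl_algebra set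
     \<Rightarrow> ('i, 'd) cyl_algebra set \<Rightarrow> ('i, 'a) cyl_algebra set" where
  "super_amalgamation_base J K0 K1 K2 KD = {A0 \<in> K0. \<forall>A1\<in>K1. \<forall>A2\<in>K2. \<forall>i1 i2.
     is_mono J A0 A1 i1 \<and> is_mono J A0 A2 i2 \<longrightarrow>
     (\<exists>D\<in>KD. \<exists>m1 m2. is_mono J A1 D m1 \<and> is_mono J A2 D m2 \<and>
        (\<forall>z\<in>car A0. m1 (i1 z) = m2 (i2 z)) \<and>
        (\<forall>x\<in>car A1. \<forall>y\<in>car A2. le_of D (m1 x) (m2 y) \<longrightarrow>
           (\<exists>z\<in>car A0. le_of A1 x (i1 z) \<and> le_of A2 (i2 z) y)) \<and>
        (\<forall>x\<in>car A2. \<forall>y\<in>car A1. le_of D (m2 x) (m1 y) \<longrightarrow>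
           (\<exists>z\<in>car A0. le_of A2 x (i2 z) \<and> le_of A1 (i1 z) y)))}"

text \<open>
  An existential claim needs a concrete type.  \<open>('i, 'x) prod_elem\<close> is the type of the
  elements of a product of full cylindric set algebras with index set and bases in \<open>'x\<close>.
  If \<open>\<kappa>\<close> is infinite and at least the dimension, a representable algebra with at most
  \<open>\<kappa>\<close> elements has a representation with at most \<open>\<kappa>\<close> factors and bases of size at
  most \<open>2\<close> to the power \<open>\<kappa>\<close>; with \<open>\<kappa>\<close> the cardinality of \<open>'w\<close>, these fit into
  \<open>'w big\<close>.
\<close>

type_synonym 'w big = "'w set set"

type_synonym ('i, 'x) prod_elem = "'x \<Rightarrow> ('i \<Rightarrow> 'x) set"

end

theory Submission
  imports Defs "HOL-Library.Countable_Set"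
begin

text \<open>
  Let \<open>A\<^sub>0\<close> be dimension complemented and embedded into representable \<open>A\<^sub>1\<close> and \<open>A\<^sub>2\<close>.  Suppose
  that for every \<open>x\<close> in \<open>A\<^sub>1\<close> and \<open>y\<close> in \<open>A\<^sub>2\<close> without an interpolant in \<open>A\<^sub>0\<close> there are
  homomorphisms \<open>h\<^sub>1\<close>, \<open>h\<^sub>2\<close> into one full set algebra that agree on \<open>A\<^sub>0\<close> and satisfy
  \<open>\<not> h\<^sub>1 x \<subseteq> h\<^sub>2 y\<close>.  The product of these set algebras, over all such pairs in either order, is
  then a super amalgam: an inequality in the product must have an interpolant, and the pairs
  \<open>(x, 0)\<close> with \<open>x \<noteq> 0\<close>, which never have one, make the two maps injective (\<open>super_amalgam\<close>).
  So the theorem is Craig interpolation in the form of Robinson's joint consistency theorem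
  (\<open>separating_interpretations\<close>), together with the representability of \<open>A\<^sub>0\<close> (\<open>Dc_RCA\<close>).

  Both facts come from one construction on cylindric atom structures: a set \<open>\<Omega>\<close> with commuting
  equivalence relations \<open>T\<^sub>v\<close> and diagonal sets \<open>E\<^sub>v\<^sub>w\<close>.  There, substituting \<open>n\<close> for \<open>i\<close> is a
  function on points, and the substitution laws of cylindric algebras become laws about
  functions.  Fix finitely many indices and a sequence of fresh indices, the names.  If \<open>b\<close> and
  \<open>c\<close> are not separated by a family \<open>R\<close> of sets, both can be shrunk forever without becoming
  separated: one set may always be decided, and an element of a cylindrification may be given a
  name on which neither \<open>b\<close> nor \<open>c\<close> depends.  In the limit there are two
  filters that agree on the sets in \<open>R\<close> which they decide, and that have named witnesses (\<open>joint_model\<close>).  Their names form a model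
  that is correct for finitely many elements and indices (\<open>local_model_sat\<close>), and an ultraproduct
  over all finite pieces of \<open>A\<^sub>1\<close>, \<open>A\<^sub>2\<close> and the index set makes it correct for all of them
  (\<open>interp_hom\<close>).  A finite piece gives rise to countably many conditions, which is why a sequence of
  length \<open>\<omega>\<close> suffices whatever the size of the algebras.

  For the representability of \<open>A\<^sub>0\<close> the atom structure is that of its ultrafilters, \<open>R\<close> contains
  all sets, and the names are indices of \<open>A\<^sub>0\<close> itself.  They exist because finitely many elements
  of a dimension complemented algebra leave infinitely many common indices free
  (\<open>Dc_infinite_common_fixed\<close>).

  For joint consistency, \<open>A\<^sub>1\<close> and \<open>A\<^sub>2\<close> are represented in a single structure of sequences that has
  infinitely many extra coordinates as names, and \<open>z\<close> in \<open>A\<^sub>0\<close> becomes the union of its two images.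
  The family \<open>R\<close> consists of the substitution instances of these unions that change finitely many
  coordinates.  A set of \<open>R\<close> that separates \<open>x\<close> from \<open>y\<close> must be pulled back to \<open>A\<^sub>0\<close>: the finitely
  many names that it mentions are exchanged with coordinates that are free for the given
  element of \<open>A\<^sub>0\<close>, and are then quantified away (\<open>N_free_interpolation\<close>).  The same
  exchange shows that \<open>R\<close> is closed under unions (\<open>normal_form\<close>), and it is possible because
  \<open>A\<^sub>0\<close> is dimension complemented.
\<close>


section \<open>Cylindric atom structures\<close>

text \<open>
  The complex algebra of such a frame is a cylindric algebra; the conditions on \<open>T\<close> and \<open>E\<close> are
  the first-order correspondents of the cylindric equations.
\<close>

locale cyl_frame =
  fixes V :: "'v set" and \<Omega> :: "'w set"
    and T :: "'v \<Rightarrow> 'w \<Rightarrow> 'w \<Rightarrow> bool" and E :: "'v \<Rightarrow> 'v \<Rightarrow> 'w set"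
  assumes T_dom: "v \<in> V \<Longrightarrow> T v a b \<Longrightarrow> a \<in> \<Omega> \<and> b \<in> \<Omega>"
    and T_refl: "v \<in> V \<Longrightarrow> a \<in> \<Omega> \<Longrightarrow> T v a a"
    and T_sym: "v \<in> V \<Longrightarrow> T v a b \<Longrightarrow> T v b a"
    and T_trans: "v \<in> V \<Longrightarrow> T v a b \<Longrightarrow> T v b c \<Longrightarrow> T v a c"
    and T_comm: "v \<in> V \<Longrightarrow> w \<in> V \<Longrightarrow> T v a b \<Longrightarrow> T w b c \<Longrightarrow> \<exists>b'. T w a b' \<and> T v b' c"
    and E_sub: "v \<in> V \<Longrightarrow> w \<in> V \<Longrightarrow> E v w \<subseteq> \<Omega>"
    and E_refl: "v \<in> V \<Longrightarrow> E v v = \<Omega>"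
    and E_comp: "i \<in> V \<Longrightarrow> j \<in> V \<Longrightarrow> k \<in> V \<Longrightarrow> k \<noteq> i \<Longrightarrow> k \<noteq> j \<Longrightarrow>
        E i j = {a. \<exists>b\<in>E i k \<inter> E k j. T k a b}"
    and E_uniq: "i \<in> V \<Longrightarrow> j \<in> V \<Longrightarrow> i \<noteq> j \<Longrightarrow> T i a b \<Longrightarrow> a \<in> E i j \<Longrightarrow> b \<in> E i j \<Longrightarrow> a = b"
begin

definition cl :: "'v \<Rightarrow> 'w set \<Rightarrow> 'w set" where
  "cl v X = {a. \<exists>b\<in>X. T v a b}"

definition closed :: "'v \<Rightarrow> 'w set \<Rightarrow> bool" where
  "closed v X \<longleftrightarrow> (\<forall>a\<in>X. \<forall>b. T v a b \<longrightarrow> b \<in> X)"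

text \<open>
  The operation \<open>X \<mapsto> c\<^sub>i(d\<^sub>i\<^sub>n \<sqinter> X)\<close> that replaces the variable \<open>i\<close> by \<open>n\<close> is the preimage map of
  \<open>repl i n\<close>, and so it preserves all Boolean operations.  Outside \<open>\<Omega>\<close> the function is the identity,
  which lets it commute with other replacements on the whole type.
\<close>

definition repl :: "'v \<Rightarrow> 'v \<Rightarrow> 'w \<Rightarrow> 'w" where
  "repl i n a = (if a \<in> \<Omega> then THE b. T i a b \<and> b \<in> E i n else a)"

lemma closed_iff: "v \<in> V \<Longrightarrow> closed v X \<Longrightarrow> T v a b \<Longrightarrow> a \<in> X \<longleftrightarrow> b \<in> X"
  using T_sym unfolding closed_def by blast

lemma closed_Un: "closed v X \<Longrightarrow> closed v Y \<Longrightarrow> closed v (X \<union> Y)"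
  and closed_Int: "closed v X \<Longrightarrow> closed v Y \<Longrightarrow> closed v (X \<inter> Y)"
  unfolding closed_def by blast+

lemma closed_Diff: "v \<in> V \<Longrightarrow> closed v X \<Longrightarrow> closed v (\<Omega> - X)"
  using T_sym T_dom unfolding closed_def by blast

lemma closed_space: "v \<in> V \<Longrightarrow> closed v \<Omega>"
  using T_dom unfolding closed_def by blast

lemma cl_sub: "v \<in> V \<Longrightarrow> cl v X \<subseteq> \<Omega>"
  using T_dom unfolding cl_def by blast

lemma cl_Int_closed: "v \<in> V \<Longrightarrow> closed v Y \<Longrightarrow> cl v (X \<inter> Y) = cl v X \<inter> Y"
  using closed_iff unfolding cl_def by blast

lemma cl_mono: "X \<subseteq> Y \<Longrightarrow> cl v X \<subseteq> cl v Y"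
  unfolding cl_def by blast

lemma subset_cl: "v \<in> V \<Longrightarrow> X \<subseteq> \<Omega> \<Longrightarrow> X \<subseteq> cl v X"
  using T_refl unfolding cl_def by blast

lemma closed_cl: "v \<in> V \<Longrightarrow> w \<in> V \<Longrightarrow> closed v X \<Longrightarrow> closed v (cl w X)"
  using T_comm T_sym unfolding closed_def cl_def by blast

lemma closed_cl_self: "v \<in> V \<Longrightarrow> closed v (cl v X)"
  using T_trans T_sym unfolding closed_def cl_def by blast

text \<open>
  Since \<open>E j j\<close> is everything, \<open>a\<close> has an \<open>i\<close>-neighbour in both \<open>E i j\<close> and \<open>E j i\<close>; by uniqueness
  that neighbour is \<open>a\<close>.
\<close>

lemma E_sym:
  assumes "i \<in> V" "j \<in> V" "a \<in> E i j" shows "a \<in> E j i"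
proof (cases "i = j")
  case False
  have "a \<in> E j j" using assms E_refl E_sub by blast
  then obtain b where b: "b \<in> E j i" "b \<in> E i j" "T i a b"
    using E_comp[of j j i] assms False by auto
  then show ?thesis using E_uniq[of i j a b] assms False by blast
qed (use assms in simp)

lemma E_trans:
  assumes "i \<in> V" "j \<in> V" "k \<in> V" "a \<in> E i j" "a \<in> E j k" shows "a \<in> E i k"
proof (cases "j = i \<or> j = k")
  case False
  then show ?thesis using E_comp[of i k j] assms T_refl E_sub by blast
qed (use assms in auto)

lemma closed_E:
  assumes "i \<in> V" "j \<in> V" "k \<in> V" "k \<noteq> i" "k \<noteq> j" shows "closed k (E i j)"
proof -
  have "E i j = cl k (E i k \<inter> E k j)" using E_comp[of i j k] assms by (simp add: cl_def)
  then show ?thesis using closed_cl_self assms by simp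
qed

lemma E_total:
  assumes "i \<in> V" "j \<in> V" "i \<noteq> j" "a \<in> \<Omega>" shows "\<exists>b\<in>E i j. T i a b"
  using E_comp[of j j i] E_refl[of j] assms by auto

lemma repl_ex1:
  assumes "i \<in> V" "n \<in> V" "i \<noteq> n" "a \<in> \<Omega>" shows "\<exists>!b. T i a b \<and> b \<in> E i n"
proof -
  obtain b where b: "T i a b" "b \<in> E i n" using E_total[OF assms] by blast
  moreover have "c = b" if "T i a c \<and> c \<in> E i n" for c
    using that b E_uniq[of i n b c] T_sym T_trans assms by blast
  ultimately show ?thesis by blast
qed

lemma repl:
  assumes "i \<in> V" "n \<in> V" "i \<noteq> n" "a \<in> \<Omega>"
  shows "T i a (repl i n a)" "repl i n a \<in> E i n"
  using theI'[OF repl_ex1[OF assms]] assms by (auto simp: repl_def)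

lemma repl_eq:
  assumes "i \<in> V" "n \<in> V" "i \<noteq> n" "T i a b" "b \<in> E i n"
  shows "repl i n a = b"
  using the1_equality[OF repl_ex1[of i n a]] assms T_dom[of i a b] by (auto simp: repl_def)

lemma repl_in: "i \<in> V \<Longrightarrow> n \<in> V \<Longrightarrow> i \<noteq> n \<Longrightarrow> a \<in> \<Omega> \<Longrightarrow> repl i n a \<in> \<Omega>"
  using repl T_dom by blast

lemma repl_back:
  assumes "i \<in> V" "n \<in> V" "i \<noteq> n" "j \<in> V" "j \<noteq> i" "j \<noteq> n" "a \<in> \<Omega>" "T j (repl i n a) c"
  shows "\<exists>b. T j a b \<and> repl i n b = c"
proof -
  obtain b where b: "T j a b" "T i b c"
    using T_comm[OF _ _ repl(1)[OF assms(1-3,7)] assms(8)] assms by blast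
  have "c \<in> E i n" using repl(2)[OF assms(1-3,7)] closed_E[of i n j] assms
    unfolding closed_def by blast
  then show ?thesis using b repl_eq assms by blast
qed

lemma repl_forth:
  assumes "i \<in> V" "n \<in> V" "i \<noteq> n" "j \<in> V" "j \<noteq> i" "j \<noteq> n" "T j a b"
  shows "T j (repl i n a) (repl i n b)"
proof -
  have a: "a \<in> \<Omega>" using T_dom assms by blast
  obtain c where c: "T j (repl i n a) c" "T i c b"
    using T_comm[OF _ _ T_sym[OF _ repl(1)[OF assms(1-3) a]] assms(7)] assms by blast
  have "c \<in> E i n" using repl(2)[OF assms(1-3) a] closed_E[of i n j] c assms
    unfolding closed_def by blast
  then have "repl i n b = c" using repl_eq[of i n b c] c T_sym assms by blast
  then show ?thesis using c by simp
qed

text \<open>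
  Both sides are the \<open>j\<close>-neighbour of \<open>repl i n a\<close> in \<open>E j m\<close>: that set is closed under \<open>i\<close>-steps.
\<close>

lemma repl_commute:
  assumes "i \<in> V" "n \<in> V" "j \<in> V" "m \<in> V" "i \<noteq> n" "j \<noteq> m" "i \<noteq> j" "i \<noteq> m" "j \<noteq> n"
  shows "repl i n (repl j m a) = repl j m (repl i n a)"
proof (cases "a \<in> \<Omega>")
  case True
  have "T j (repl i n a) (repl i n (repl j m a))"
    using repl_forth[of i n j a] repl(1)[of j m a] True assms by blast
  moreover have "repl i n (repl j m a) \<in> E j m"
    using repl(2)[of j m a] repl(1)[of i n "repl j m a"] repl_in[of j m a] closed_E[of j m i] True assms
    unfolding closed_def by blast
  ultimately show ?thesis using repl_eq assms by metis
qed (simp add: repl_def)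

lemma repl_cong:
  assumes "i \<in> V" "n \<in> V" "m \<in> V" "i \<noteq> n" "i \<noteq> m" "a \<in> E n m"
  shows "repl i n a = repl i m a"
proof -
  have a: "a \<in> \<Omega>" using E_sub assms by blast
  have "repl i n a \<in> E n m" using closed_E[of n m i] repl(1)[of i n a] assms a
    unfolding closed_def by blast
  then have "repl i n a \<in> E i m" using E_trans[of i n m] repl(2)[of i n a] assms a by blast
  then show ?thesis using repl_eq[of i m a] repl(1)[of i n a] assms a by metis
qed

text \<open>
  If \<open>X\<close> does not depend on \<open>n\<close>, then \<open>\<exists>n. X(n)\<close> is the same as \<open>\<exists>i. X(i)\<close>: this is what permits \<open>n\<close> to
  serve as the name of a witness.
\<close>

lemma cl_repl:
  assumes "i \<in> V" "n \<in> V" "i \<noteq> n" "X \<subseteq> \<Omega>" "closed n X"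
  shows "cl n {a \<in> \<Omega>. repl i n a \<in> X} = cl i X"
proof (intro equalityI subsetI)
  fix a assume "a \<in> cl n {a \<in> \<Omega>. repl i n a \<in> X}"
  then obtain b where b: "T n a b" "b \<in> \<Omega>" "repl i n b \<in> X" by (auto simp: cl_def)
  then obtain c where "T i a c" "T n c (repl i n b)"
    using T_comm[OF _ _ b(1) repl(1)[of i n b]] assms by blast
  then show "a \<in> cl i X" using b assms T_sym unfolding cl_def closed_def by blast
next
  fix a assume "a \<in> cl i X"
  then obtain b where b: "T i a b" "b \<in> X" by (auto simp: cl_def)
  obtain c where c: "c \<in> E n i" "T n b c" using E_total[of n i b] assms b by blast
  have cX: "c \<in> X" using b c assms unfolding closed_def by blast
  obtain d where d: "T n a d" "T i d c" using T_comm[OF _ _ b(1) c(2)] assms by blast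
  have "repl i n d = c" using repl_eq[of i n d c] d c E_sym assms by blast
  then show "a \<in> cl n {a \<in> \<Omega>. repl i n a \<in> X}" using d cX assms T_dom unfolding cl_def by blast
qed

end

section \<open>Substitution of names for finitely many indices\<close>

text \<open>
  The indices in \<open>\<Gamma>\<close> are replaced by names \<open>\<nu> n\<close>, which lie outside \<open>\<Gamma>\<close>.  Sources and targets being
  disjoint, the single replacements commute and their order is irrelevant.
\<close>

locale cyl_frame_names = cyl_frame +
  fixes \<Gamma> :: "'a set" and \<nu> :: "nat \<Rightarrow> 'a"
  assumes fin_\<Gamma>: "finite \<Gamma>" and \<Gamma>_sub: "\<Gamma> \<subseteq> V" and inj_\<nu>: "inj \<nu>"
    and \<nu>_in: "\<nu> n \<in> V" and \<nu>_notin: "\<nu> n \<notin> \<Gamma>"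
begin

definition sim :: "('a \<Rightarrow> nat) \<Rightarrow> 'a set \<Rightarrow> 'b \<Rightarrow> 'b" where
  "sim q D a = Finite_Set.fold (\<lambda>i. repl i (\<nu> (q i))) a D"

definition pre :: "('a \<Rightarrow> nat) \<Rightarrow> 'a set \<Rightarrow> 'b set \<Rightarrow> 'b set" where
  "pre q D X = {a \<in> \<Omega>. sim q D a \<in> X}"

lemma \<Gamma>_simps: "i \<in> \<Gamma> \<Longrightarrow> i \<in> V" "i \<in> \<Gamma> \<Longrightarrow> i \<noteq> \<nu> n" "i \<in> \<Gamma> \<Longrightarrow> \<nu> n \<noteq> i"
  using \<Gamma>_sub \<nu>_notin by auto

lemma repl_comp_fun_commute: "comp_fun_commute_on \<Gamma> (\<lambda>i. repl i (\<nu> (q i)))"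
proof
  fix x y assume "x \<in> \<Gamma>" "y \<in> \<Gamma>"
  then show "repl y (\<nu> (q y)) \<circ> repl x (\<nu> (q x)) = repl x (\<nu> (q x)) \<circ> repl y (\<nu> (q y))"
    using \<Gamma>_simps \<nu>_in by (cases "x = y") (simp_all add: fun_eq_iff repl_commute)
qed

lemma sim_empty [simp]: "sim q {} a = a"
  by (simp add: sim_def)

lemma sim_insert:
  assumes "insert j D \<subseteq> \<Gamma>" "j \<notin> D"
  shows "sim q (insert j D) a = repl j (\<nu> (q j)) (sim q D a)"
  unfolding sim_def
  using comp_fun_commute_on.fold_insert[OF repl_comp_fun_commute assms(1) _ assms(2)]
    assms(1) fin_\<Gamma> finite_subset[of D \<Gamma>] by blast

lemma sim_insert2:
  assumes "insert j D \<subseteq> \<Gamma>" "j \<notin> D"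
  shows "sim q (insert j D) a = sim q D (repl j (\<nu> (q j)) a)"
  unfolding sim_def
  using comp_fun_commute_on.fold_insert2[OF repl_comp_fun_commute assms(1) _ assms(2)]
    assms(1) fin_\<Gamma> finite_subset[of D \<Gamma>] by blast

lemma subset_induct [consumes 1, case_names empty insert]:
  assumes "D \<subseteq> \<Gamma>" "P {}" "\<And>j D. insert j D \<subseteq> \<Gamma> \<Longrightarrow> j \<notin> D \<Longrightarrow> P D \<Longrightarrow> P (insert j D)"
  shows "P D"
proof -
  have "finite D" using assms(1) fin_\<Gamma> finite_subset by blast
  then show ?thesis using assms(1)
    by (induction D rule: finite_induct) (use assms(2,3) in auto)
qed

lemma sim_cong: "D \<subseteq> \<Gamma> \<Longrightarrow> (\<And>i. i \<in> D \<Longrightarrow> q i = q' i) \<Longrightarrow> sim q D a = sim q' D a"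
  by (induction D rule: subset_induct) (auto simp: sim_insert)

lemma sim_in: "D \<subseteq> \<Gamma> \<Longrightarrow> a \<in> \<Omega> \<Longrightarrow> sim q D a \<in> \<Omega>"
  by (induction D rule: subset_induct) (auto simp: sim_insert \<Gamma>_simps \<nu>_in intro!: repl_in)

text \<open>
  Forth and back: \<open>sim q D\<close> is a bisimulation for every index \<open>j\<close> that the substitution neither
  replaces nor introduces, hence it commutes with cylindrification by \<open>j\<close>.
\<close>

lemma sim_forth:
  assumes "D \<subseteq> \<Gamma>" "j \<in> V" "j \<notin> D" "\<And>i. i \<in> D \<Longrightarrow> j \<noteq> \<nu> (q i)" "T j a b"
  shows "T j (sim q D a) (sim q D b)"
  using assms
  by (induction D rule: subset_induct) (auto simp: sim_insert \<Gamma>_simps \<nu>_in intro!: repl_forth)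

lemma sim_back:
  assumes "D \<subseteq> \<Gamma>" "j \<in> V" "j \<notin> D" "\<And>i. i \<in> D \<Longrightarrow> j \<noteq> \<nu> (q i)" "a \<in> \<Omega>" "T j (sim q D a) c"
  shows "\<exists>b. T j a b \<and> sim q D b = c"
  using assms
proof (induction D arbitrary: c rule: subset_induct)
  case (insert i D)
  then have "T j (repl i (\<nu> (q i)) (sim q D a)) c" by (simp add: sim_insert)
  then obtain b where b: "T j (sim q D a) b" "repl i (\<nu> (q i)) b = c"
    using repl_back[of i "\<nu> (q i)" j "sim q D a" c] insert.prems insert.hyps \<Gamma>_simps \<nu>_in
      sim_in[of D a q] by auto
  then obtain b' where "T j a b'" "sim q D b' = b" using insert.IH[of b] insert.prems by auto
  then show ?case using b insert.hyps sim_insert by blast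
qed auto

lemma pre_cl:
  assumes "D \<subseteq> \<Gamma>" "j \<in> \<Gamma>" "j \<notin> D"
  shows "pre q D (cl j X) = cl j (pre q D X)"
proof (intro equalityI subsetI)
  fix a assume "a \<in> pre q D (cl j X)"
  then obtain c where c: "a \<in> \<Omega>" "T j (sim q D a) c" "c \<in> X" by (auto simp: pre_def cl_def)
  then obtain b where "T j a b" "sim q D b = c"
    using sim_back[of D j q a c] assms \<Gamma>_simps by auto
  then show "a \<in> cl j (pre q D X)" using c T_dom assms \<Gamma>_simps unfolding pre_def cl_def by blast
next
  fix a assume "a \<in> cl j (pre q D X)"
  then obtain b where "T j a b" "sim q D b \<in> X" by (auto simp: pre_def cl_def)
  then show "a \<in> pre q D (cl j X)"
    using sim_forth[of D j q a b] T_dom[of j a b] assms \<Gamma>_simps by (auto simp: pre_def cl_def)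
qed

lemma pre_insert:
  assumes "insert j D \<subseteq> \<Gamma>" "j \<notin> D"
  shows "pre q (insert j D) X = {a \<in> \<Omega>. repl j (\<nu> (q j)) a \<in> pre q D X}"
proof -
  have "repl j (\<nu> (q j)) a \<in> \<Omega>" if "a \<in> \<Omega>" for a
    using repl_in[of j "\<nu> (q j)" a] assms that \<Gamma>_simps \<nu>_in by auto
  then show ?thesis using sim_insert2[OF assms] by (auto simp: pre_def)
qed

lemma sim_closed:
  assumes "D \<subseteq> \<Gamma>" "a \<in> \<Omega>" "\<And>i. i \<in> D \<Longrightarrow> closed i X"
  shows "sim q D a \<in> X \<longleftrightarrow> a \<in> X"
  using assms
proof (induction D rule: subset_induct)
  case (insert j D)
  have "T j (sim q D a) (sim q (insert j D) a)"
    using repl(1)[of j "\<nu> (q j)" "sim q D a"] insert.prems insert.hyps \<Gamma>_simps \<nu>_in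
      sim_in[of D a q] by (auto simp: sim_insert)
  then have "sim q D a \<in> X \<longleftrightarrow> sim q (insert j D) a \<in> X"
    using closed_iff[of j X] insert.prems insert.hyps \<Gamma>_simps by auto
  then show ?case using insert by auto
qed auto

lemma pre_closed: "X \<subseteq> \<Omega> \<Longrightarrow> (\<And>i. i \<in> \<Gamma> \<Longrightarrow> closed i X) \<Longrightarrow> pre q \<Gamma> X = X"
  using sim_closed[of \<Gamma> _ X q] by (auto simp: pre_def)

text \<open>
  The element \<open>cl j X\<close> does not depend on \<open>j\<close>, so the replacement of \<open>j\<close> may be dropped before the
  remaining substitution is moved inside.
\<close>

lemma pre_cl_\<Gamma>:
  assumes "j \<in> \<Gamma>" "X \<subseteq> \<Omega>"
  shows "pre q \<Gamma> (cl j X) = cl j (pre q (\<Gamma> - {j}) X)"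
proof -
  have i: "insert j (\<Gamma> - {j}) = \<Gamma>" using assms by auto
  have s: "sim q \<Gamma> a = repl j (\<nu> (q j)) (sim q (\<Gamma> - {j}) a)" for a
    using sim_insert[of j "\<Gamma> - {j}" q a] i by auto
  have "sim q \<Gamma> a \<in> cl j X \<longleftrightarrow> sim q (\<Gamma> - {j}) a \<in> cl j X" if "a \<in> \<Omega>" for a
    using closed_iff[of j "cl j X"] closed_cl_self[of j X] s[of a] assms \<Gamma>_simps \<nu>_in
      repl(1)[of j "\<nu> (q j)" "sim q (\<Gamma> - {j}) a"] sim_in[of "\<Gamma> - {j}" a q] that by auto
  then have "pre q \<Gamma> (cl j X) = pre q (\<Gamma> - {j}) (cl j X)" by (auto simp: pre_def)
  then show ?thesis using pre_cl[of "\<Gamma> - {j}" j q X] assms by auto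
qed

lemma sim_diag:
  assumes "D \<subseteq> \<Gamma>" "i \<in> D" "a \<in> \<Omega>" shows "sim q D a \<in> E i (\<nu> (q i))"
proof -
  have i: "insert i (D - {i}) = D" using assms by auto
  have "i \<in> \<Gamma>" using assms by auto
  then show ?thesis
    using sim_insert[of i "D - {i}" q a] i repl(2)[of i "\<nu> (q i)" "sim q (D - {i}) a"]
      sim_in[of "D - {i}" a q] assms \<Gamma>_simps \<nu>_in by auto
qed

lemma sim_E_names:
  assumes "D \<subseteq> \<Gamma>" "a \<in> \<Omega>"
  shows "sim q D a \<in> E (\<nu> n) (\<nu> m) \<longleftrightarrow> a \<in> E (\<nu> n) (\<nu> m)"
  using assms \<nu>_notin by (intro sim_closed closed_E) (auto simp: \<nu>_in \<Gamma>_simps)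

lemma pre_E:
  assumes "i \<in> \<Gamma>" "j \<in> \<Gamma>"
  shows "pre q \<Gamma> (E i j) = E (\<nu> (q i)) (\<nu> (q j))"
proof -
  have "sim q \<Gamma> a \<in> E i j \<longleftrightarrow> a \<in> E (\<nu> (q i)) (\<nu> (q j))" if a: "a \<in> \<Omega>" for a
  proof -
    let ?b = "sim q \<Gamma> a"
    have "?b \<in> E i (\<nu> (q i))" "?b \<in> E j (\<nu> (q j))" using sim_diag assms a by auto
    then have "?b \<in> E i j \<longleftrightarrow> ?b \<in> E (\<nu> (q i)) (\<nu> (q j))"
      using E_sym E_trans \<Gamma>_simps(1)[OF assms(1)] \<Gamma>_simps(1)[OF assms(2)] \<nu>_in by meson
    then show ?thesis using sim_E_names a by auto
  qed
  then show ?thesis using E_sub \<nu>_in by (auto simp: pre_def)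
qed

lemma sim_eq:
  assumes "D \<subseteq> \<Gamma>" "a \<in> \<Omega>" "\<And>i. i \<in> D \<Longrightarrow> a \<in> E (\<nu> (q i)) (\<nu> (q' i))"
  shows "sim q D a = sim q' D a"
  using assms
proof (induction D rule: subset_induct)
  case (insert j D)
  have "sim q D a \<in> E (\<nu> (q j)) (\<nu> (q' j))" using sim_E_names insert.prems insert.hyps by auto
  then show ?case
    using repl_cong[of j "\<nu> (q j)" "\<nu> (q' j)" "sim q D a"] insert \<Gamma>_simps \<nu>_in
    by (auto simp: sim_insert)
qed auto

lemma closed_pre:
  assumes "D \<subseteq> \<Gamma>" "closed (\<nu> n) X" "n \<notin> q ` D"
  shows "closed (\<nu> n) (pre q D X)"
  unfolding closed_def
proof (intro ballI allI impI)
  fix a b assume ab: "a \<in> pre q D X" "T (\<nu> n) a b"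
  have "T (\<nu> n) (sim q D a) (sim q D b)"
    using assms ab inj_\<nu> \<nu>_notin by (intro sim_forth) (auto simp: \<nu>_in dest: injD)
  then show "b \<in> pre q D X"
    using assms ab T_dom[of "\<nu> n" a b] \<nu>_in unfolding closed_def pre_def by auto
qed

end

section \<open>Robinson's construction with Henkin witnesses\<close>

locale cyl_frame_interpolants = cyl_frame_names +
  fixes R :: "'b set set"
  assumes R_sub: "r \<in> R \<Longrightarrow> r \<subseteq> \<Omega>"
    and R_Un: "r \<in> R \<Longrightarrow> s \<in> R \<Longrightarrow> r \<union> s \<in> R"
    and R_Diff: "r \<in> R \<Longrightarrow> \<Omega> - r \<in> R"
    and R_cl: "r \<in> R \<Longrightarrow> cl (\<nu> n) r \<in> R"
    and R_repl: "i \<in> \<Gamma> \<Longrightarrow> r \<in> R \<Longrightarrow> {a \<in> \<Omega>. repl i (\<nu> n) a \<in> r} \<in> R"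
    and R_E: "v \<in> \<Gamma> \<union> range \<nu> \<Longrightarrow> w \<in> \<Gamma> \<union> range \<nu> \<Longrightarrow> E v w \<in> R"
begin

definition sep :: "'b set \<Rightarrow> 'b set \<Rightarrow> bool" where
  "sep b c \<longleftrightarrow> (\<exists>r\<in>R. b \<subseteq> r \<and> c \<inter> r = {})"

definition cofree :: "'b set \<Rightarrow> bool" where
  "cofree X \<longleftrightarrow> X \<subseteq> \<Omega> \<and> finite {n. \<not> closed (\<nu> n) X}"

text \<open>
  A proper filter on all sets that decides the members of \<open>\<D>\<close> and provides a named witness for
  each of their cylindrifications.
\<close>

definition henkin :: "'b set set \<Rightarrow> 'b set set \<Rightarrow> bool" where
  "henkin \<D> F \<longleftrightarrow> {} \<notin> F \<and> (\<forall>X\<in>F. \<forall>Y\<in>F. X \<inter> Y \<in> F) \<and> (\<forall>X\<in>F. \<forall>Y. X \<subseteq> Y \<longrightarrow> Y \<in> F) \<and>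
     (\<forall>X\<in>\<D>. X \<in> F \<or> \<Omega> - X \<in> F) \<and>
     (\<forall>X\<in>\<D>. \<forall>j\<in>\<Gamma>. cl j X \<in> F \<longrightarrow> (\<exists>n. {a \<in> \<Omega>. repl j (\<nu> n) a \<in> X} \<in> F))"

lemma R_Int: "r \<in> R \<Longrightarrow> s \<in> R \<Longrightarrow> r \<inter> s \<in> R"
proof -
  assume rs: "r \<in> R" "s \<in> R"
  then have "r \<inter> s = \<Omega> - ((\<Omega> - r) \<union> (\<Omega> - s))" using R_sub by blast
  then show ?thesis using rs R_Un R_Diff by presburger
qed

lemma R_empty: "{} \<in> R"
proof -
  have E: "E (\<nu> 0) (\<nu> 0) \<in> R" using R_E by blast
  show ?thesis using R_Int[OF E R_Diff[OF E]] by (simp add: Int_Diff)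
qed

lemma R_pre: "D \<subseteq> \<Gamma> \<Longrightarrow> r \<in> R \<Longrightarrow> pre q D r \<in> R"
proof (induction D rule: subset_induct)
  case empty
  then have "pre q {} r = r" using R_sub by (auto simp: pre_def)
  then show ?case using empty by simp
qed (auto simp: pre_insert R_repl)

lemma sep_sym:
  assumes "b \<subseteq> \<Omega>" "c \<subseteq> \<Omega>" "sep b c" shows "sep c b"
proof -
  obtain r where r: "r \<in> R" "b \<subseteq> r" "c \<inter> r = {}" using assms sep_def by auto
  then have "c \<subseteq> \<Omega> - r" "b \<inter> (\<Omega> - r) = {}" using assms by auto
  then show ?thesis using R_Diff[OF r(1)] sep_def by blast
qed

lemma sep_decide: "sep (b \<inter> X) c \<Longrightarrow> sep (b - X) c \<Longrightarrow> sep b c"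
proof -
  assume "sep (b \<inter> X) c" "sep (b - X) c"
  then obtain r s where "r \<in> R" "s \<in> R" "b \<inter> X \<subseteq> r" "b - X \<subseteq> s" "c \<inter> r = {}" "c \<inter> s = {}"
    unfolding sep_def by blast
  then have "r \<union> s \<in> R" "b \<subseteq> r \<union> s" "c \<inter> (r \<union> s) = {}" using R_Un by auto
  then show ?thesis unfolding sep_def by blast
qed

text \<open>
  If \<open>r\<close> separates \<open>b \<inter> Y\<close> from \<open>c\<close> and neither \<open>b\<close> nor \<open>c\<close> depends on the name \<open>n\<close>, then quantifying \<open>n\<close>
  away in \<open>r\<close> gives a separator of \<open>b\<close> from \<open>c\<close>, provided that \<open>b\<close> implies \<open>\<exists>n. Y\<close>.  So adding \<open>Y\<close>
  with a fresh name is harmless.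
\<close>

lemma sep_fresh:
  assumes "closed (\<nu> n) b" "closed (\<nu> n) c" "b \<subseteq> cl (\<nu> n) Y" "sep (b \<inter> Y) c"
  shows "sep b c"
proof -
  obtain r where r: "r \<in> R" "Y \<inter> b \<subseteq> r" "r \<inter> c = {}" using assms(4) unfolding sep_def by blast
  have "cl (\<nu> n) Y \<inter> b \<subseteq> cl (\<nu> n) r"
    using cl_mono[OF r(2), of "\<nu> n"] cl_Int_closed[OF \<nu>_in assms(1), of Y] by simp
  moreover have "cl (\<nu> n) r \<inter> c = {}"
    using cl_Int_closed[OF \<nu>_in assms(2), of r] r(3) by (simp add: cl_def)
  ultimately show ?thesis using R_cl[OF r(1)] assms(3) unfolding sep_def by blast
qed

lemma cofreeI:
  assumes "X \<subseteq> \<Omega>" "finite A" "\<And>n. n \<notin> A \<Longrightarrow> closed (\<nu> n) X"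
  shows "cofree X"
proof -
  have "{n. \<not> closed (\<nu> n) X} \<subseteq> A" using assms(3) by blast
  then show ?thesis unfolding cofree_def using finite_subset[OF _ assms(2)] assms(1) by simp
qed

lemma cofree_Int: "cofree X \<Longrightarrow> cofree Y \<Longrightarrow> cofree (X \<inter> Y)"
  by (rule cofreeI[of _ "{n. \<not> closed (\<nu> n) X} \<union> {n. \<not> closed (\<nu> n) Y}"])
    (auto simp: cofree_def closed_Int)

lemma cofree_Compl: "cofree X \<Longrightarrow> cofree (\<Omega> - X)"
  by (rule cofreeI[of _ "{n. \<not> closed (\<nu> n) X}"])
    (auto simp: cofree_def closed_Diff \<nu>_in)

lemma cofree_Diff: "cofree X \<Longrightarrow> cofree Y \<Longrightarrow> cofree (X - Y)"
proof -
  assume "cofree X" "cofree Y"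
  then have "cofree (X \<inter> (\<Omega> - Y))" "X \<inter> (\<Omega> - Y) = X - Y"
    using cofree_Int cofree_Compl by (auto simp: cofree_def)
  then show ?thesis by simp
qed

lemma cofree_cl: "cofree X \<Longrightarrow> j \<in> \<Gamma> \<Longrightarrow> cofree (cl j X)"
  by (rule cofreeI[of _ "{n. \<not> closed (\<nu> n) X}"])
    (auto simp: cofree_def closed_cl \<nu>_in \<Gamma>_simps(1) dest: subsetD[OF cl_sub, rotated])

lemma cofree_pre: "cofree X \<Longrightarrow> D \<subseteq> \<Gamma> \<Longrightarrow> cofree (pre q D X)"
proof -
  assume a: "cofree X" "D \<subseteq> \<Gamma>"
  have "finite ({n. \<not> closed (\<nu> n) X} \<union> q ` D)"
    using a fin_\<Gamma> finite_subset[of D \<Gamma>] by (simp add: cofree_def)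
  then show ?thesis
    by (rule cofreeI[rotated]) (auto simp: closed_pre[OF a(2)], auto simp: pre_def)
qed

lemma repl_pre: "j \<in> \<Gamma> \<Longrightarrow> {a \<in> \<Omega>. repl j (\<nu> n) a \<in> X} = pre (\<lambda>_. n) {j} X"
  using sim_insert[of j "{}" "\<lambda>_. n"] by (auto simp: pre_def)

lemma cofree_E: 
  assumes "v \<in> V" "w \<in> V" shows "cofree (E v w)"
proof -
  have "{n. \<not> closed (\<nu> n) (E v w)} \<subseteq> \<nu> -` {v, w}" using closed_E[of v w] assms \<nu>_in by auto
  moreover have "finite (\<nu> -` {v, w})" using inj_\<nu> by (intro finite_vimageI) auto
  ultimately show ?thesis by (intro cofreeI[OF E_sub[OF assms]]) auto
qed

lemma cofree_fresh:
  assumes "cofree X" "cofree Y" "cofree Z"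
  shows "\<exists>n. closed (\<nu> n) X \<and> closed (\<nu> n) Y \<and> closed (\<nu> n) Z"
proof -
  have "finite ({n. \<not> closed (\<nu> n) X} \<union> {n. \<not> closed (\<nu> n) Y} \<union> {n. \<not> closed (\<nu> n) Z})"
    using assms by (auto simp: cofree_def)
  from ex_new_if_finite[OF infinite_UNIV_nat this] show ?thesis by simp
qed

text \<open>
  The requirement \<open>(X, j)\<close> is met by \<open>c\<close> when \<open>c\<close> decides \<open>X\<close>, and either refutes \<open>c\<^sub>j X\<close> or forces a
  named witness for it.
\<close>

definition settles :: "'b set \<Rightarrow> 'b set \<times> 'a \<Rightarrow> bool" where
  "settles c = (\<lambda>(X, j). (c \<subseteq> X \<or> c \<inter> X = {}) \<and>
     (j \<in> \<Gamma> \<longrightarrow> c \<inter> cl j X = {} \<or> (\<exists>n. c \<subseteq> {a \<in> \<Omega>. repl j (\<nu> n) a \<in> X})))"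

lemma settle:
  assumes b: "cofree b" "cofree c" "\<not> sep b c" and X: "cofree X"
  shows "\<exists>b'\<subseteq>b. cofree b' \<and> \<not> sep b' c \<and> settles b' (X, j)"
proof -
  obtain b1 where b1: "b1 \<subseteq> b" "cofree b1" "\<not> sep b1 c" "b1 \<subseteq> X \<or> b1 \<inter> X = {}"
  proof (cases "sep (b \<inter> X) c")
    case True
    then show ?thesis
      using that[of "b - X"] sep_decide[of b X c] b cofree_Diff[of b X] X by blast
  next
    case False
    then show ?thesis using that[of "b \<inter> X"] b cofree_Int[of b X] X by blast
  qed
  consider "j \<notin> \<Gamma>" | "j \<in> \<Gamma>" "\<not> sep (b1 - cl j X) c" | "j \<in> \<Gamma>" "\<not> sep (b1 \<inter> cl j X) c"
    using sep_decide[of b1 "cl j X" c] b1 by blast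
  then show ?thesis
  proof cases
    case 1
    then show ?thesis using b1 by (auto simp: settles_def)
  next
    case 2
    then show ?thesis using b1 cofree_Diff[OF _ cofree_cl[OF X]]
      by (intro exI[of _ "b1 - cl j X"]) (auto simp: settles_def)
  next
    case 3
    let ?b = "b1 \<inter> cl j X"
    have fb: "cofree ?b" using cofree_Int[OF _ cofree_cl[OF X]] b1 3 by blast
    obtain n where n: "closed (\<nu> n) ?b" "closed (\<nu> n) c" "closed (\<nu> n) X"
      using cofree_fresh[OF fb b(2) X] by blast
    let ?Y = "{a \<in> \<Omega>. repl j (\<nu> n) a \<in> X}"
    have "cl (\<nu> n) ?Y = cl j X"
      using cl_repl[of j "\<nu> n" X] n 3 X \<Gamma>_simps \<nu>_in by (auto simp: cofree_def)
    then have "\<not> sep (?b \<inter> ?Y) c" using sep_fresh[OF n(1,2), of ?Y] 3 by auto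
    moreover have "cofree (?b \<inter> ?Y)"
      using cofree_Int[OF fb] cofree_pre[OF X, of "{j}"] repl_pre 3 by auto
    ultimately show ?thesis using b1
      by (intro exI[of _ "?b \<inter> ?Y"]) (auto simp: settles_def)
  qed
qed

lemma settle_both:
  assumes b: "cofree b" "cofree c" "\<not> sep b c" and X: "cofree (fst d)"
  shows "\<exists>b' c'. b' \<subseteq> b \<and> c' \<subseteq> c \<and> cofree b' \<and> cofree c' \<and> \<not> sep b' c' \<and> settles b' d \<and> settles c' d"
proof -
  obtain X j where d: "d = (X, j)" by (cases d)
  obtain b' where b': "b' \<subseteq> b" "cofree b'" "\<not> sep b' c" "settles b' d"
    using settle[OF b, of X j] X d by auto
  have "\<not> sep c b'" using sep_sym b' b by (auto simp: cofree_def)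
  then obtain c' where c': "c' \<subseteq> c" "cofree c'" "\<not> sep c' b'" "settles c' d"
    using settle[of c b' X j] X d b b' by auto
  then have "\<not> sep b' c'" using sep_sym b' by (auto simp: cofree_def)
  then show ?thesis using b' c' by blast
qed

lemma henkin_limit:
  fixes b :: "nat \<Rightarrow> 'b set"
  assumes dec: "\<And>n. b (Suc n) \<subseteq> b n" and ne: "\<And>n. b n \<noteq> {}" and sub: "\<And>n. b n \<subseteq> \<Omega>"
    and settled: "\<And>X j. X \<in> \<D> \<Longrightarrow> j \<in> insert undefined \<Gamma> \<Longrightarrow> \<exists>n. settles (b n) (X, j)"
  shows "henkin \<D> {X. \<exists>n. b n \<subseteq> X}"
proof -
  have anti: "b n \<subseteq> b m" if "m \<le> n" for m n using dec that by (rule lift_Suc_antimono_le)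
  have meet: "\<exists>k. b k \<subseteq> X \<inter> Y" if "b m \<subseteq> X" "b n \<subseteq> Y" for m n X Y
    using that anti[of m "max m n"] anti[of n "max m n"] by (intro exI[of _ "max m n"]) auto
  show ?thesis unfolding henkin_def
  proof (intro conjI ballI allI impI)
    show "{} \<notin> {X. \<exists>n. b n \<subseteq> X}" using ne by auto
  next
    fix X Y assume "X \<in> {X. \<exists>n. b n \<subseteq> X}" "Y \<in> {X. \<exists>n. b n \<subseteq> X}"
    then show "X \<inter> Y \<in> {X. \<exists>n. b n \<subseteq> X}" using meet by blast
  next
    fix X Y assume "X \<in> {X. \<exists>n. b n \<subseteq> X}" "X \<subseteq> Y"
    then show "Y \<in> {X. \<exists>n. b n \<subseteq> X}" by blast
  next
    fix X assume "X \<in> \<D>"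
    then obtain n where "settles (b n) (X, undefined)" using settled[of X undefined] by auto
    then have "b n \<subseteq> X \<or> b n \<subseteq> \<Omega> - X" using sub[of n] by (auto simp: settles_def)
    then show "X \<in> {X. \<exists>n. b n \<subseteq> X} \<or> \<Omega> - X \<in> {X. \<exists>n. b n \<subseteq> X}" by blast
  next
    fix X j assume X: "X \<in> \<D>" "j \<in> \<Gamma>" "cl j X \<in> {X. \<exists>n. b n \<subseteq> X}"
    then obtain n m where n: "settles (b n) (X, j)" "b m \<subseteq> cl j X" using settled[of X j] by auto
    then obtain k where "b k \<subseteq> b n \<inter> cl j X" using meet[of n "b n" m "cl j X"] by blast
    then have "b n \<inter> cl j X \<noteq> {}" using ne[of k] by blast
    then show "\<exists>n. {a \<in> \<Omega>. repl j (\<nu> n) a \<in> X} \<in> {X. \<exists>n. b n \<subseteq> X}"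
      using n X by (auto simp: settles_def)
  qed
qed

text \<open>
  The requirements are met one after the other on both sides, keeping the two sets unseparated.
  The filters of the two limits agree on a decided \<open>r\<close> in \<open>R\<close>: otherwise \<open>r\<close> or its complement
  would separate two sets of the sequence.
\<close>

theorem joint_henkin:
  assumes D: "countable \<D>" "\<And>X. X \<in> \<D> \<Longrightarrow> cofree X"
    and b: "cofree b" "cofree c" "\<not> sep b c"
  shows "\<exists>F G. henkin \<D> F \<and> henkin \<D> G \<and> b \<in> F \<and> c \<in> G \<and> (\<forall>r\<in>R \<inter> \<D>. r \<in> F \<longleftrightarrow> r \<in> G)"
proof (cases "\<D> = {}")
  case True
  have "b \<noteq> {}" "c \<noteq> {}" using b R_empty R_Diff[OF R_empty] by (auto simp: sep_def cofree_def)
  then have "henkin \<D> {X. b \<subseteq> X}" "henkin \<D> {X. c \<subseteq> X}" using True by (auto simp: henkin_def)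
  then show ?thesis using True by blast
next
  case False
  \<comment> \<open>The index \<open>undefined\<close> keeps the list of requirements nonempty when \<open>\<Gamma>\<close> is empty.\<close>
  define d where "d = from_nat_into (\<D> \<times> insert undefined \<Gamma>)"
  have cnt: "countable (\<D> \<times> insert undefined \<Gamma>)" using D fin_\<Gamma> by (simp add: countable_finite)
  have rng: "range d = \<D> \<times> insert undefined \<Gamma>" unfolding d_def
    using range_from_nat_into[OF _ cnt] False by blast
  have fd: "cofree (fst (d n))" for n using D(2) rng rangeI[of d n] by (auto simp: mem_Times_iff)
  define P where "P = (\<lambda>(n::nat) (bc::'b set \<times> 'b set).
     cofree (fst bc) \<and> cofree (snd bc) \<and> \<not> sep (fst bc) (snd bc) \<and> (n = 0 \<longrightarrow> bc = (b, c)))"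
  define Q where "Q = (\<lambda>n (bc::'b set \<times> 'b set) bc'. fst bc' \<subseteq> fst bc \<and> snd bc' \<subseteq> snd bc \<and>
     settles (fst bc') (d n) \<and> settles (snd bc') (d n))"
  have "\<exists>f. \<forall>n. P n (f n) \<and> Q n (f n) (f (Suc n))"
  proof (rule dependent_nat_choice)
    show "\<exists>x. P 0 x" using b by (auto simp: P_def)
  next
    fix x n assume "P n x"
    then obtain b' c' where "b' \<subseteq> fst x \<and> c' \<subseteq> snd x \<and> cofree b' \<and> cofree c' \<and> \<not> sep b' c' \<and>
        settles b' (d n) \<and> settles c' (d n)"
      using settle_both[OF _ _ _ fd, of "fst x" "snd x" n] by (auto simp: P_def)
    then show "\<exists>y. P (Suc n) y \<and> Q n x y" by (auto simp: P_def Q_def)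
  qed
  then obtain f where f: "\<And>n. P n (f n)" "\<And>n. Q n (f n) (f (Suc n))" by blast
  define B where "B = (\<lambda>n. fst (f n))"
  define C where "C = (\<lambda>n. snd (f n))"
  have B: "B (Suc n) \<subseteq> B n" "C (Suc n) \<subseteq> C n" "settles (B (Suc n)) (d n)" "settles (C (Suc n)) (d n)"
    "cofree (B n)" "cofree (C n)" "\<not> sep (B n) (C n)" "B 0 = b" "C 0 = c" for n
    using f(1)[of n] f(2)[of n] f(1)[of 0] by (auto simp: P_def Q_def B_def C_def)
  have ne: "B n \<noteq> {}" "C n \<noteq> {}" for n
    using B(5-7)[of n] R_empty R_Diff[OF R_empty] by (auto simp: sep_def cofree_def)
  have sub: "B n \<subseteq> \<Omega>" "C n \<subseteq> \<Omega>" for n using B(5,6)[of n] by (auto simp: cofree_def)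
  have st: "\<exists>n. settles (B n) (X, j) \<and> settles (C n) (X, j)"
    if "X \<in> \<D>" "j \<in> insert undefined \<Gamma>" for X j
  proof -
    have "(X, j) \<in> range d" using rng that by blast
    then show ?thesis using B(3,4) by (metis rangeE)
  qed
  let ?F = "{X. \<exists>n. B n \<subseteq> X}" and ?G = "{X. \<exists>n. C n \<subseteq> X}"
  have h: "henkin \<D> ?F" "henkin \<D> ?G"
    by (rule henkin_limit; use B(1,2) ne sub st in blast)+
  have agree: False if r: "r \<in> R" "B n \<subseteq> r" "C m \<subseteq> \<Omega> - r" for r n m
  proof -
    have "B (max n m) \<subseteq> r" "C (max n m) \<inter> r = {}"
      using lift_Suc_antimono_le[of B n "max n m", OF B(1)]
        lift_Suc_antimono_le[of C m "max n m", OF B(2)] r by auto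
    then show False using B(7)[of "max n m"] r(1) by (auto simp: sep_def)
  qed
  have "r \<in> ?F \<longleftrightarrow> r \<in> ?G" if r: "r \<in> R \<inter> \<D>" for r
  proof
    assume "r \<in> ?F"
    moreover have "r \<in> ?G \<or> \<Omega> - r \<in> ?G" using h(2) r by (auto simp: henkin_def)
    ultimately show "r \<in> ?G" using agree[of r] r by blast
  next
    assume "r \<in> ?G"
    moreover have "r \<in> ?F \<or> \<Omega> - r \<in> ?F" using h(1) r by (auto simp: henkin_def)
    moreover have "\<Omega> - (\<Omega> - r) = r" using R_sub r by blast
    ultimately show "r \<in> ?F" using agree[of "\<Omega> - r"] R_Diff r by fastforce
  qed
  moreover have "b \<in> ?F" "c \<in> ?G" using B(8,9) by auto
  ultimately show ?thesis using h by blast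
qed

text \<open>
  The sets that must be decided so that the names form a model correct for the members of \<open>\<X>\<close>.
  The substitutions are restricted to \<open>\<Gamma>\<close>, which keeps the collection countable.
\<close>

definition tests :: "'b set set \<Rightarrow> 'b set set" where
  "tests \<X> = (\<Union>D\<in>Pow \<Gamma>. \<Union>q\<in>\<Gamma> \<rightarrow>\<^sub>E UNIV. pre q D ` \<X>) \<union> (\<Union>n. \<Union>m. {E (\<nu> n) (\<nu> m)})"

lemma countable_PiE_finite:
  assumes "finite S" "countable A" shows "countable (S \<rightarrow>\<^sub>E A)"
  using assms(1)
proof (induction S rule: finite_induct)
  case (insert x S)
  then show ?case using assms(2) unfolding PiE_insert_eq by (intro countable_image countable_SIGMA)
qed simp

lemma countable_tests:
  assumes "countable \<X>" shows "countable (tests \<X>)"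
proof -
  have "countable (\<Gamma> \<rightarrow>\<^sub>E (UNIV::nat set))" using fin_\<Gamma> by (intro countable_PiE_finite) auto
  moreover have "countable (Pow \<Gamma>)" using fin_\<Gamma> by (simp add: countable_finite)
  ultimately show ?thesis unfolding tests_def using assms by (intro countable_Un countable_UN) auto
qed

lemma cofree_tests: "(\<And>X. X \<in> \<X> \<Longrightarrow> cofree X) \<Longrightarrow> X \<in> tests \<X> \<Longrightarrow> cofree X"
  unfolding tests_def using cofree_pre cofree_E \<nu>_in by auto

lemma pre_tests: "D \<subseteq> \<Gamma> \<Longrightarrow> X \<in> \<X> \<Longrightarrow> pre q D X \<in> tests \<X>"
proof -
  assume a: "D \<subseteq> \<Gamma>" "X \<in> \<X>"
  have "sim q D = sim (restrict q \<Gamma>) D"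
    using a(1) by (intro ext sim_cong) auto
  then have "pre q D X = pre (restrict q \<Gamma>) D X" by (simp add: pre_def)
  moreover have "restrict q \<Gamma> \<in> \<Gamma> \<rightarrow>\<^sub>E UNIV" by auto
  ultimately show ?thesis unfolding tests_def using a by blast
qed

text \<open>
  In the model given by \<open>F\<close>, the points are the names modulo \<open>eqv F\<close>, and \<open>sat F q X\<close> says that the
  valuation \<open>q\<close> satisfies \<open>X\<close>.
\<close>

definition eqv :: "'b set set \<Rightarrow> nat \<Rightarrow> nat \<Rightarrow> bool" where
  "eqv F n m \<longleftrightarrow> E (\<nu> n) (\<nu> m) \<in> F"

definition sat :: "'b set set \<Rightarrow> ('a \<Rightarrow> nat) \<Rightarrow> 'b set \<Rightarrow> bool" where
  "sat F q X \<longleftrightarrow> pre q \<Gamma> X \<in> F"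

context
  fixes \<X> F assumes F: "henkin (tests \<X>) F"
begin

lemma F_conjuncts:
  "{} \<notin> F" "\<forall>X\<in>F. \<forall>Y\<in>F. X \<inter> Y \<in> F" "\<forall>X\<in>F. \<forall>Y. X \<subseteq> Y \<longrightarrow> Y \<in> F"
  "\<forall>X\<in>tests \<X>. X \<in> F \<or> \<Omega> - X \<in> F"
  "\<forall>X\<in>tests \<X>. \<forall>j\<in>\<Gamma>. cl j X \<in> F \<longrightarrow> (\<exists>n. {a \<in> \<Omega>. repl j (\<nu> n) a \<in> X} \<in> F)"
  using F unfolding henkin_def by - (elim conjE, assumption)+

lemma F_Int: "X \<in> F \<Longrightarrow> Y \<in> F \<Longrightarrow> X \<inter> Y \<in> F"
  and F_up: "X \<in> F \<Longrightarrow> X \<subseteq> Y \<Longrightarrow> Y \<in> F"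
  and F_dec: "X \<in> tests \<X> \<Longrightarrow> X \<in> F \<or> \<Omega> - X \<in> F"
  and F_henkin: "X \<in> tests \<X> \<Longrightarrow> j \<in> \<Gamma> \<Longrightarrow> cl j X \<in> F \<Longrightarrow> \<exists>n. {a \<in> \<Omega>. repl j (\<nu> n) a \<in> X} \<in> F"
  by (erule (1) F_conjuncts(2)[rule_format])
    (erule (1) F_conjuncts(3)[rule_format], erule F_conjuncts(4)[rule_format],
     erule (2) F_conjuncts(5)[rule_format])

lemmas F_ne = F_conjuncts(1)

lemma F_top: "\<Omega> \<in> F"
proof -
  have "E (\<nu> 0) (\<nu> 0) \<in> tests \<X>" unfolding tests_def by auto
  then show ?thesis using F_dec[of "E (\<nu> 0) (\<nu> 0)"] E_refl[OF \<nu>_in] F_ne by auto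
qed

lemma eqv_equivp: "equivp (eqv F)"
proof (intro equivpI reflpI sympI transpI)
  show "eqv F n n" for n using F_top E_refl[OF \<nu>_in] by (simp add: eqv_def)
  show "eqv F n m \<Longrightarrow> eqv F m n" for n m
    unfolding eqv_def by (erule F_up) (auto intro: E_sym \<nu>_in)
  show "eqv F n m \<Longrightarrow> eqv F m k \<Longrightarrow> eqv F n k" for n m k
    unfolding eqv_def by (drule (1) F_Int, erule F_up) (auto intro: E_trans[of _ "\<nu> m"] \<nu>_in)
qed

lemma sat_eqv:
  assumes "\<And>i. i \<in> \<Gamma> \<Longrightarrow> eqv F (q i) (q' i)" "sat F q X" shows "sat F q' X"
proof -
  have "\<Omega> \<inter> (\<Inter>i\<in>D. E (\<nu> (q i)) (\<nu> (q' i))) \<in> F" if "D \<subseteq> \<Gamma>" for D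
    using that
  proof (induction D rule: subset_induct)
    case (insert j D)
    have "\<Omega> \<inter> (\<Inter>i\<in>insert j D. E (\<nu> (q i)) (\<nu> (q' i))) =
        (\<Omega> \<inter> (\<Inter>i\<in>D. E (\<nu> (q i)) (\<nu> (q' i)))) \<inter> E (\<nu> (q j)) (\<nu> (q' j))" by auto
    then show ?case using F_Int insert assms(1)[of j] by (auto simp: eqv_def)
  qed (simp add: F_top)
  then have "(\<Omega> \<inter> (\<Inter>i\<in>\<Gamma>. E (\<nu> (q i)) (\<nu> (q' i)))) \<inter> pre q \<Gamma> X \<in> F" (is "?A \<in> F")
    using F_Int assms(2) by (auto simp: sat_def)
  moreover have "?A \<subseteq> pre q' \<Gamma> X" using sim_eq[of \<Gamma> _ q q'] by (auto simp: pre_def)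
  ultimately show ?thesis using F_up by (auto simp: sat_def)
qed

lemma sat_Int: "sat F q (X \<inter> Y) \<longleftrightarrow> sat F q X \<and> sat F q Y"
proof -
  have "pre q \<Gamma> (X \<inter> Y) = pre q \<Gamma> X \<inter> pre q \<Gamma> Y" by (auto simp: pre_def)
  then show ?thesis using F_Int F_up by (auto simp: sat_def)
qed

lemma sat_mono: "sat F q X \<Longrightarrow> X \<subseteq> Y \<Longrightarrow> sat F q Y"
  using sat_Int[of q X Y] by (auto simp: Int_absorb2)

lemma sat_empty: "\<not> sat F q {}"
  using F_ne by (simp add: sat_def pre_def)

lemma sat_compl: "X \<in> \<X> \<Longrightarrow> sat F q (\<Omega> - X) \<longleftrightarrow> \<not> sat F q X"
proof -
  assume X: "X \<in> \<X>"
  have "pre q \<Gamma> (\<Omega> - X) = \<Omega> - pre q \<Gamma> X" using sim_in by (auto simp: pre_def)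
  then show ?thesis using F_dec[OF pre_tests[OF subset_refl X, of q]] F_Int[of "pre q \<Gamma> X" "\<Omega> - pre q \<Gamma> X"]
    F_ne by (auto simp: sat_def)
qed

lemma sat_Un: "X \<in> \<X> \<Longrightarrow> sat F q (X \<union> Y) \<longleftrightarrow> sat F q X \<or> sat F q Y"
proof
  assume X: "X \<in> \<X>" and U: "sat F q (X \<union> Y)"
  show "sat F q X \<or> sat F q Y"
  proof (rule disjCI)
    assume n: "\<not> sat F q Y"
    show "sat F q X"
    proof (rule ccontr)
      assume "\<not> sat F q X"
      then have "sat F q ((X \<union> Y) \<inter> (\<Omega> - X))" using sat_compl[OF X] U sat_Int by blast
      then show False using n sat_mono[of q _ Y] by blast
    qed
  qed
qed (use sat_mono in blast)

text \<open>
  Right to left holds in every filter; left to right is the witness property, applied to the set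
  in which all indices but \<open>j\<close> have been replaced already.
\<close>

lemma sat_cl:
  assumes "X \<in> \<X>" "X \<subseteq> \<Omega>" "j \<in> \<Gamma>"
  shows "sat F q (cl j X) \<longleftrightarrow> (\<exists>n. sat F (q(j := n)) X)"
proof -
  let ?Y = "pre q (\<Gamma> - {j}) X"
  have "insert j (\<Gamma> - {j}) = \<Gamma>" using assms by auto
  then have up: "pre (q(j := n)) \<Gamma> X = {a \<in> \<Omega>. repl j (\<nu> n) a \<in> ?Y}" for n
    using pre_insert[of j "\<Gamma> - {j}" "q(j := n)" X] sim_cong[of "\<Gamma> - {j}" "q(j := n)" q]
    by (auto simp: pre_def)
  have c: "sat F q (cl j X) \<longleftrightarrow> cl j ?Y \<in> F" using pre_cl_\<Gamma>[OF assms(3,2)] by (simp add: sat_def)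
  have "{a \<in> \<Omega>. repl j (\<nu> n) a \<in> ?Y} \<subseteq> cl j ?Y" for n
    using repl(1)[of j "\<nu> n"] assms \<Gamma>_simps \<nu>_in by (auto simp: cl_def)
  then have "{a \<in> \<Omega>. repl j (\<nu> n) a \<in> ?Y} \<in> F \<Longrightarrow> cl j ?Y \<in> F" for n using F_up by blast
  moreover have "?Y \<in> tests \<X>" using pre_tests[of "\<Gamma> - {j}"] assms by blast
  ultimately show ?thesis using c F_henkin[of ?Y j] assms(3)
    unfolding sat_def up by blast
qed

lemma sat_E: "i \<in> \<Gamma> \<Longrightarrow> j \<in> \<Gamma> \<Longrightarrow> sat F q (E i j) \<longleftrightarrow> eqv F (q i) (q j)"
  by (simp add: sat_def eqv_def pre_E)

lemma sat_closed:
  assumes "X \<in> F" "X \<subseteq> Y" "Y \<subseteq> \<Omega>" "\<And>i. i \<in> \<Gamma> \<Longrightarrow> closed i Y" shows "sat F q Y"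
  using F_up[OF assms(1,2)] pre_closed[of Y q] assms(3,4) by (simp add: sat_def)

end

text \<open>
  To obtain a valuation that satisfies \<open>b\<close> in one model and \<open>c\<close> in the other, every index in \<open>\<Gamma>\<close> is
  equated with a fresh name, in both sets; \<open>E j (\<nu> n)\<close> belongs to \<open>R\<close>, which transfers
  non-separation from one side to both.
\<close>

lemma sep_diag:
  assumes "cofree b" "cofree c" "\<not> sep b c" "D \<subseteq> \<Gamma>"
  shows "\<exists>q. cofree (b \<inter> (\<Inter>i\<in>D. E i (\<nu> (q i)))) \<and> cofree (c \<inter> (\<Inter>i\<in>D. E i (\<nu> (q i)))) \<and>
     \<not> sep (b \<inter> (\<Inter>i\<in>D. E i (\<nu> (q i)))) (c \<inter> (\<Inter>i\<in>D. E i (\<nu> (q i))))"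
  using assms(4)
proof (induction D rule: subset_induct)
  case empty
  then show ?case using assms by auto
next
  case (insert j D)
  then obtain q where q: "cofree (b \<inter> (\<Inter>i\<in>D. E i (\<nu> (q i))))"
      "cofree (c \<inter> (\<Inter>i\<in>D. E i (\<nu> (q i))))"
      "\<not> sep (b \<inter> (\<Inter>i\<in>D. E i (\<nu> (q i)))) (c \<inter> (\<Inter>i\<in>D. E i (\<nu> (q i))))" by blast
  let ?b = "b \<inter> (\<Inter>i\<in>D. E i (\<nu> (q i)))" and ?c = "c \<inter> (\<Inter>i\<in>D. E i (\<nu> (q i)))"
  obtain n where n: "closed (\<nu> n) ?b" "closed (\<nu> n) ?c" using cofree_fresh[OF q(1,2,2)] by blast
  have j: "j \<in> V" "j \<in> \<Gamma>" "j \<noteq> \<nu> n" "j \<notin> D" using insert \<Gamma>_simps by auto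
  have "?b \<subseteq> cl (\<nu> n) (E j (\<nu> n))"
  proof
    fix a assume "a \<in> ?b"
    then have "a \<in> \<Omega>" using q(1) by (meson cofree_def subsetD)
    then obtain d where "d \<in> E (\<nu> n) j" "T (\<nu> n) a d"
      using E_total[of "\<nu> n" j a] j \<nu>_in by auto
    then show "a \<in> cl (\<nu> n) (E j (\<nu> n))" using E_sym[of "\<nu> n" j d] j \<nu>_in by (auto simp: cl_def)
  qed
  from sep_fresh[OF n this] q(3) have 1: "\<not> sep (?b \<inter> E j (\<nu> n)) ?c" by blast
  have 2: "\<not> sep (?b \<inter> E j (\<nu> n)) (?c \<inter> E j (\<nu> n))"
  proof
    assume "sep (?b \<inter> E j (\<nu> n)) (?c \<inter> E j (\<nu> n))"
    then obtain r where r: "r \<in> R" "?b \<inter> E j (\<nu> n) \<subseteq> r" "(?c \<inter> E j (\<nu> n)) \<inter> r = {}"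
      unfolding sep_def by blast
    have "r \<inter> E j (\<nu> n) \<in> R" "?b \<inter> E j (\<nu> n) \<subseteq> r \<inter> E j (\<nu> n)" "?c \<inter> (r \<inter> E j (\<nu> n)) = {}"
      using R_Int R_E[of j "\<nu> n"] j r by auto
    then show False using 1 unfolding sep_def by blast
  qed
  have e: "z \<inter> (\<Inter>i\<in>insert j D. E i (\<nu> ((q(j := n)) i))) = (z \<inter> (\<Inter>i\<in>D. E i (\<nu> (q i)))) \<inter> E j (\<nu> n)" for z
  proof -
    have "(\<Inter>i\<in>D. E i (\<nu> ((q(j := n)) i))) = (\<Inter>i\<in>D. E i (\<nu> (q i)))"
      using j by (intro INF_cong) auto
    then show ?thesis by auto
  qed
  show ?case
    by (rule exI[of _ "q(j := n)"], unfold e)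
      (use 2 cofree_Int[OF q(1) cofree_E[OF j(1) \<nu>_in]] cofree_Int[OF q(2) cofree_E[OF j(1) \<nu>_in]] in blast)
qed

theorem joint_model:
  assumes X: "countable \<X>" "\<And>X. X \<in> \<X> \<Longrightarrow> cofree X"
    and b: "cofree b" "cofree c" "\<not> sep b c"
  shows "\<exists>F G q. henkin (tests \<X>) F \<and> henkin (tests \<X>) G \<and>
     sat F q b \<and> sat G q c \<and> b \<in> F \<and> c \<in> G \<and> eqv F = eqv G \<and> (\<forall>r\<in>R \<inter> \<X>. \<forall>q. sat F q r \<longleftrightarrow> sat G q r)"
proof -
  obtain q where q: "cofree (b \<inter> (\<Inter>i\<in>\<Gamma>. E i (\<nu> (q i))))"
      "cofree (c \<inter> (\<Inter>i\<in>\<Gamma>. E i (\<nu> (q i))))"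
      "\<not> sep (b \<inter> (\<Inter>i\<in>\<Gamma>. E i (\<nu> (q i)))) (c \<inter> (\<Inter>i\<in>\<Gamma>. E i (\<nu> (q i))))"
    using sep_diag[OF b subset_refl] by blast
  let ?b = "b \<inter> (\<Inter>i\<in>\<Gamma>. E i (\<nu> (q i)))" and ?c = "c \<inter> (\<Inter>i\<in>\<Gamma>. E i (\<nu> (q i)))"
  have X': "\<And>X. X \<in> tests \<X> \<Longrightarrow> cofree X" using cofree_tests X(2) by blast
  obtain F G where FG: "henkin (tests \<X>) F" "henkin (tests \<X>) G" "?b \<in> F" "?c \<in> G"
    "\<forall>r\<in>R \<inter> tests \<X>. r \<in> F \<longleftrightarrow> r \<in> G"
    using joint_henkin[OF countable_tests[OF X(1)] X' q] by blast
  \<comment> \<open>On the diagonal the substitution does nothing, so \<open>b\<close> there entails its own instance.\<close>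
  have fix_diag: "sim q D a = a" if "D \<subseteq> \<Gamma>" "a \<in> \<Omega>" "a \<in> (\<Inter>i\<in>\<Gamma>. E i (\<nu> (q i)))" for a D
    using that
  proof (induction D rule: subset_induct)
    case (insert j D)
    then have "repl j (\<nu> (q j)) a = a"
      using repl_eq[of j "\<nu> (q j)" a a] T_refl[of j a] \<Gamma>_simps \<nu>_in by auto
    then show ?case using insert by (simp add: sim_insert)
  qed simp
  have "?b \<subseteq> pre q \<Gamma> b" "?c \<subseteq> pre q \<Gamma> c"
    using fix_diag[of \<Gamma>] b by (auto simp: pre_def cofree_def subset_iff)
  then have "sat F q b" "sat G q c"
    using F_up[OF FG(1,3)] F_up[OF FG(2,4)] by (auto simp: sat_def)
  moreover have "b \<in> F" "c \<in> G"
    using F_up[OF FG(1,3), of b] F_up[OF FG(2,4), of c] by auto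
  moreover have "eqv F = eqv G"
  proof (intro ext)
    fix n m
    have "E (\<nu> n) (\<nu> m) \<in> R \<inter> tests \<X>" using R_E by (auto simp: tests_def)
    then show "eqv F n m = eqv G n m" using FG(5) by (simp add: eqv_def)
  qed
  moreover have "sat F q r \<longleftrightarrow> sat G q r" if "r \<in> R \<inter> \<X>" for r q
    using FG(5) R_pre[of \<Gamma> r q] pre_tests[of \<Gamma> r \<X> q] that by (auto simp: sat_def)
  ultimately show ?thesis using FG by blast
qed

end

section \<open>Ultrafilters of Boolean algebras\<close>

locale boolean_carrier =
  fixes A :: "('i, 'a) cyl_algebra"
  assumes ops: "closed_under_ops {} (car A) A" and laws: "boolean_reduct A"
begin

abbreviation "C \<equiv> car A"
abbreviation "O' \<equiv> zero_of A"
abbreviation "I' \<equiv> one_of A"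
abbreviation add (infixl \<open>\<squnion>\<close> 65) where "x \<squnion> y \<equiv> plus_of A x y"
abbreviation mul (infixl \<open>\<sqinter>\<close> 70) where "x \<sqinter> y \<equiv> times_of A x y"
abbreviation neg (\<open>\<sim> _\<close> [81] 80) where "\<sim> x \<equiv> compl_of A x"

lemma in_C [simp]:
  "x \<in> C \<Longrightarrow> y \<in> C \<Longrightarrow> x \<squnion> y \<in> C" "x \<in> C \<Longrightarrow> y \<in> C \<Longrightarrow> x \<sqinter> y \<in> C"
  "x \<in> C \<Longrightarrow> \<sim> x \<in> C" "O' \<in> C" "I' \<in> C"
  using ops by (auto simp: closed_under_ops_def)

lemmas laws3 = conjunct1[OF laws[unfolded boolean_reduct_def], THEN bspec, THEN bspec, THEN bspec]
lemmas laws1 = conjunct2[OF laws[unfolded boolean_reduct_def], THEN bspec]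

lemma bool:
  "x \<in> C \<Longrightarrow> y \<in> C \<Longrightarrow> x \<squnion> y = y \<squnion> x" "x \<in> C \<Longrightarrow> y \<in> C \<Longrightarrow> x \<sqinter> y = y \<sqinter> x"
  "x \<in> C \<Longrightarrow> y \<in> C \<Longrightarrow> z \<in> C \<Longrightarrow> (x \<sqinter> y) \<sqinter> z = x \<sqinter> (y \<sqinter> z)"
  "x \<in> C \<Longrightarrow> y \<in> C \<Longrightarrow> z \<in> C \<Longrightarrow> (x \<squnion> y) \<squnion> z = x \<squnion> (y \<squnion> z)"
  "x \<in> C \<Longrightarrow> y \<in> C \<Longrightarrow> z \<in> C \<Longrightarrow> x \<sqinter> (y \<squnion> z) = (x \<sqinter> y) \<squnion> (x \<sqinter> z)"
  "x \<in> C \<Longrightarrow> y \<in> C \<Longrightarrow> z \<in> C \<Longrightarrow> x \<squnion> (y \<sqinter> z) = (x \<squnion> y) \<sqinter> (x \<squnion> z)"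
  "x \<in> C \<Longrightarrow> x \<squnion> O' = x" "x \<in> C \<Longrightarrow> x \<sqinter> I' = x"
  "x \<in> C \<Longrightarrow> x \<squnion> \<sim> x = I'" "x \<in> C \<Longrightarrow> x \<sqinter> \<sim> x = O'"
  apply (use laws3[of x y x] in blast, use laws3[of x y x] in blast)
  by (use laws3[of x y z] in blast)+ (use laws1[of x] in blast)+

lemma mul_idem: "x \<in> C \<Longrightarrow> x \<sqinter> x = x"
  using bool(5)[of x x "\<sim> x"] bool(7)[of "x \<sqinter> x"] bool(8)[of x] bool(9,10)[of x] by simp

lemma mul_zero: "x \<in> C \<Longrightarrow> x \<sqinter> O' = O'"
  using bool(5)[of x O' "\<sim> x"] bool(7)[of "x \<sqinter> O'"] bool(1)[of O' "\<sim> x"] bool(7)[of "\<sim> x"] bool(10)[of x]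
  by simp

lemma mul_left_commute:
  "x \<in> C \<Longrightarrow> y \<in> C \<Longrightarrow> z \<in> C \<Longrightarrow> x \<sqinter> (y \<sqinter> z) = y \<sqinter> (x \<sqinter> z)"
  using bool(3)[of x y z] bool(3)[of y x z] bool(2)[of x y] by simp

lemma absorb: "x \<in> C \<Longrightarrow> y \<in> C \<Longrightarrow> x \<sqinter> (x \<squnion> y) = x"
proof -
  assume xy: "x \<in> C" "y \<in> C"
  have "x \<sqinter> (x \<squnion> y) = (x \<squnion> O') \<sqinter> (x \<squnion> y)" using xy by (simp add: bool(7))
  also have "\<dots> = x \<squnion> (O' \<sqinter> y)" using xy by (simp add: bool(6))
  also have "\<dots> = x" using xy mul_zero[of y] bool(2)[of y O'] by (simp add: bool(7))
  finally show ?thesis .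
qed

lemma split: "x \<in> C \<Longrightarrow> y \<in> C \<Longrightarrow> x = (x \<sqinter> y) \<squnion> (x \<sqinter> \<sim> y)"
  using bool(5)[of x y "\<sim> y"] bool(8)[of x] bool(9)[of y] by simp

definition ultra :: "'a set \<Rightarrow> bool" where
  "ultra G \<longleftrightarrow> G \<subseteq> C \<and> I' \<in> G \<and> O' \<notin> G \<and> (\<forall>x\<in>G. \<forall>y\<in>G. x \<sqinter> y \<in> G) \<and> (\<forall>x\<in>C. x \<in> G \<or> \<sim> x \<in> G)"

text \<open>
  A maximal multiplicatively closed set without zero is an ultrafilter: an \<open>x\<close> outside it is
  annihilated by some member \<open>g\<close>, and if \<open>\<sim> x\<close> is annihilated by a member \<open>h\<close> as well, then
  \<open>g \<sqinter> h = 0\<close>.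
\<close>

theorem ex_ultra:
  assumes M: "M \<subseteq> C" "O' \<notin> M" "I' \<in> M" "\<And>x y. x \<in> M \<Longrightarrow> y \<in> M \<Longrightarrow> x \<sqinter> y \<in> M"
  shows "\<exists>G. ultra G \<and> M \<subseteq> G"
proof -
  define mult where "mult = {G. M \<subseteq> G \<and> G \<subseteq> C \<and> O' \<notin> G \<and> (\<forall>x\<in>G. \<forall>y\<in>G. x \<sqinter> y \<in> G)}"
  have "\<exists>G\<in>mult. \<forall>H\<in>mult. G \<subseteq> H \<longrightarrow> H = G"
  proof (rule subset_Zorn_nonempty)
    show "mult \<noteq> {}" using M by (auto simp: mult_def)
  next
    fix \<C> assume ne: "\<C> \<noteq> {}" and ch: "subset.chain mult \<C>"
    have \<C>: "\<C> \<subseteq> mult" using ch by (simp add: subset.chain_def)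
    have "x \<sqinter> y \<in> \<Union>\<C>" if xy: "x \<in> \<Union>\<C>" "y \<in> \<Union>\<C>" for x y
    proof -
      obtain X Y where XY: "x \<in> X" "X \<in> \<C>" "y \<in> Y" "Y \<in> \<C>" using xy by blast
      then have "X \<subseteq> Y \<or> Y \<subseteq> X" using ch unfolding subset_chain_def by blast
      then show ?thesis
      proof
        assume "X \<subseteq> Y"
        then have "x \<sqinter> y \<in> Y" using XY \<C> by (auto simp: mult_def)
        then show ?thesis using XY by blast
      next
        assume "Y \<subseteq> X"
        then have "x \<sqinter> y \<in> X" using XY \<C> by (auto simp: mult_def)
        then show ?thesis using XY by blast
      qed
    qed
    moreover have "M \<subseteq> X \<and> X \<subseteq> C \<and> O' \<notin> X" if "X \<in> \<C>" for X
      using that \<C> unfolding mult_def by blast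
    then have "M \<subseteq> \<Union>\<C>" "\<Union>\<C> \<subseteq> C" "O' \<notin> \<Union>\<C>" using ne by blast+
    ultimately show "\<Union>\<C> \<in> mult" unfolding mult_def by blast
  qed
  then obtain G where G: "G \<in> mult" and max: "\<And>H. H \<in> mult \<Longrightarrow> G \<subseteq> H \<Longrightarrow> H = G" by blast
  have G': "M \<subseteq> G" "G \<subseteq> C" "O' \<notin> G" "\<And>x y. x \<in> G \<Longrightarrow> y \<in> G \<Longrightarrow> x \<sqinter> y \<in> G"
    using G unfolding mult_def by blast+
  have kill: "\<exists>g\<in>G. g \<sqinter> x = O'" if x: "x \<in> C" "x \<notin> G" for x
  proof (rule ccontr)
    assume n: "\<not> (\<exists>g\<in>G. g \<sqinter> x = O')"
    let ?H = "G \<union> (\<lambda>g. g \<sqinter> x) ` G"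
    have prod: "(g \<sqinter> x) \<sqinter> (h \<sqinter> x) = (g \<sqinter> h) \<sqinter> x" if "g \<in> C" "h \<in> C" for g h
      using that x by (simp add: bool(3) mul_left_commute[of x h x] mul_idem)
    have prod2: "g \<sqinter> (h \<sqinter> x) = (g \<sqinter> h) \<sqinter> x" "(h \<sqinter> x) \<sqinter> g = (h \<sqinter> g) \<sqinter> x" if "g \<in> C" "h \<in> C" for g h
      using that x by (simp_all add: bool(3)[of g h x] bool(3)[of h x g] bool(3)[of h g x] bool(2)[of x g])
    have I: "g \<sqinter> h \<in> G" if "g \<in> G" "h \<in> G" for g h
      using that G'(4) by blast
    have IC: "G \<subseteq> C" using G' by auto
    have "?H \<in> mult" unfolding mult_def
    proof (intro CollectI conjI ballI)
      show "M \<subseteq> ?H" using G' by blast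
      show "?H \<subseteq> C" using IC x by auto
      show "O' \<notin> ?H" using n G'(3) by auto
    next
      fix a b assume a: "a \<in> ?H" and b: "b \<in> ?H"
      have *: "g \<sqinter> x \<in> ?H" if "g \<in> G" for g using that by blast
      from a b show "a \<sqinter> b \<in> ?H"
      proof (elim UnE imageE)
        fix g h assume gh: "a = g \<sqinter> x" "b = h \<sqinter> x" "g \<in> G" "h \<in> G"
        then have "a \<sqinter> b = (g \<sqinter> h) \<sqinter> x" using prod IC by blast
        then show ?thesis using *[OF I[OF gh(3,4)]] by simp
      next
        fix h assume gh: "a \<in> G" "b = h \<sqinter> x" "h \<in> G"
        then have "a \<sqinter> b = (a \<sqinter> h) \<sqinter> x" using prod2 IC by blast
        then show ?thesis using *[OF I[OF _ gh(3), of a]] gh by simp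
      next
        fix g assume gh: "a = g \<sqinter> x" "b \<in> G" "g \<in> G"
        then have "a \<sqinter> b = (g \<sqinter> b) \<sqinter> x" using prod2 IC by blast
        then show ?thesis using *[OF I[OF gh(3), of b]] gh by simp
      qed (use G'(4) in blast)
    qed
    then have "?H = G" using max[of ?H] by blast
    moreover have "I' \<sqinter> x = x" using x bool(2)[of I' x] bool(8)[of x] by simp
    then have "x \<in> ?H" using G'(1) M(3) by force
    ultimately show False using x by blast
  qed
  have "x \<in> G \<or> \<sim> x \<in> G" if x: "x \<in> C" for x
  proof (rule ccontr)
    assume n: "\<not> (x \<in> G \<or> \<sim> x \<in> G)"
    obtain g where g: "g \<in> G" "g \<sqinter> x = O'" using kill[of x] n x by blast
    obtain h where h: "h \<in> G" "h \<sqinter> \<sim> x = O'" using kill[of "\<sim> x"] n in_C(3)[OF x] by blast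
    have C: "g \<in> C" "h \<in> C" using g h G' by auto
    have "(g \<sqinter> h) \<sqinter> x = O'" "(g \<sqinter> h) \<sqinter> \<sim> x = O'"
      using C x g(2) h(2) mul_zero mul_left_commute[of g h x] bool(3)[of g h x] bool(3)[of g h "\<sim> x"] by simp_all
    then have z: "g \<sqinter> h = O'" using split[of "g \<sqinter> h" x] C x bool(7)[of O'] by simp
    then show False using G'(3) G'(4)[OF g(1) h(1)] by simp
  qed
  then have "ultra G" unfolding ultra_def using G' M(3) by (intro conjI ballI) auto
  then show ?thesis using G'(1) by blast
qed


context
  fixes G assumes G: "ultra G"
begin

lemma ultra_C: "x \<in> G \<Longrightarrow> x \<in> C"
  and ultra_one: "I' \<in> G" and ultra_zero: "O' \<notin> G"
  and ultra_mulI: "x \<in> G \<Longrightarrow> y \<in> G \<Longrightarrow> x \<sqinter> y \<in> G"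
  using G unfolding ultra_def by blast+

lemma ultra_neg: "x \<in> C \<Longrightarrow> \<sim> x \<in> G \<longleftrightarrow> x \<notin> G"
proof -
  assume x: "x \<in> C"
  then have "x \<in> G \<or> \<sim> x \<in> G" using G unfolding ultra_def by blast
  moreover have "\<not> (x \<in> G \<and> \<sim> x \<in> G)" using ultra_mulI[of x "\<sim> x"] bool(10)[OF x] ultra_zero by auto
  ultimately show ?thesis by blast
qed

lemma ultra_up: "x \<in> G \<Longrightarrow> y \<in> C \<Longrightarrow> x \<sqinter> y = x \<Longrightarrow> y \<in> G"
proof (rule ccontr)
  assume x: "x \<in> G" "y \<in> C" "x \<sqinter> y = x" "y \<notin> G"
  have "x \<sqinter> \<sim> y \<in> G" using ultra_mulI[OF x(1)] ultra_neg x by blast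
  moreover have "x \<sqinter> \<sim> y = (x \<sqinter> y) \<sqinter> \<sim> y" using x(3) by simp
  moreover have "\<dots> = O'"
    using bool(3)[of x y "\<sim> y"] bool(10)[of y] mul_zero[of x] ultra_C[OF x(1)] x(2) by simp
  ultimately show False using ultra_zero by simp
qed

lemma ultra_mul: "x \<in> C \<Longrightarrow> y \<in> C \<Longrightarrow> x \<sqinter> y \<in> G \<longleftrightarrow> x \<in> G \<and> y \<in> G"
proof
  assume xy: "x \<in> C" "y \<in> C" "x \<sqinter> y \<in> G"
  have "(x \<sqinter> y) \<sqinter> x = x \<sqinter> y" "(x \<sqinter> y) \<sqinter> y = x \<sqinter> y"
    using xy bool(2)[of "x \<sqinter> y" x] bool(3)[of x x y] bool(3)[of x y y] mul_idem by simp_all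
  then show "x \<in> G \<and> y \<in> G" using ultra_up[OF xy(3)] xy by blast
qed (use ultra_mulI in blast)

lemma ultra_add: "x \<in> C \<Longrightarrow> y \<in> C \<Longrightarrow> x \<squnion> y \<in> G \<longleftrightarrow> x \<in> G \<or> y \<in> G"
proof
  assume xy: "x \<in> C" "y \<in> C" "x \<squnion> y \<in> G"
  show "x \<in> G \<or> y \<in> G"
  proof (rule ccontr)
    assume n: "\<not> (x \<in> G \<or> y \<in> G)"
    then have "(\<sim> x \<sqinter> \<sim> y) \<sqinter> (x \<squnion> y) \<in> G" using xy ultra_mulI ultra_neg by blast
    moreover have "(\<sim> x \<sqinter> \<sim> y) \<sqinter> x = O'" "(\<sim> x \<sqinter> \<sim> y) \<sqinter> y = O'"
      using xy bool(2)[of "\<sim> x \<sqinter> \<sim> y" x] bool(3)[of x "\<sim> x" "\<sim> y"] bool(10)[of x]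
        bool(3)[of "\<sim> x" "\<sim> y" y] bool(2)[of "\<sim> y" y] bool(10)[of y] mul_zero[of "\<sim> x"]
        mul_zero[of "\<sim> y"] bool(2)[of O' "\<sim> y"] by simp_all
    ultimately show False using bool(5)[of "\<sim> x \<sqinter> \<sim> y" x y] xy bool(7)[of O'] ultra_zero by simp
  qed
next
  assume xy: "x \<in> C" "y \<in> C" "x \<in> G \<or> y \<in> G"
  then show "x \<squnion> y \<in> G"
    using ultra_up[of x "x \<squnion> y"] ultra_up[of y "x \<squnion> y"] absorb[of x y] absorb[of y x]
      bool(1)[of x y] by auto
qed

end

end

text \<open>
  The index set of the ultraproducts below consists of the finite sets \<open>k\<close> of relevant objects; for
  each object, almost all \<open>k\<close> contain it.
\<close>

theorem ex_fine_ultrafilter: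
  "\<exists>U. (\<forall>Q. eventually Q U \<or> eventually (\<lambda>k. \<not> Q k) U) \<and> U \<noteq> bot \<and>
     eventually finite U \<and> (\<forall>e :: 'k. eventually (\<lambda>k. e \<in> k) U)"
proof -
  define B where "B = \<lparr>car = UNIV :: 'k set set set, plus_of = (\<union>), times_of = (\<inter>),
    compl_of = uminus, zero_of = {}, one_of = UNIV, cyl = \<lambda>_::unit. id, diag = \<lambda>_ _. {}\<rparr>"
  interpret boolean_carrier B
    by unfold_locales (auto simp: B_def closed_under_ops_def boolean_reduct_def)
  let ?M = "{X. \<exists>P :: 'k set. finite P \<and> (\<forall>k. finite k \<longrightarrow> P \<subseteq> k \<longrightarrow> k \<in> X)}"
  have "\<exists>G. ultra G \<and> ?M \<subseteq> G"
  proof (rule ex_ultra)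
    have "{} \<notin> ?M"
    proof
      assume "{} \<in> ?M"
      then obtain P :: "'k set" where "finite P" "\<forall>k. finite k \<longrightarrow> P \<subseteq> k \<longrightarrow> k \<in> {}" by blast
      then show False using subset_refl[of P] by blast
    qed
    then show "zero_of B \<notin> ?M" by (simp only: B_def cyl_algebra.simps simp_thms)
  next
    fix X Y assume "X \<in> ?M" "Y \<in> ?M"
    then obtain P P' where P: "finite P" "\<forall>k. finite k \<longrightarrow> P \<subseteq> k \<longrightarrow> k \<in> X"
      "finite P'" "\<forall>k. finite k \<longrightarrow> P' \<subseteq> k \<longrightarrow> k \<in> Y" by blast
    then have "finite (P \<union> P')" "\<forall>k. finite k \<longrightarrow> P \<union> P' \<subseteq> k \<longrightarrow> k \<in> X \<inter> Y" by auto
    then have "X \<inter> Y \<in> ?M" by (intro CollectI exI[of _ "P \<union> P'"] conjI)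
    then show "times_of B X Y \<in> ?M" by (simp only: B_def cyl_algebra.simps)
  next
    have "UNIV \<in> ?M" by (intro CollectI exI[of _ "{}"]) simp
    then show "one_of B \<in> ?M" by (simp only: B_def cyl_algebra.simps)
  qed (simp add: B_def)
  then obtain G where G: "ultra G" "?M \<subseteq> G" by (elim exE conjE)
  have dec: "X \<in> G \<or> - X \<in> G" for X
    using ultra_neg[OF G(1), of X] by (simp add: B_def)
  have up: "X \<in> G \<Longrightarrow> X \<subseteq> Y \<Longrightarrow> Y \<in> G" for X Y
    using ultra_up[OF G(1), of X Y] by (simp add: B_def Int_absorb2)
  have int: "X \<in> G \<Longrightarrow> Y \<in> G \<Longrightarrow> X \<inter> Y \<in> G" for X Y
    using ultra_mulI[OF G(1), of X Y] by (simp add: B_def)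
  have top: "UNIV \<in> G" using ultra_one[OF G(1)] by (simp add: B_def)
  define U where "U = Abs_filter (\<lambda>Q. {k. Q k} \<in> G)"
  have "is_filter (\<lambda>Q. {k. Q k} \<in> G)"
  proof
    show "{k. True} \<in> G" using top by simp
  next
    fix P Q assume "{k. P k} \<in> G" "{k. Q k} \<in> G"
    then show "{k. P k \<and> Q k} \<in> G" using int[of "{k. P k}" "{k. Q k}"] by (simp add: Collect_conj_eq)
  next
    fix P Q assume "\<forall>k. P k \<longrightarrow> Q k" "{k. P k} \<in> G"
    then show "{k. Q k} \<in> G" using up[of "{k. P k}" "{k. Q k}"] by blast
  qed
  then have ev: "eventually Q U \<longleftrightarrow> {k. Q k} \<in> G" for Q
    unfolding U_def by (rule eventually_Abs_filter)
  have fine: "{k. finite k \<and> P \<subseteq> k} \<in> G" if P: "finite P" for P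
    by (rule subsetD[OF G(2)], rule CollectI, rule exI[of _ P]) (use P in simp)
  have "eventually Q U \<or> eventually (\<lambda>k. \<not> Q k) U" for Q
    using dec[of "{k. Q k}"] by (simp add: ev Collect_neg_eq)
  moreover have "U \<noteq> bot"
  proof -
    have "{} \<notin> G" using ultra_zero[OF G(1)] by (simp add: B_def)
    then have "\<not> eventually (\<lambda>_. False) U" unfolding ev by simp
    then show ?thesis by auto
  qed
  moreover have "eventually finite U" unfolding ev by (rule up[OF fine[of "{}"]]) auto
  moreover have "eventually (\<lambda>k. e \<in> k) U" for e unfolding ev by (rule up[OF fine[of "{e}"]]) auto
  ultimately show ?thesis by (intro exI[of _ U] conjI allI)
qed

section \<open>Ultraproducts of local models\<close>

text \<open>
  A set of points \<open>nat\<close>, with \<open>eq\<close> as equality, in which \<open>g q a\<close> says that the valuation \<open>q\<close> satisfies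
  \<open>a\<close>.  The homomorphism conditions are imposed for the elements of \<open>P\<close> and the indices of \<open>\<Gamma>\<close> only.
\<close>

definition local_model :: "'i set \<Rightarrow> 'a set \<Rightarrow> ('i, 'a) cyl_algebra \<Rightarrow> (nat \<Rightarrow> nat \<Rightarrow> bool) \<Rightarrow>
    (('i \<Rightarrow> nat) \<Rightarrow> 'a \<Rightarrow> bool) \<Rightarrow> bool" where
  "local_model \<Gamma> P A eq g \<longleftrightarrow>
     (\<forall>a\<in>P. \<forall>q q'. (\<forall>i\<in>\<Gamma>. eq (q i) (q' i)) \<longrightarrow> g q a \<longrightarrow> g q' a) \<and>
     (\<forall>a\<in>P. \<forall>b\<in>P. \<forall>q. (g q (plus_of A a b) \<longleftrightarrow> g q a \<or> g q b) \<and>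
        (g q (times_of A a b) \<longleftrightarrow> g q a \<and> g q b)) \<and>
     (\<forall>a\<in>P. \<forall>q. g q (compl_of A a) \<longleftrightarrow> \<not> g q a) \<and>
     (\<forall>q. \<not> g q (zero_of A) \<and> g q (one_of A)) \<and>
     (\<forall>a\<in>P. \<forall>i\<in>\<Gamma>. \<forall>q. g q (cyl A i a) \<longleftrightarrow> (\<exists>n. g (q(i := n)) a)) \<and>
     (\<forall>i\<in>\<Gamma>. \<forall>j\<in>\<Gamma>. \<forall>q. g q (diag A i j) \<longleftrightarrow> eq (q i) (q j))"

lemma local_model_cong:
  assumes "local_model \<Gamma> P A eq g" "a \<in> P" "\<forall>i\<in>\<Gamma>. eq (q i) (q' i)" "g q a"
  shows "g q' a"
proof -
  have "\<forall>a\<in>P. \<forall>q q'. (\<forall>i\<in>\<Gamma>. eq (q i) (q' i)) \<longrightarrow> g q a \<longrightarrow> g q' a"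
    using assms(1) unfolding local_model_def by (rule conjunct1)
  from this[THEN bspec, OF assms(2), THEN spec, THEN spec, THEN mp, OF assms(3)] assms(4)
  show ?thesis by (rule mp)
qed

locale ultraproduct =
  fixes U :: "'k filter" and J :: "'i set" and \<Gamma> :: "'k \<Rightarrow> 'i set" and eq :: "'k \<Rightarrow> nat \<Rightarrow> nat \<Rightarrow> bool"
    and q0 :: "'k \<Rightarrow> 'i \<Rightarrow> nat" and code :: "('k \<Rightarrow> nat) \<Rightarrow> 'u"
  assumes dec: "eventually Q U \<or> eventually (\<lambda>k. \<not> Q k) U" and ne: "U \<noteq> bot"
    and equivp: "eventually (\<lambda>k. equivp (eq k)) U" and inj_code: "inj code"
    and \<Gamma>_sub: "\<Gamma> k \<subseteq> J" and \<Gamma>_ev: "i \<in> J \<Longrightarrow> eventually (\<lambda>k. i \<in> \<Gamma> k) U"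
begin

lemma ev_not: "eventually (\<lambda>k. \<not> Q k) U \<longleftrightarrow> \<not> eventually Q U"
proof
  assume "eventually (\<lambda>k. \<not> Q k) U"
  then show "\<not> eventually Q U"
    using eventually_conj[of "\<lambda>k. \<not> Q k" U Q] ne by auto
next
  assume "\<not> eventually Q U"
  then show "eventually (\<lambda>k. \<not> Q k) U" using dec[of Q] by simp
qed

lemma ev_disj: "eventually (\<lambda>k. P k \<or> Q k) U \<longleftrightarrow> eventually P U \<or> eventually Q U"
proof -
  have "eventually (\<lambda>k. \<not> P k \<and> \<not> Q k) U \<longleftrightarrow> \<not> eventually P U \<and> \<not> eventually Q U"
    by (simp add: eventually_conj_iff ev_not)
  then show ?thesis using ev_not[of "\<lambda>k. P k \<or> Q k"] unfolding de_Morgan_disj by blast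
qed

lemma ev_cong: "eventually (\<lambda>k. P k = Q k) U \<Longrightarrow> eventually P U \<longleftrightarrow> eventually Q U"
  by (rule eventually_subst)

definition near :: "('k \<Rightarrow> nat) \<Rightarrow> ('k \<Rightarrow> nat) \<Rightarrow> bool" where
  "near f g \<longleftrightarrow> eventually (\<lambda>k. eq k (f k) (g k)) U"

text \<open>
  A point of the ultraproduct is coded by a chosen member of its equivalence class; \<open>code\<close> places
  the base in the type where it is wanted.
\<close>

definition canon :: "('k \<Rightarrow> nat) \<Rightarrow> 'u" where
  "canon f = code (SOME g. near f g)"

definition W :: "'u set" where "W = range canon"

text \<open>
  The representative of a point depends on the coordinate \<open>i\<close> at which it is used, so that the
  points \<open>canon (\<lambda>k. q0 k i)\<close> are represented exactly by the given valuations \<open>q0\<close>, at every \<open>k\<close>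
  and for all \<open>i\<close> at once.  An arbitrary choice would agree with \<open>q0\<close> only for almost all \<open>k\<close>, where the
  exceptional set depends on \<open>i\<close>, and infinitely many coordinates could not be handled together.
\<close>

definition rep :: "'i \<Rightarrow> 'u \<Rightarrow> 'k \<Rightarrow> nat" where
  "rep i w = (if canon (\<lambda>k. q0 k i) = w then (\<lambda>k. q0 k i) else inv code w)"

definition at :: "('i \<Rightarrow> 'u) \<Rightarrow> 'k \<Rightarrow> 'i \<Rightarrow> nat" where
  "at s k = (\<lambda>i. rep i (s i) k)"

definition interp :: "('k \<Rightarrow> ('i \<Rightarrow> nat) \<Rightarrow> 'a \<Rightarrow> bool) \<Rightarrow> 'a \<Rightarrow> ('i \<Rightarrow> 'u) set" where
  "interp g a = {s \<in> J \<rightarrow>\<^sub>E W. eventually (\<lambda>k. g k (at s k) a) U}"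

lemma near_refl: "near f f"
  using equivp unfolding near_def
proof eventually_elim
  case (elim k)
  then show ?case using equivp_reflp[of "eq k"] by simp
qed

lemma near_sym: assumes "near f g" shows "near g f"
  using assms equivp unfolding near_def
proof eventually_elim
  case (elim k)
  then show ?case using equivp_symp[of "eq k" "f k" "g k"] by simp
qed

lemma near_trans: assumes "near f g" "near g h" shows "near f h"
  using assms equivp unfolding near_def
proof eventually_elim
  case (elim k)
  then show ?case using equivp_transp[of "eq k" "f k" "g k" "h k"] by simp
qed

lemma canon_eq: "canon f = canon g \<longleftrightarrow> near f g"
proof
  assume "canon f = canon g"
  then have "(SOME h. near f h) = (SOME h. near g h)" using inj_code by (auto simp: canon_def inj_def)
  then show "near f g"
    using near_trans[OF _ near_sym, of f "SOME h. near f h" g]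
      someI[of "near f", OF near_refl] someI[of "near g", OF near_refl] by simp
next
  assume "near f g"
  then have "near f h = near g h" for h
    using near_trans[of f g h] near_trans[of g f h] near_sym[of f g] by blast
  then have "near f = near g" by (rule ext)
  then show "canon f = canon g" by (simp add: canon_def)
qed

lemma canon_rep: "w \<in> W \<Longrightarrow> canon (rep i w) = w"
proof -
  assume "w \<in> W"
  then obtain f where f: "w = canon f" by (auto simp: W_def)
  have "near f (inv code w)"
    using someI[of "near f", OF near_refl] inv_f_f[OF inj_code] by (simp add: f canon_def)
  then have "canon (inv code w) = w" using f canon_eq near_sym by simp
  then show ?thesis by (simp add: rep_def)
qed

lemma W_eq: "v \<in> W \<Longrightarrow> w \<in> W \<Longrightarrow> v = w \<longleftrightarrow> near (rep i v) (rep j w)"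
  by (simp add: canon_eq[symmetric] canon_rep)

text \<open>
  The argument for the theorem of Los.  As \<open>interp\<close> reads the sequence \<open>s\<close> through fixed
  representatives, an element may depend on infinitely many coordinates; only the quantified
  coordinate is changed, up to equivalence, in the step for cylindrifications.
\<close>

theorem interp_hom:
  assumes alg: "is_algebra J A"
    and lm: "eventually (\<lambda>k. local_model (\<Gamma> k) (P k) A (eq k) (g k)) U"
    and P: "\<And>a. a \<in> car A \<Longrightarrow> eventually (\<lambda>k. a \<in> P k) U"
  shows "is_hom J A (full_cs J W) (interp g)"
proof -
  have bin: "eventually (\<lambda>k. (g k (at s k) (plus_of A a b) = (g k (at s k) a \<or> g k (at s k) b)) \<and>
      (g k (at s k) (times_of A a b) = (g k (at s k) a \<and> g k (at s k) b))) U"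
    if "a \<in> car A" "b \<in> car A" for a b s
    using lm P[OF that(1)] P[OF that(2)] by eventually_elim (simp add: local_model_def)
  have un: "eventually (\<lambda>k. g k (at s k) (compl_of A a) = (\<not> g k (at s k) a)) U" if "a \<in> car A" for a s
    using lm P[OF that(1)] by eventually_elim (simp add: local_model_def)
  have add: "interp g (plus_of A a b) = interp g a \<union> interp g b"
    if ab: "a \<in> car A" "b \<in> car A" for a b
  proof -
    have "eventually (\<lambda>k. g k (at s k) (plus_of A a b) = (g k (at s k) a \<or> g k (at s k) b)) U" for s
      using bin[OF ab] by (rule eventually_mono) blast
    from ev_cong[OF this] show ?thesis by (auto simp: interp_def ev_disj)
  qed
  have mul: "interp g (times_of A a b) = interp g a \<inter> interp g b"
    if ab: "a \<in> car A" "b \<in> car A" for a b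
  proof -
    have "eventually (\<lambda>k. g k (at s k) (times_of A a b) = (g k (at s k) a \<and> g k (at s k) b)) U" for s
      using bin[OF ab] by (rule eventually_mono) blast
    from ev_cong[OF this] show ?thesis by (auto simp: interp_def eventually_conj_iff)
  qed
  have neg: "interp g (compl_of A a) = (J \<rightarrow>\<^sub>E W) - interp g a" if a: "a \<in> car A" for a
    using ev_cong[OF un[OF a]] by (auto simp: interp_def ev_not)
  have zero: "interp g (zero_of A) = {}"
  proof -
    have "eventually (\<lambda>k. \<not> g k (at s k) (zero_of A)) U" for s
      using lm by eventually_elim (simp add: local_model_def)
    then show ?thesis by (simp add: interp_def ev_not)
  qed
  have one: "interp g (one_of A) = J \<rightarrow>\<^sub>E W"
  proof -
    have "eventually (\<lambda>k. g k (at s k) (one_of A)) U" for s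
      using lm by eventually_elim (simp add: local_model_def)
    then show ?thesis by (simp add: interp_def)
  qed
  have diag: "interp g (diag A i j) = {s \<in> J \<rightarrow>\<^sub>E W. s i = s j}" if ij: "i \<in> J" "j \<in> J" for i j
  proof -
    have "eventually (\<lambda>k. g k (at s k) (diag A i j) = eq k (at s k i) (at s k j)) U" for s
      using lm \<Gamma>_ev[OF ij(1)] \<Gamma>_ev[OF ij(2)] by eventually_elim (simp add: local_model_def)
    from ev_cong[OF this] have "s \<in> interp g (diag A i j) \<longleftrightarrow> s \<in> J \<rightarrow>\<^sub>E W \<and> near (rep i (s i)) (rep j (s j))" for s
      by (simp add: interp_def near_def at_def)
    then show ?thesis using W_eq ij by (auto simp: PiE_iff)
  qed
  have cyl: "interp g (cyl A i a) = {s \<in> J \<rightarrow>\<^sub>E W. \<exists>t\<in>interp g a. \<forall>j\<in>J. j \<noteq> i \<longrightarrow> t j = s j}"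
    if i: "i \<in> J" and a: "a \<in> car A" for i a
  proof -
    have 1: "s \<in> interp g (cyl A i a) \<longleftrightarrow> s \<in> J \<rightarrow>\<^sub>E W \<and> eventually (\<lambda>k. \<exists>n. g k ((at s k)(i := n)) a) U" for s
    proof -
      have "eventually (\<lambda>k. g k (at s k) (cyl A i a) = (\<exists>n. g k ((at s k)(i := n)) a)) U"
        using lm \<Gamma>_ev[OF i] P[OF a] by eventually_elim (simp add: local_model_def)
      from ev_cong[OF this] show ?thesis by (simp add: interp_def)
    qed
    show ?thesis
    proof (intro equalityI subsetI)
      fix s assume "s \<in> interp g (cyl A i a)"
      then have s: "s \<in> J \<rightarrow>\<^sub>E W" "eventually (\<lambda>k. \<exists>n. g k ((at s k)(i := n)) a) U" using 1 by auto
      define n where "n = (\<lambda>k. SOME n. g k ((at s k)(i := n)) a)"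
      have n: "eventually (\<lambda>k. g k ((at s k)(i := n k)) a) U"
        using s(2)
      proof eventually_elim
        case (elim k)
        then show ?case unfolding n_def using someI_ex[of "\<lambda>n. g k ((at s k)(i := n)) a"] by simp
      qed
      let ?t = "s(i := canon n)"
      have cW: "canon n \<in> W" by (simp add: W_def)
      have "near n (rep i (canon n))" using canon_rep[OF cW, of i] canon_eq[of n "rep i (canon n)"] by simp
      then have "eventually (\<lambda>k. eq k (n k) (rep i (canon n) k)) U" by (simp add: near_def)
      then have "eventually (\<lambda>k. g k (at ?t k) a) U"
        using n lm P[OF a] equivp
      proof eventually_elim
        case (elim k)
        have "\<forall>j\<in>\<Gamma> k. eq k (((at s k)(i := n k)) j) (at ?t k j)"
          using elim(1) equivp_reflp[OF elim(5)] by (simp add: at_def)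
        from local_model_cong[OF elim(3), OF elim(4), OF this, OF elim(2)] show ?case .
      qed
      moreover have "?t \<in> J \<rightarrow>\<^sub>E W" using s(1) i cW by (auto simp: PiE_iff extensional_def)
      ultimately have "?t \<in> interp g a" by (simp add: interp_def)
      then show "s \<in> {s \<in> J \<rightarrow>\<^sub>E W. \<exists>t\<in>interp g a. \<forall>j\<in>J. j \<noteq> i \<longrightarrow> t j = s j}"
        using s(1) by (intro CollectI conjI bexI[of _ ?t]) auto
    next
      fix s assume "s \<in> {s \<in> J \<rightarrow>\<^sub>E W. \<exists>t\<in>interp g a. \<forall>j\<in>J. j \<noteq> i \<longrightarrow> t j = s j}"
      then obtain t where t: "s \<in> J \<rightarrow>\<^sub>E W" "t \<in> J \<rightarrow>\<^sub>E W" "eventually (\<lambda>k. g k (at t k) a) U"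
        "\<forall>j\<in>J. j \<noteq> i \<longrightarrow> t j = s j" by (auto simp: interp_def)
      have "t j = s j" if "j \<noteq> i" for j using t that by (cases "j \<in> J") (auto simp: PiE_iff extensional_def)
      then have upd: "(at s k)(i := at t k i) = at t k" for k by (auto simp: at_def)
      have "eventually (\<lambda>k. \<exists>n. g k ((at s k)(i := n)) a) U"
        using t(3)
      proof (rule eventually_mono)
        fix k assume "g k (at t k) a"
        then have "g k ((at s k)(i := at t k i)) a" by (simp add: upd)
        then show "\<exists>n. g k ((at s k)(i := n)) a" by (rule exI)
      qed
      then show "s \<in> interp g (cyl A i a)" using 1 t(1) by blast
    qed
  qed
  have "interp g \<in> car A \<rightarrow> car (full_cs J W)" by (auto simp: full_cs_def interp_def)
  then show ?thesis
    unfolding is_hom_def using add mul neg zero one diag cyl by (simp add: full_cs_def)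
qed

definition base_point :: "'i \<Rightarrow> 'u" where
  "base_point = (\<lambda>i\<in>J. canon (\<lambda>k. q0 k i))"

lemma base_point_interp:
  assumes lm: "eventually (\<lambda>k. local_model (\<Gamma> k) (P k) A (eq k) (g k)) U"
    and P: "eventually (\<lambda>k. a \<in> P k) U"
  shows "base_point \<in> interp g a \<longleftrightarrow> eventually (\<lambda>k. g k (q0 k) a) U"
proof -
  have "eventually (\<lambda>k. g k (at base_point k) a = g k (q0 k) a) U"
    using lm P equivp
  proof eventually_elim
    case (elim k)
    have "at base_point k j = q0 k j" if "j \<in> \<Gamma> k" for j
      using \<Gamma>_sub[of k] that by (auto simp: at_def base_point_def rep_def)
    then have "\<forall>j\<in>\<Gamma> k. eq k (at base_point k j) (q0 k j)" "\<forall>j\<in>\<Gamma> k. eq k (q0 k j) (at base_point k j)"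
      using equivp_reflp[OF elim(3)] by simp_all
    then show ?case
      using local_model_cong[OF elim(1), OF elim(2), of "at base_point k" "q0 k"]
        local_model_cong[OF elim(1), OF elim(2), of "q0 k" "at base_point k"] by (intro iffI)
  qed
  from ev_cong[OF this] show ?thesis by (auto simp: interp_def base_point_def W_def)
qed

end

lemma infinite_avoids: "infinite S \<Longrightarrow> finite F \<Longrightarrow> \<exists>x\<in>S. x \<notin> F"
  by (meson finite_subset subsetI)

section \<open>Common free indices of finitely many elements\<close>

locale cyl_field = cyl_frame +
  fixes \<A> :: "'b set set"
  assumes \<A>_sub: "X \<in> \<A> \<Longrightarrow> X \<subseteq> \<Omega>"
    and \<A>_Un: "X \<in> \<A> \<Longrightarrow> Y \<in> \<A> \<Longrightarrow> X \<union> Y \<in> \<A>"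
    and \<A>_Compl: "X \<in> \<A> \<Longrightarrow> \<Omega> - X \<in> \<A>"
    and \<A>_cl: "i \<in> V \<Longrightarrow> X \<in> \<A> \<Longrightarrow> cl i X \<in> \<A>"
    and \<A>_E: "i \<in> V \<Longrightarrow> j \<in> V \<Longrightarrow> E i j \<in> \<A>"
    and infinite_V: "infinite V"
    and complemented: "X \<in> \<A> \<Longrightarrow> \<exists>i\<in>V. closed i X"
begin

lemma \<A>_Int: "X \<in> \<A> \<Longrightarrow> Y \<in> \<A> \<Longrightarrow> X \<inter> Y \<in> \<A>"
proof -
  assume XY: "X \<in> \<A>" "Y \<in> \<A>"
  then have "X \<inter> Y = \<Omega> - ((\<Omega> - X) \<union> (\<Omega> - Y))" using \<A>_sub by auto
  then show ?thesis using XY \<A>_Un \<A>_Compl by simp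
qed

lemma \<A>_Diff: "X \<in> \<A> \<Longrightarrow> Y \<in> \<A> \<Longrightarrow> X - Y \<in> \<A>"
proof -
  assume XY: "X \<in> \<A>" "Y \<in> \<A>"
  then have "X - Y = X \<inter> (\<Omega> - Y)" using \<A>_sub by auto
  then show ?thesis using XY \<A>_Int \<A>_Compl by simp
qed

text \<open>
  If \<open>X\<close> is free of \<open>k\<close> but depends on \<open>j\<close>, then adding \<open>d\<^sub>k\<^sub>j \<sqinter> d\<^sub>k\<^sub>l\<close> modulo 2 gives a set that depends on
  \<open>k\<close> and still depends on \<open>j\<close>.  The points are moved as follows, starting from a sequence \<open>w0\<close> whose
  values at \<open>j\<close> and \<open>l\<close> differ: \<open>w1\<close> sets \<open>k\<close> to the value at \<open>l\<close> and \<open>v1\<close> sets \<open>k\<close> to the value at \<open>j\<close>;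
  then \<open>w2\<close> and \<open>v2\<close> set \<open>j\<close> to the value at \<open>l\<close>.  Of these four only \<open>w2\<close> lies in \<open>z\<close>, and \<open>w2\<close>, \<open>v2\<close>
  differ at \<open>k\<close> only.  The single diagonal element \<open>d\<^sub>k\<^sub>j\<close> would not do: over a base of two
  points, \<open>X\<close> may change with every change of \<open>j\<close>, as \<open>d\<^sub>k\<^sub>j\<close> does, and then their sum is free of \<open>j\<close>.
\<close>

lemma sym_diff_not_closed:
  assumes V: "k \<in> V" "j \<in> V" "l \<in> V" "k \<noteq> j" "k \<noteq> l" "j \<noteq> l"
    and X: "X \<subseteq> \<Omega>" "closed k X" "\<not> closed j X"
  defines "z \<equiv> E k j \<inter> E k l"
  defines "w \<equiv> (X - z) \<union> (z - X)"
  shows "\<not> closed j w" "\<not> closed k w"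
proof -
  obtain a b where ab: "a \<in> X" "T j a b" "b \<notin> X" using X by (auto simp: closed_def)
  then have "\<not> (a \<in> E j l \<and> b \<in> E j l)" using E_uniq[of j l a b] V by auto
  then obtain w0 where w0: "w0 \<in> \<Omega>" "w0 \<notin> E j l" using ab T_dom[of j a b] V by auto
  define w1 where "w1 = repl k l w0"
  have w1: "T k w0 w1" "w1 \<in> E k l" "w1 \<in> \<Omega>"
    using repl[of k l w0] repl_in[of k l w0] V w0 by (auto simp: w1_def)
  have n1: "w1 \<notin> E j l" using closed_iff[OF _ closed_E[of j l k] w1(1)] V w0 by auto
  have n1': "w1 \<notin> E k j" using E_sym[of k j w1] E_trans[of j k l w1] n1 w1 V by auto
  define w2 where "w2 = repl j l w1"
  have w2: "T j w1 w2" "w2 \<in> E j l" using repl[of j l w1] V w1 by (auto simp: w2_def)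
  have "w2 \<in> E k l" using closed_iff[OF _ closed_E[of k l j] w2(1)] V w1 by auto
  then have w2z: "w2 \<in> z" using E_sym[of j l w2] E_trans[of k l j w2] w2 V by (auto simp: z_def)
  define v1 where "v1 = repl k j w0"
  have v1: "T k w0 v1" "v1 \<in> E k j" "v1 \<in> \<Omega>"
    using repl[of k j w0] repl_in[of k j w0] V w0 by (auto simp: v1_def)
  have m1: "v1 \<notin> E j l" using closed_iff[OF _ closed_E[of j l k] v1(1)] V w0 by auto
  have m1': "v1 \<notin> E k l" using E_sym[of k j v1] E_trans[of j k l v1] m1 v1 V by auto
  define v2 where "v2 = repl j l v1"
  have v2: "T j v1 v2" "v2 \<in> E j l" using repl[of j l v1] V v1 by (auto simp: v2_def)
  have v2z: "v2 \<notin> z" using closed_iff[OF _ closed_E[of k l j] v2(1)] V m1' by (auto simp: z_def)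
  have "T k w1 v1" using w1(1) v1(1) T_sym T_trans V by blast
  then have T2: "T k w2 v2" using repl_forth[of j l k w1 v1] V by (auto simp: w2_def v2_def)
  have same: "w2 \<in> X \<longleftrightarrow> v2 \<in> X" using closed_iff[OF V(1) X(2) T2] .
  then show "\<not> closed k w" using closed_iff[OF V(1) _ T2, of w] w2z v2z by (auto simp: w_def)
  show "\<not> closed j w"
  proof
    assume cj: "closed j w"
    have "w1 \<in> w \<longleftrightarrow> w2 \<in> w" using closed_iff[OF V(2) cj w2(1)] .
    then have 1: "w1 \<in> X \<longleftrightarrow> w2 \<notin> X" using n1' w2z by (auto simp: w_def z_def)
    have "v1 \<in> w \<longleftrightarrow> v2 \<in> w" using closed_iff[OF V(2) cj v2(1)] .
    then have 2: "v1 \<in> X \<longleftrightarrow> v2 \<in> X" using m1' v2z by (auto simp: w_def z_def)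
    have "w1 \<in> X \<longleftrightarrow> v1 \<in> X"
      using closed_iff[OF V(1) X(2) w1(1)] closed_iff[OF V(1) X(2) v1(1)] by simp
    then show False using 1 2 same by simp
  qed
qed

text \<open>
  If only finitely many indices were free, the previous lemma would lower their number as long as
  one is left, and finally give an element that depends on every index.
\<close>

lemma infinite_closed:
  assumes "X \<in> \<A>" shows "infinite {i \<in> V. closed i X}"
proof
  assume "finite {i \<in> V. closed i X}"
  then show False using assms
  proof (induction "card {i \<in> V. closed i X}" arbitrary: X rule: less_induct)
    case less
    let ?C = "{i \<in> V. closed i X}"
    obtain k where k: "k \<in> V" "closed k X" using complemented less.prems by blast
    have inf: "infinite (V - ?C)" using infinite_V less.prems by simp
    then obtain j where j: "j \<in> V - ?C" using infinite_avoids[of "V - ?C" "{}"] by blast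
    obtain l where l: "l \<in> V - ?C" "l \<noteq> j"
      using infinite_avoids[OF inf, of "{j}"] by auto
    define z where "z = E k j \<inter> E k l"
    define w where "w = (X - z) \<union> (z - X)"
    have X: "X \<subseteq> \<Omega>" using \<A>_sub less.prems by blast
    have "z \<in> \<A>" using \<A>_Int \<A>_E k j l unfolding z_def by blast
    then have wA: "w \<in> \<A>" using \<A>_Un \<A>_Diff less.prems unfolding w_def by blast
    have d: "k \<noteq> j" "k \<noteq> l" "j \<noteq> l" "j \<in> V" "l \<in> V" "\<not> closed j X" "\<not> closed l X" using k j l by auto
    have nj: "\<not> closed j w" "\<not> closed k w"
      using sym_diff_not_closed[OF k(1) d(4,5,1,2,3) X k(2) d(6)] by (auto simp: w_def z_def)
    have nl: "\<not> closed l w"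
      using sym_diff_not_closed(1)[OF k(1) d(5,4,2,1) d(3)[symmetric] X k(2) d(7)]
      by (simp add: w_def z_def Int_commute)
    have "closed i X" if i: "i \<in> V" "closed i w" for i
    proof -
      have "i \<noteq> j" "i \<noteq> k" "i \<noteq> l" using i nj nl by auto
      then have cz: "closed i z" unfolding z_def using closed_E k d i by (intro closed_Int) auto
      have "X = (w - z) \<union> (z - w)" by (auto simp: w_def)
      moreover have "closed i (w - z)" "closed i (z - w)"
        using cz i closed_iff[OF i(1)] unfolding closed_def by blast+
      ultimately show ?thesis using closed_Un by metis
    qed
    then have sub: "{i \<in> V. closed i w} \<subseteq> ?C - {k}" using nj by auto
    moreover have "?C - {k} \<subset> ?C" using k by auto
    ultimately have "{i \<in> V. closed i w} \<subset> ?C" by blast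
    then have "card {i \<in> V. closed i w} < card ?C" using less.prems by (intro psubset_card_mono)
    moreover have "finite {i \<in> V. closed i w}" using sub less.prems by (meson finite_Diff finite_subset)
    ultimately show False using less.hyps wA by blast
  qed
qed

lemma cl_E_Int:
  assumes "i \<in> V" "n \<in> V" "i \<noteq> n" shows "{a \<in> \<Omega>. repl i n a \<in> X} = cl i (E i n \<inter> X)"
proof (intro equalityI subsetI)
  fix a assume "a \<in> {a \<in> \<Omega>. repl i n a \<in> X}"
  then show "a \<in> cl i (E i n \<inter> X)" using repl[OF assms, of a] by (auto simp: cl_def)
next
  fix a assume "a \<in> cl i (E i n \<inter> X)"
  then obtain b where b: "b \<in> E i n" "b \<in> X" "T i a b" by (auto simp: cl_def)
  then have "repl i n a = b" using repl_eq[OF assms b(3,1)] by simp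
  then show "a \<in> {a \<in> \<Omega>. repl i n a \<in> X}" using b T_dom[OF assms(1) b(3)] by simp
qed

text \<open>
  One element that depends on almost all indices on which \<open>X\<close> or \<open>Y\<close> depends.  After \<open>k\<close> is renamed to
  \<open>k'\<close> in \<open>Y\<close>, both are free of \<open>k\<close>, and so each can be recovered from its restriction to \<open>d\<^sub>k\<^sub>l\<close>,
  respectively to the complement of \<open>d\<^sub>k\<^sub>l\<close>.
\<close>

lemma join:
  assumes XY: "X \<in> \<A>" "Y \<in> \<A>"
  shows "\<exists>z\<in>\<A>. \<exists>F. finite F \<and> (\<forall>i\<in>V - F. closed i z \<longrightarrow> closed i X \<and> closed i Y)"
proof -
  obtain k where k: "k \<in> V" "closed k X" using complemented XY by blast
  obtain k' where k': "k' \<in> V" "closed k' Y" "k' \<noteq> k"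
    using infinite_avoids[OF infinite_closed[OF XY(2)], of "{k}"] by auto
  obtain l where l: "l \<in> V" "l \<noteq> k" "l \<noteq> k'"
    using infinite_avoids[OF infinite_V, of "{k, k'}"] by auto
  define Y1 where "Y1 = cl k (E k k' \<inter> Y)"
  define z where "z = (X \<inter> E k l) \<union> (Y1 - E k l)"
  have Y1: "Y1 = {a \<in> \<Omega>. repl k k' a \<in> Y}" using cl_E_Int[of k k' Y] k k' by (simp add: Y1_def)
  have Y1k: "closed k Y1" using closed_cl_self k by (simp add: Y1_def)
  have zA: "z \<in> \<A>" unfolding z_def Y1_def
    using XY k k' l by (intro \<A>_Un \<A>_Int \<A>_Diff \<A>_cl \<A>_E)
  have "closed i X \<and> closed i Y" if i: "i \<in> V - {k, k', l}" and cz: "closed i z" for i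
  proof -
    have iV: "i \<in> V" "i \<noteq> k" "i \<noteq> k'" "i \<noteq> l" using i by auto
    have cE: "closed i (E k l)" "closed i (\<Omega> - E k l)"
      using closed_E[of k l i] closed_Diff[of i "E k l"] k l iV by auto
    have "X \<inter> E k l = z \<inter> E k l" by (auto simp: z_def)
    then have cX: "closed i (X \<inter> E k l)" using closed_Int[OF cz cE(1)] by simp
    have "Y1 - E k l = z \<inter> (\<Omega> - E k l)"
      using cl_sub[OF k(1)] by (auto simp: z_def Y1_def)
    then have cY: "closed i (Y1 - E k l)" using closed_Int[OF cz cE(2)] by simp
    have 1: "closed i X" unfolding closed_def
    proof (intro ballI allI impI)
      fix a b assume ab: "a \<in> X" "T i a b"
      have d: "a \<in> \<Omega>" "b \<in> \<Omega>" using T_dom iV ab by auto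
      note ra = repl[OF k(1) l(1) l(2)[symmetric] d(1)] and rb = repl[OF k(1) l(1) l(2)[symmetric] d(2)]
      have "repl k l a \<in> X \<inter> E k l" using closed_iff[OF k(1,2) ra(1)] ab ra(2) by simp
      moreover have "T i (repl k l a) (repl k l b)" using repl_forth[of k l i a b] k l iV ab by auto
      ultimately have "repl k l b \<in> X" using closed_iff[OF iV(1) cX] by blast
      then show "b \<in> X" using closed_iff[OF k(1,2) rb(1)] by simp
    qed
    have 2: "closed i Y1" unfolding closed_def
    proof (intro ballI allI impI)
      fix a b assume ab: "a \<in> Y1" "T i a b"
      have d: "a \<in> \<Omega>" "b \<in> \<Omega>" using T_dom iV ab by auto
      show "b \<in> Y1"
      proof (cases "\<exists>c. T k a c \<and> c \<notin> E k l")
        case True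
        then obtain c where c: "T k a c" "c \<notin> E k l" by blast
        then have cY1: "c \<in> Y1 - E k l" using closed_iff[OF k(1) Y1k c(1)] ab by simp
        obtain e where e: "T i c e" "T k e b"
          using T_comm[OF k(1) iV(1) T_sym[OF k(1) c(1)] ab(2)] by blast
        have "e \<in> Y1" using closed_iff[OF iV(1) cY e(1)] cY1 by simp
        then show ?thesis using closed_iff[OF k(1) Y1k e(2)] by simp
      next
        \<comment> \<open>In the part where no value at \<open>k\<close> differs from that at \<open>l\<close>, the base has one point only.\<close>
        case False
        then have alone: "c = a" if "T k a c" for c
          using E_uniq[OF k(1) l(1) l(2)[symmetric] that] T_refl[OF k(1) d(1)] that by auto
        have ki: "k \<noteq> i" using iV by auto
        have "a \<in> E k i" using repl[OF k(1) iV(1) ki d(1)] alone[of "repl k i a"] by simp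
        then have aE: "a \<in> E i k" using E_sym k iV by blast
        note rb = repl[OF k(1) iV(1) ki d(2)]
        obtain e where e: "T k a e" "T i e (repl k i b)" using T_comm[OF iV(1) k(1) ab(2) rb(1)] by blast
        have "T i a (repl k i b)" using e alone[of e] by simp
        then have "a = repl k i b"
          using E_uniq[of i k a "repl k i b"] aE E_sym[of k i "repl k i b"] rb(2) iV k by auto
        then have "b = a" using T_sym[OF k(1) rb(1)] alone[of b] by simp
        then show ?thesis using ab by simp
      qed
    qed
    have "closed i Y" unfolding closed_def
    proof (intro ballI allI impI)
      fix a b assume ab: "a \<in> Y" "T i a b"
      have d: "a \<in> \<Omega>" "b \<in> \<Omega>" using T_dom iV ab by auto
      have diag: "repl k' k c \<in> Y1 \<longleftrightarrow> c \<in> Y" if c: "c \<in> \<Omega>" for c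
      proof -
        note r = repl[OF k'(1) k(1) k'(3) c]
        have "repl k' k c \<in> \<Omega>" using repl_in[OF k'(1) k(1) k'(3) c] .
        moreover have "repl k k' (repl k' k c) = repl k' k c"
          using repl_eq[of k k' "repl k' k c" "repl k' k c"] T_refl[OF k(1) calculation]
            E_sym[OF k'(1) k(1) r(2)] k k' by auto
        ultimately show ?thesis using closed_iff[OF k'(1,2) r(1)] by (simp add: Y1)
      qed
      have "T i (repl k' k a) (repl k' k b)" using repl_forth[of k' k i a b] k k' iV ab by auto
      then show "b \<in> Y" using closed_iff[OF iV(1) 2, of "repl k' k a" "repl k' k b"] diag[OF d(1)] diag[OF d(2)] ab by simp
    qed
    then show ?thesis using 1 by blast
  qed
  then show ?thesis using zA by (intro bexI[of _ z] exI[of _ "{k, k', l}"]) auto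
qed

theorem infinite_common_closed:
  assumes "finite P" "P \<subseteq> \<A>"
  shows "infinite {i \<in> V. \<forall>X\<in>P. closed i X}"
proof -
  have "\<exists>z\<in>\<A>. \<exists>F. finite F \<and> (\<forall>i\<in>V - F. closed i z \<longrightarrow> (\<forall>X\<in>P. closed i X))"
    using assms
  proof (induction P rule: finite_induct)
    case empty
    obtain i where "i \<in> V" using infinite_avoids[OF infinite_V, of "{}"] by auto
    then show ?case using \<A>_E by (intro bexI[of _ "E i i"] exI[of _ "{}"]) auto
  next
    case (insert X P)
    then obtain z F where z: "z \<in> \<A>" "finite F" "\<forall>i\<in>V - F. closed i z \<longrightarrow> (\<forall>X\<in>P. closed i X)" by auto
    have "X \<in> \<A>" using insert.prems by simp
    from join[OF this z(1)] obtain y G where y: "y \<in> \<A>" "finite G"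
      "\<forall>i\<in>V - G. closed i y \<longrightarrow> closed i X \<and> closed i z" by (elim bexE exE conjE)
    have "\<forall>i\<in>V - (F \<union> G). closed i y \<longrightarrow> (\<forall>Y\<in>insert X P. closed i Y)"
    proof (intro ballI impI)
      fix i Y assume i: "i \<in> V - (F \<union> G)" "closed i y" "Y \<in> insert X P"
      have "closed i X \<and> closed i z" using bspec[OF y(3), of i] i(1,2) by blast
      then show "closed i Y" using bspec[OF z(3), of i] i(1,3) by blast
    qed
    moreover have "finite (F \<union> G)" using y(2) z(2) by simp
    ultimately show ?case using y(1) by blast
  qed
  then obtain z F where z: "z \<in> \<A>" "finite F" "\<forall>i\<in>V - F. closed i z \<longrightarrow> (\<forall>X\<in>P. closed i X)" by blast
  have "infinite ({i \<in> V. closed i z} - F)" using infinite_closed[OF z(1)] z(2) by simp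
  moreover have "{i \<in> V. closed i z} - F \<subseteq> {i \<in> V. \<forall>X\<in>P. closed i X}" using z(3) by auto
  ultimately show ?thesis using finite_subset by blast
qed

end

section \<open>Representability from homomorphisms into set algebras\<close>

lemma full_cs_simps [simp]:
  "car (full_cs J U) = Pow (J \<rightarrow>\<^sub>E U)" "plus_of (full_cs J U) = (\<union>)" "times_of (full_cs J U) = (\<inter>)"
  "compl_of (full_cs J U) X = (J \<rightarrow>\<^sub>E U) - X" "zero_of (full_cs J U) = {}" "one_of (full_cs J U) = J \<rightarrow>\<^sub>E U"
  "cyl (full_cs J U) i X = {s \<in> J \<rightarrow>\<^sub>E U. \<exists>t\<in>X. \<forall>j\<in>J. j \<noteq> i \<longrightarrow> t j = s j}"
  "diag (full_cs J U) i j = {s \<in> J \<rightarrow>\<^sub>E U. s i = s j}"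
  by (simp_all add: full_cs_def)

lemma prod_alg_simps [simp]:
  "car (prod_alg I A) = (\<Pi>\<^sub>E k\<in>I. car (A k))"
  "plus_of (prod_alg I A) f g = (\<lambda>k\<in>I. plus_of (A k) (f k) (g k))"
  "times_of (prod_alg I A) f g = (\<lambda>k\<in>I. times_of (A k) (f k) (g k))"
  "compl_of (prod_alg I A) f = (\<lambda>k\<in>I. compl_of (A k) (f k))"
  "zero_of (prod_alg I A) = (\<lambda>k\<in>I. zero_of (A k))"
  "one_of (prod_alg I A) = (\<lambda>k\<in>I. one_of (A k))"
  "cyl (prod_alg I A) i f = (\<lambda>k\<in>I. cyl (A k) i (f k))"
  "diag (prod_alg I A) i j = (\<lambda>k\<in>I. diag (A k) i j)"
  by (simp_all add: prod_alg_def)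

lemma is_algebra_full_cs: "is_algebra J (full_cs J U)"
  by (auto simp: is_algebra_def closed_under_ops_def)

lemma is_algebra_prod_alg:
  assumes "\<And>k. k \<in> I \<Longrightarrow> is_algebra J (A k)" shows "is_algebra J (prod_alg I A)"
  using assms by (auto simp: is_algebra_def closed_under_ops_def PiE_iff)

lemma is_homD:
  assumes "is_hom J A B h"
  shows "x \<in> car A \<Longrightarrow> h x \<in> car B"
    "x \<in> car A \<Longrightarrow> y \<in> car A \<Longrightarrow> h (plus_of A x y) = plus_of B (h x) (h y)"
    "x \<in> car A \<Longrightarrow> y \<in> car A \<Longrightarrow> h (times_of A x y) = times_of B (h x) (h y)"
    "x \<in> car A \<Longrightarrow> h (compl_of A x) = compl_of B (h x)"
    "h (zero_of A) = zero_of B" "h (one_of A) = one_of B"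
    "i \<in> J \<Longrightarrow> x \<in> car A \<Longrightarrow> h (cyl A i x) = cyl B i (h x)"
    "i \<in> J \<Longrightarrow> j \<in> J \<Longrightarrow> h (diag A i j) = diag B i j"
  using assms by (auto simp: is_hom_def)

lemma is_hom_tuple:
  assumes "\<And>k. k \<in> I \<Longrightarrow> is_hom J A (B k) (h k)"
  shows "is_hom J A (prod_alg I B) (\<lambda>a. \<lambda>k\<in>I. h k a)"
  unfolding is_hom_def using is_homD[OF assms] by (auto simp: restrict_def fun_eq_iff)

lemma RCA_I:
  fixes I :: "'u set" and U :: "'u \<Rightarrow> 'u set"
  assumes alg: "is_algebra J A"
    and h: "\<And>k. k \<in> I \<Longrightarrow> is_hom J A (full_cs J (U k)) (h k)"
    and sep: "\<And>a b. a \<in> car A \<Longrightarrow> b \<in> car A \<Longrightarrow> (\<And>k. k \<in> I \<Longrightarrow> h k a = h k b) \<Longrightarrow> a = b"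
  shows "A \<in> RCA TYPE('u) J"
proof -
  let ?P = "prod_alg I (\<lambda>k. full_cs J (U k))"
  define H where "H = (\<lambda>a. \<lambda>k\<in>I. h k a)"
  have H: "is_hom J A ?P H" unfolding H_def using is_hom_tuple[OF h] .
  have cl: "closed_under_ops J (car A) A" using alg by (simp add: is_algebra_def)
  have sub: "H ` car A \<subseteq> car ?P" using H unfolding is_hom_def by blast
  have "closed_under_ops J (H ` car A) ?P"
    unfolding closed_under_ops_def
  proof (intro conjI ballI)
    fix f g assume "f \<in> H ` car A" "g \<in> H ` car A"
    then obtain a b where ab: "f = H a" "g = H b" "a \<in> car A" "b \<in> car A" by blast
    have "plus_of A a b \<in> car A" "times_of A a b \<in> car A" using cl ab(3,4) unfolding closed_under_ops_def by blast+
    moreover have "plus_of ?P f g = H (plus_of A a b)" "times_of ?P f g = H (times_of A a b)"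
      using H ab(3,4) unfolding is_hom_def ab(1,2) by metis+
    ultimately show "plus_of ?P f g \<in> H ` car A" "times_of ?P f g \<in> H ` car A" by blast+
  next
    fix f assume "f \<in> H ` car A"
    then obtain a where a: "f = H a" "a \<in> car A" by blast
    have "compl_of A a \<in> car A" using cl a(2) unfolding closed_under_ops_def by blast
    moreover have "compl_of ?P f = H (compl_of A a)" using H a(2) unfolding is_hom_def a(1) by metis
    ultimately show "compl_of ?P f \<in> H ` car A" by blast
  next
    have "zero_of ?P = H (zero_of A)" "zero_of A \<in> car A" "one_of ?P = H (one_of A)" "one_of A \<in> car A"
      using H cl unfolding is_hom_def closed_under_ops_def by metis+
    then show "zero_of ?P \<in> H ` car A" "one_of ?P \<in> H ` car A" by blast+
  next
    fix i f assume i: "i \<in> J" and "f \<in> H ` car A"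
    then obtain a where a: "f = H a" "a \<in> car A" by blast
    have "cyl A i a \<in> car A" using cl a(2) i unfolding closed_under_ops_def by blast
    moreover have "cyl ?P i f = H (cyl A i a)" using H a(2) i unfolding is_hom_def a(1) by metis
    ultimately show "cyl ?P i f \<in> H ` car A" by blast
  next
    fix i j assume ij: "i \<in> J" "j \<in> J"
    have "diag A i j \<in> car A" using cl ij unfolding closed_under_ops_def by blast
    moreover have "diag ?P i j = H (diag A i j)" using H ij unfolding is_hom_def by metis
    ultimately show "diag ?P i j \<in> H ` car A" by blast
  qed
  then have s: "is_subuniverse J (H ` car A) ?P" using sub by (simp add: is_subuniverse_def)
  have "a = b" if ab: "a \<in> car A" "b \<in> car A" "H a = H b" for a b
  proof (rule sep[OF ab(1,2)])
    fix k assume "k \<in> I"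
    then show "h k a = h k b" using fun_cong[OF ab(3), of k] by (simp add: H_def)
  qed
  then have "bij_betw H (car A) (H ` car A)" by (intro bij_betw_imageI inj_onI refl)
  moreover have "is_hom J A (?P\<lparr>car := H ` car A\<rparr>) H" using H unfolding is_hom_def by simp
  ultimately have "isomorphic J A (?P\<lparr>car := H ` car A\<rparr>)" unfolding isomorphic_def by auto
  then show ?thesis using s alg unfolding RCA_def by blast
qed

lemma prod_full_cs_RCA:
  fixes I :: "'u set" and U :: "'u \<Rightarrow> 'u set"
  shows "prod_alg I (\<lambda>k. full_cs J (U k)) \<in> RCA TYPE('u) J"
proof (rule RCA_I[where h = "\<lambda>k f. f k" and I = I and U = U])
  let ?P = "prod_alg I (\<lambda>k. full_cs J (U k))"
  show "is_algebra J ?P" by (intro is_algebra_prod_alg is_algebra_full_cs)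
  show "is_hom J ?P (full_cs J (U k)) (\<lambda>f. f k)" if "k \<in> I" for k
    using that by (auto simp: is_hom_def PiE_iff)
  show "a = b" if "a \<in> car ?P" "b \<in> car ?P" "\<And>k. k \<in> I \<Longrightarrow> a k = b k" for a b
    by (rule PiE_ext[of _ I "\<lambda>k. car (full_cs J (U k))"]) (use that in simp_all)
qed

text \<open>Apply the hypothesis to \<open>a \<sqinter> \<sim> b\<close> and to \<open>b \<sqinter> \<sim> a\<close>.\<close>

lemma (in boolean_carrier) separating_homs:
  assumes h: "\<And>k. k \<in> I \<Longrightarrow> is_hom J A (full_cs J (W k)) (h k)"
    and sep: "\<And>x. x \<in> C \<Longrightarrow> x \<noteq> O' \<Longrightarrow> \<exists>k\<in>I. h k x \<noteq> {}"
    and ab: "a \<in> C" "b \<in> C" and eq: "\<And>k. k \<in> I \<Longrightarrow> h k a = h k b"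
  shows "a = b"
proof -
  have le: "a \<sqinter> \<sim> b = O'" if ab: "a \<in> C" "b \<in> C" and eq: "\<And>k. k \<in> I \<Longrightarrow> h k a = h k b" for a b
  proof (rule ccontr)
    assume "a \<sqinter> \<sim> b \<noteq> O'"
    then obtain k where k: "k \<in> I" "h k (a \<sqinter> \<sim> b) \<noteq> {}" using sep[of "a \<sqinter> \<sim> b"] ab by auto
    have "h k (a \<sqinter> \<sim> b) = h k a \<inter> ((J \<rightarrow>\<^sub>E W k) - h k b)"
      using is_homD(3)[OF h[OF k(1)] ab(1), of "\<sim> b"] is_homD(4)[OF h[OF k(1)] ab(2)] ab by simp
    then show False using k(2) eq[OF k(1)] by blast
  qed
  have "a = a \<sqinter> b" "b = b \<sqinter> a"
    using split[OF ab] split[OF ab(2,1)] le[OF ab eq] le[OF ab(2,1) eq[symmetric]] ab bool(7) by simp_all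
  then show ?thesis using bool(2)[OF ab] by simp
qed

section \<open>The canonical frame of a cylindric algebra\<close>

locale cyl_alg =
  fixes J :: "'i set" and A :: "('i, 'a) cyl_algebra"
  assumes CA: "A \<in> CA J"
begin

lemma algebra: "is_algebra J A" and boolean: "boolean_reduct A"
  using CA by (simp_all add: CA_def)

sublocale boolean_carrier A
  using algebra boolean by unfold_locales (auto simp: is_algebra_def closed_under_ops_def)

lemma cyl_in [simp]: "i \<in> J \<Longrightarrow> x \<in> C \<Longrightarrow> cyl A i x \<in> C"
  and diag_in [simp]: "i \<in> J \<Longrightarrow> j \<in> J \<Longrightarrow> diag A i j \<in> C"
  using algebra by (simp_all add: is_algebra_def closed_under_ops_def)

lemma cyl_laws:
  "i \<in> J \<Longrightarrow> cyl A i O' = O'"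
  "i \<in> J \<Longrightarrow> x \<in> C \<Longrightarrow> x \<squnion> cyl A i x = cyl A i x"
  "i \<in> J \<Longrightarrow> x \<in> C \<Longrightarrow> y \<in> C \<Longrightarrow> cyl A i (x \<sqinter> cyl A i y) = cyl A i x \<sqinter> cyl A i y"
  "i \<in> J \<Longrightarrow> j \<in> J \<Longrightarrow> x \<in> C \<Longrightarrow> cyl A i (cyl A j x) = cyl A j (cyl A i x)"
  "i \<in> J \<Longrightarrow> diag A i i = I'"
  "i \<in> J \<Longrightarrow> j \<in> J \<Longrightarrow> k \<in> J \<Longrightarrow> k \<noteq> i \<Longrightarrow> k \<noteq> j \<Longrightarrow> diag A i j = cyl A k (diag A i k \<sqinter> diag A k j)"
  "i \<in> J \<Longrightarrow> j \<in> J \<Longrightarrow> x \<in> C \<Longrightarrow> i \<noteq> j \<Longrightarrow>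
     cyl A i (diag A i j \<sqinter> x) \<sqinter> cyl A i (diag A i j \<sqinter> \<sim> x) = O'"
  using CA unfolding CA_def le_of_def by simp_all

definition fixed :: "'i \<Rightarrow> 'a \<Rightarrow> bool" where
  "fixed i x \<longleftrightarrow> x \<in> C \<and> cyl A i x = x"

lemma cyl_one: "i \<in> J \<Longrightarrow> cyl A i I' = I'"
  using cyl_laws(2)[of i I'] absorb[of I' "cyl A i I'"] bool(2)[of I' "cyl A i I'"] bool(8)[of "cyl A i I'"]
  by simp

lemma fixed_cyl: "i \<in> J \<Longrightarrow> x \<in> C \<Longrightarrow> fixed i (cyl A i x)"
  using cyl_laws(3)[of i I' x] bool(2)[of I' "cyl A i x"] bool(8)[of "cyl A i x"] cyl_one[of i]
  by (simp add: fixed_def)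

lemma fixed_mul: "i \<in> J \<Longrightarrow> fixed i x \<Longrightarrow> fixed i y \<Longrightarrow> fixed i (x \<sqinter> y)"
  using cyl_laws(3)[of i x y] by (simp add: fixed_def)

lemma fixed_one: "i \<in> J \<Longrightarrow> fixed i I'"
  using cyl_one by (simp add: fixed_def)

lemma ultra_cyl: "ultra G \<Longrightarrow> i \<in> J \<Longrightarrow> x \<in> G \<Longrightarrow> cyl A i x \<in> G"
  using ultra_add[of G x "cyl A i x"] cyl_laws(2)[of i x] ultra_C[of G x] by simp

lemma fixed_neg:
  assumes "i \<in> J" "fixed i x" shows "fixed i (\<sim> x)"
proof -
  have x: "x \<in> C" "cyl A i x = x" using assms by (auto simp: fixed_def)
  let ?y = "cyl A i (\<sim> x)"
  have "?y \<sqinter> x = cyl A i (\<sim> x \<sqinter> x)" using cyl_laws(3)[of i "\<sim> x" x] x assms by simp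
  also have "\<dots> = O'" using bool(2)[of "\<sim> x" x] bool(10)[of x] cyl_laws(1) x assms by simp
  finally have "?y = ?y \<sqinter> \<sim> x"
    using split[of ?y x] x assms bool(1)[of O' "?y \<sqinter> \<sim> x"] bool(7)[of "?y \<sqinter> \<sim> x"] by simp
  also have "\<dots> = \<sim> x \<sqinter> (\<sim> x \<squnion> ?y)"
    using cyl_laws(2)[of i "\<sim> x"] bool(2)[of "\<sim> x" ?y] x assms by simp
  also have "\<dots> = \<sim> x" using absorb[of "\<sim> x" ?y] x assms by simp
  finally show ?thesis using x by (simp add: fixed_def)
qed

definition \<Omega> :: "'a set set" where "\<Omega> = Collect ultra"

text \<open>
  Two ultrafilters are \<open>i\<close>-neighbours when they contain the same \<open>i\<close>-closed elements.  The familiar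
  condition \<open>\<forall>x\<in>H. cyl A i x \<in> G\<close> is equivalent, but in this form the relation is visibly an
  equivalence.
\<close>

definition T :: "'i \<Rightarrow> 'a set \<Rightarrow> 'a set \<Rightarrow> bool" where
  "T i G H \<longleftrightarrow> ultra G \<and> ultra H \<and> (\<forall>x. fixed i x \<longrightarrow> (x \<in> G \<longleftrightarrow> x \<in> H))"

definition stone :: "'a \<Rightarrow> 'a set set" where "stone x = {G. ultra G \<and> x \<in> G}"

definition E :: "'i \<Rightarrow> 'i \<Rightarrow> 'a set set" where "E i j = stone (diag A i j)"

lemma T_I:
  assumes "ultra G" "ultra H" "i \<in> J" "\<And>x. fixed i x \<Longrightarrow> x \<in> G \<Longrightarrow> x \<in> H"
  shows "T i G H"
proof -
  have "x \<in> G" if x: "fixed i x" "x \<in> H" for x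
  proof (rule ccontr)
    assume "x \<notin> G"
    then have "\<sim> x \<in> G" using ultra_neg[OF assms(1)] x(1) by (simp add: fixed_def)
    then have "\<sim> x \<in> H" using assms(4) fixed_neg[OF assms(3) x(1)] by blast
    then show False using ultra_neg[OF assms(2)] x by (simp add: fixed_def)
  qed
  then show ?thesis using assms unfolding T_def by blast
qed

text \<open>
  For the existence of \<open>H\<close>, the element \<open>x\<close> and the \<open>i\<close>-closed members \<open>b\<close> of \<open>G\<close> generate a proper
  filter: \<open>x \<sqinter> b = 0\<close> would give \<open>cyl A i x \<sqinter> b = cyl A i (x \<sqinter> b) = 0\<close>.
\<close>

lemma cyl_mem:
  assumes G: "ultra G" and i: "i \<in> J" and x: "x \<in> C"
  shows "cyl A i x \<in> G \<longleftrightarrow> (\<exists>H. T i G H \<and> x \<in> H)"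
proof
  assume cx: "cyl A i x \<in> G"
  let ?M = "{y. \<exists>b\<in>G. fixed i b \<and> (y = b \<or> y = x \<sqinter> b)}"
  have M: "I' \<in> ?M" using ultra_one[OF G] fixed_one[OF i] by blast
  have sub: "?M \<subseteq> C" using ultra_C[OF G] x by auto
  have nz: "O' \<notin> ?M"
  proof
    assume "O' \<in> ?M"
    then obtain b where b: "b \<in> G" "fixed i b" "x \<sqinter> b = O'" using ultra_zero[OF G] by auto
    have "cyl A i x \<sqinter> b = cyl A i (x \<sqinter> b)"
      using cyl_laws(3)[of i x b] b(2) i x by (simp add: fixed_def)
    then have "cyl A i x \<sqinter> b = O'" using b(3) cyl_laws(1)[OF i] by simp
    then show False using ultra_mulI[OF G cx b(1)] ultra_zero[OF G] by simp
  qed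
  have mult: "y \<sqinter> z \<in> ?M" if yz: "y \<in> ?M" "z \<in> ?M" for y z
  proof -
    obtain b c where bc: "b \<in> G" "fixed i b" "y = b \<or> y = x \<sqinter> b" "c \<in> G" "fixed i c" "z = c \<or> z = x \<sqinter> c"
      using yz by blast
    have C: "b \<in> C" "c \<in> C" using bc by (auto simp: fixed_def)
    have "y \<sqinter> z = b \<sqinter> c \<or> y \<sqinter> z = x \<sqinter> (b \<sqinter> c)"
      using bc(3,6) C x bool(3)[of x b c] mul_left_commute[of b x c] bool(3)[of x b "x \<sqinter> c"] mul_left_commute[of x x "b \<sqinter> c"]
        bool(3)[of x x "b \<sqinter> c"] mul_idem[of x] by auto
    moreover have "b \<sqinter> c \<in> G" "fixed i (b \<sqinter> c)" using ultra_mulI[OF G] fixed_mul[OF i] bc by auto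
    ultimately show ?thesis by blast
  qed
  obtain H where H: "ultra H" "?M \<subseteq> H" using ex_ultra[OF sub nz M mult] by blast
  have "x = x \<sqinter> I'" using bool(8) x by simp
  then have "x \<in> ?M" using ultra_one[OF G] fixed_one[OF i] by blast
  then have "x \<in> H" using H(2) by blast
  moreover have "T i G H" by (rule T_I[OF G H(1) i]) (use H(2) in blast)
  ultimately show "\<exists>H. T i G H \<and> x \<in> H" by blast
next
  assume "\<exists>H. T i G H \<and> x \<in> H"
  then obtain H where H: "T i G H" "x \<in> H" by blast
  then have "cyl A i x \<in> H" using ultra_cyl i by (auto simp: T_def)
  then show "cyl A i x \<in> G" using H(1) fixed_cyl[OF i x] by (auto simp: T_def)
qed

text \<open>
  The \<open>w\<close>-closed members \<open>b\<close> of \<open>F\<close> and the \<open>v\<close>-closed members \<open>c\<close> of \<open>H\<close> generate a proper filter: the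
  element \<open>cyl A v b\<close> is closed for both indices, hence passes from \<open>F\<close> over \<open>G\<close> to \<open>H\<close>, and so is not
  disjoint from \<open>c\<close>.
\<close>

lemma T_commute:
  assumes v: "v \<in> J" "w \<in> J" and T: "T v F G" "T w G H"
  shows "\<exists>G'. T w F G' \<and> T v G' H"
proof -
  have u: "ultra F" "ultra G" "ultra H" using T by (auto simp: T_def)
  let ?M = "{y. \<exists>b\<in>F. \<exists>c\<in>H. fixed w b \<and> fixed v c \<and> y = b \<sqinter> c}"
  have one: "I' = I' \<sqinter> I'" using mul_idem by simp
  have M: "I' \<in> ?M" using ultra_one[OF u(1)] ultra_one[OF u(3)] fixed_one v one by blast
  have sub: "?M \<subseteq> C" using ultra_C[OF u(1)] ultra_C[OF u(3)] by auto
  have nz: "O' \<notin> ?M"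
  proof
    assume "O' \<in> ?M"
    then obtain b c where bc: "b \<in> F" "c \<in> H" "fixed w b" "fixed v c" "b \<sqinter> c = O'" by auto
    have C: "b \<in> C" "c \<in> C" "cyl A v c = c" "cyl A w b = b" using bc by (auto simp: fixed_def)
    have "cyl A v b \<in> F" using ultra_cyl[OF u(1) v(1) bc(1)] .
    then have "cyl A v b \<in> G" using T(1) fixed_cyl[OF v(1) C(1)] by (auto simp: T_def)
    moreover have "fixed w (cyl A v b)" using cyl_laws(4)[of w v b] C v by (simp add: fixed_def)
    ultimately have "cyl A v b \<in> H" using T(2) by (auto simp: T_def)
    moreover have "cyl A v b \<sqinter> c = cyl A v (b \<sqinter> c)" using cyl_laws(3)[of v b c] C v by simp
    ultimately show False
      using bc(5) cyl_laws(1)[OF v(1)] ultra_mulI[OF u(3), of "cyl A v b" c] bc(2) ultra_zero[OF u(3)] by simp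
  qed
  have mult: "y \<sqinter> z \<in> ?M" if yz: "y \<in> ?M" "z \<in> ?M" for y z
  proof -
    obtain b c b' c' where bc: "b \<in> F" "c \<in> H" "fixed w b" "fixed v c" "y = b \<sqinter> c"
      "b' \<in> F" "c' \<in> H" "fixed w b'" "fixed v c'" "z = b' \<sqinter> c'"
      using yz by blast
    have C: "b \<in> C" "c \<in> C" "b' \<in> C" "c' \<in> C" using bc by (auto simp: fixed_def)
    have "y \<sqinter> z = (b \<sqinter> b') \<sqinter> (c \<sqinter> c')"
      using C bool(3)[of b c "b' \<sqinter> c'"] bool(3)[of b b' "c \<sqinter> c'"] mul_left_commute[of c b' c'] bc(5,10) by simp
    moreover have "b \<sqinter> b' \<in> F" "c \<sqinter> c' \<in> H" "fixed w (b \<sqinter> b')" "fixed v (c \<sqinter> c')"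
      using bc ultra_mulI[OF u(1)] ultra_mulI[OF u(3)] fixed_mul v by auto
    ultimately show ?thesis by blast
  qed
  obtain G' where G': "ultra G'" "?M \<subseteq> G'" using ex_ultra[OF sub nz M mult] by blast
  have "T w F G'"
  proof (rule T_I[OF u(1) G'(1) v(2)])
    fix x assume x: "fixed w x" "x \<in> F"
    then have "x = x \<sqinter> I'" using bool(8) by (simp add: fixed_def)
    then have "x \<in> ?M" using x ultra_one[OF u(3)] fixed_one[OF v(1)] by blast
    then show "x \<in> G'" using G'(2) by blast
  qed
  moreover have "T v H G'"
  proof (rule T_I[OF u(3) G'(1) v(1)])
    fix x assume x: "fixed v x" "x \<in> H"
    then have "x = I' \<sqinter> x" using bool(8)[of x] bool(2)[of I' x] by (simp add: fixed_def)
    then have "x \<in> ?M" using x ultra_one[OF u(1)] fixed_one[OF v(2)] by blast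
    then show "x \<in> G'" using G'(2) by blast
  qed
  then have "T v G' H" by (simp add: T_def)
  ultimately show ?thesis by blast
qed

lemma T_eq_on_diag:
  assumes ij: "i \<in> J" "j \<in> J" "i \<noteq> j" and T: "T i G H" and d: "diag A i j \<in> G" "diag A i j \<in> H"
  shows "G \<subseteq> H"
proof (rule subsetI, rule ccontr)
  have u: "ultra G" "ultra H" using T by (auto simp: T_def)
  fix x assume x: "x \<in> G" "x \<notin> H"
  have xC: "x \<in> C" using ultra_C[OF u(1) x(1)] .
  have n: "\<sim> x \<in> H" using ultra_neg[OF u(2) xC] x by simp
  let ?y = "cyl A i (diag A i j \<sqinter> x)"
  have "?y \<in> G" using ultra_cyl[OF u(1) ij(1)] ultra_mulI[OF u(1) d(1) x(1)] by simp
  then have "?y \<in> H" using T fixed_cyl[of i "diag A i j \<sqinter> x"] ij xC by (auto simp: T_def)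
  moreover have "cyl A i (diag A i j \<sqinter> \<sim> x) \<in> H"
    using ultra_cyl[OF u(2) ij(1)] ultra_mulI[OF u(2) d(2) n] by simp
  ultimately show False
    using ultra_mulI[OF u(2)] ultra_zero[OF u(2)] cyl_laws(7)[of i j x] ij xC by metis
qed

sublocale cyl_frame J \<Omega> T E
proof
  show "T v a b \<Longrightarrow> a \<in> \<Omega> \<and> b \<in> \<Omega>" for v a b by (simp add: T_def \<Omega>_def)
  show "a \<in> \<Omega> \<Longrightarrow> T v a a" for v a by (simp add: T_def \<Omega>_def)
  show "T v a b \<Longrightarrow> T v b a" for v a b by (simp add: T_def)
  show "T v a b \<Longrightarrow> T v b c \<Longrightarrow> T v a c" for v a b c by (simp add: T_def)
  show "v \<in> J \<Longrightarrow> w \<in> J \<Longrightarrow> T v a b \<Longrightarrow> T w b c \<Longrightarrow> \<exists>b'. T w a b' \<and> T v b' c" for v w a b c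
    by (rule T_commute)
  show "E v w \<subseteq> \<Omega>" for v w by (auto simp: E_def stone_def \<Omega>_def)
  show "v \<in> J \<Longrightarrow> E v v = \<Omega>" for v
    using ultra_one by (auto simp: E_def stone_def \<Omega>_def cyl_laws(5))
  show "E i j = {a. \<exists>b\<in>E i k \<inter> E k j. T k a b}"
    if i: "i \<in> J" "j \<in> J" "k \<in> J" "k \<noteq> i" "k \<noteq> j" for i j k
  proof -
    let ?d = "diag A i k \<sqinter> diag A k j"
    have "G \<in> E i j \<longleftrightarrow> (\<exists>H. T k G H \<and> ?d \<in> H)" for G
    proof (cases "ultra G")
      case True
      have "G \<in> E i j \<longleftrightarrow> cyl A k ?d \<in> G"
        using True cyl_laws(6)[OF i] by (simp add: E_def stone_def)
      then show ?thesis using cyl_mem[OF True i(3), of ?d] i by simp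
    qed (simp add: E_def stone_def T_def)
    moreover have "?d \<in> H \<longleftrightarrow> diag A i k \<in> H \<and> diag A k j \<in> H" if "ultra H" for H
      using ultra_mul[OF that, of "diag A i k" "diag A k j"] i by simp
    ultimately show ?thesis unfolding E_def stone_def T_def by auto
  qed
  show "i \<in> J \<Longrightarrow> j \<in> J \<Longrightarrow> i \<noteq> j \<Longrightarrow> T i a b \<Longrightarrow> a \<in> E i j \<Longrightarrow> b \<in> E i j \<Longrightarrow> a = b" for i j a b
    using T_eq_on_diag[of i j a b] T_eq_on_diag[of i j b a] by (auto simp: E_def stone_def T_def)
qed

lemma stone_sub: "stone x \<subseteq> \<Omega>"
  by (auto simp: stone_def \<Omega>_def)

lemma stone_simps:
  "x \<in> C \<Longrightarrow> y \<in> C \<Longrightarrow> stone (x \<squnion> y) = stone x \<union> stone y"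
  "x \<in> C \<Longrightarrow> y \<in> C \<Longrightarrow> stone (x \<sqinter> y) = stone x \<inter> stone y"
  "x \<in> C \<Longrightarrow> stone (\<sim> x) = \<Omega> - stone x" "stone O' = {}" "stone I' = \<Omega>"
  "i \<in> J \<Longrightarrow> x \<in> C \<Longrightarrow> stone (cyl A i x) = cl i (stone x)"
proof -
  show "x \<in> C \<Longrightarrow> y \<in> C \<Longrightarrow> stone (x \<squnion> y) = stone x \<union> stone y"
    using ultra_add by (auto simp: stone_def)
  show "x \<in> C \<Longrightarrow> y \<in> C \<Longrightarrow> stone (x \<sqinter> y) = stone x \<inter> stone y"
    using ultra_mul by (auto simp: stone_def)
  show "x \<in> C \<Longrightarrow> stone (\<sim> x) = \<Omega> - stone x"
    using ultra_neg by (auto simp: stone_def \<Omega>_def)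
  show "stone O' = {}" using ultra_zero by (auto simp: stone_def)
  show "stone I' = \<Omega>" using ultra_one by (auto simp: stone_def \<Omega>_def)
  show "i \<in> J \<Longrightarrow> x \<in> C \<Longrightarrow> stone (cyl A i x) = cl i (stone x)"
    using cyl_mem by (auto simp: stone_def cl_def T_def)
qed

lemma stone_nonempty:
  assumes "x \<in> C" "x \<noteq> O'" shows "stone x \<noteq> {}"
proof -
  have ne: "O' \<noteq> I'" using mul_zero[OF assms(1)] bool(8)[OF assms(1)] assms(2) by auto
  have mult: "y \<sqinter> z \<in> {x, I'}" if "y \<in> {x, I'}" "z \<in> {x, I'}" for y z
    using that assms(1) bool(8)[of x] bool(2)[of I' x] mul_idem[of x] mul_idem[of I'] by auto
  have "\<exists>G. ultra G \<and> {x, I'} \<subseteq> G"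
    by (rule ex_ultra[OF _ _ _ mult]) (use assms ne in auto)
  then show ?thesis by (auto simp: stone_def)
qed

lemma stone_inj:
  assumes x: "x \<in> C" and y: "y \<in> C" and eq: "stone x = stone y" shows "x = y"
proof -
  have "stone (x \<sqinter> \<sim> y) = {}" "stone (y \<sqinter> \<sim> x) = {}"
    using x y eq stone_simps(2,3) by auto
  then have "x \<sqinter> \<sim> y = O'" "y \<sqinter> \<sim> x = O'" using stone_nonempty x y by (meson in_C)+
  then have "x = x \<sqinter> y" "y = y \<sqinter> x" using split[OF x y] split[OF y x] x y bool(7) by simp_all
  then show ?thesis using bool(2)[OF x y] by simp
qed

lemma closed_stone:
  assumes "i \<in> J" "x \<in> C" shows "closed i (stone x) \<longleftrightarrow> cyl A i x = x"
proof
  assume "closed i (stone x)"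
  then have "cl i (stone x) \<subseteq> stone x"
    using closed_iff[OF assms(1), of "stone x"] unfolding cl_def by blast
  then have "cl i (stone x) = stone x" using subset_cl[OF assms(1) stone_sub] by blast
  then show "cyl A i x = x" using stone_simps(6)[OF assms] stone_inj[of "cyl A i x" x] assms by simp
next
  assume "cyl A i x = x"
  then show "closed i (stone x)" using closed_cl_self[OF assms(1), of "stone x"] stone_simps(6)[OF assms] by simp
qed

end

theorem Dc_infinite_common_fixed:
  assumes D: "A \<in> Dc J" and J: "infinite J" and P: "finite P" "P \<subseteq> car A"
  shows "infinite {i \<in> J. \<forall>x\<in>P. cyl A i x = x}"
proof -
  interpret cyl_alg J A using D by unfold_locales (simp add: Dc_def)
  interpret F: cyl_field J \<Omega> T E "stone ` C"
  proof
    show "X \<in> stone ` C \<Longrightarrow> X \<subseteq> \<Omega>" for X using stone_sub by auto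
    show "X \<in> stone ` C \<Longrightarrow> Y \<in> stone ` C \<Longrightarrow> X \<union> Y \<in> stone ` C" for X Y
      by (auto simp: stone_simps(1)[symmetric])
    show "X \<in> stone ` C \<Longrightarrow> \<Omega> - X \<in> stone ` C" for X
      by (auto simp: stone_simps(3)[symmetric])
    show "i \<in> J \<Longrightarrow> X \<in> stone ` C \<Longrightarrow> cl i X \<in> stone ` C" for X i
      by (auto simp: stone_simps(6)[symmetric])
    show "i \<in> J \<Longrightarrow> j \<in> J \<Longrightarrow> E i j \<in> stone ` C" for i j by (simp add: E_def)
    show "infinite J" by (rule J)
    show "\<exists>i\<in>J. closed i X" if X: "X \<in> stone ` C" for X
    proof -
      obtain x where x: "x \<in> C" "X = stone x" using X by blast
      then have "dim_set J A x \<noteq> J" using D by (simp add: Dc_def)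
      then obtain i where "i \<in> J" "cyl A i x = x" by (auto simp: dim_set_def)
      then show ?thesis using closed_stone x by blast
    qed
  qed
  have "infinite {i \<in> J. \<forall>X\<in>stone ` P. closed i X}"
    using P by (intro F.infinite_common_closed) auto
  moreover have "{i \<in> J. \<forall>X\<in>stone ` P. closed i X} = {i \<in> J. \<forall>x\<in>P. cyl A i x = x}"
    using closed_stone P(2) by auto
  ultimately show ?thesis by simp
qed

section \<open>Local models from Henkin filters\<close>

text \<open>
  The image of the unit may be a part \<open>D\<close> of the frame, and indices are translated by \<open>\<iota>\<close>: one frame can
  then carry two algebras side by side and have further indices to be used as names.
\<close>

definition (in cyl_frame) represents ::
  "'i set \<Rightarrow> ('i \<Rightarrow> 'v) \<Rightarrow> ('i, 'c) cyl_algebra \<Rightarrow> 'w set \<Rightarrow> ('c \<Rightarrow> 'w set) \<Rightarrow> bool" where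
  "represents J \<iota> A D e \<longleftrightarrow> D \<subseteq> \<Omega> \<and> (\<forall>v\<in>V. closed v D) \<and> \<iota> ` J \<subseteq> V \<and>
     (\<forall>a\<in>car A. e a \<subseteq> D) \<and>
     (\<forall>a\<in>car A. \<forall>b\<in>car A. e (plus_of A a b) = e a \<union> e b \<and> e (times_of A a b) = e a \<inter> e b) \<and>
     (\<forall>a\<in>car A. e (compl_of A a) = D - e a) \<and> e (zero_of A) = {} \<and> e (one_of A) = D \<and>
     (\<forall>i\<in>J. \<forall>a\<in>car A. e (cyl A i a) = cl (\<iota> i) (e a)) \<and>
     (\<forall>i\<in>J. \<forall>j\<in>J. e (diag A i j) = D \<inter> E (\<iota> i) (\<iota> j))"

lemma (in cyl_frame) representsD:
  assumes "represents J \<iota> A D e"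
  shows "D \<subseteq> \<Omega>" "v \<in> V \<Longrightarrow> closed v D" "i \<in> J \<Longrightarrow> \<iota> i \<in> V" "a \<in> car A \<Longrightarrow> e a \<subseteq> D"
    "a \<in> car A \<Longrightarrow> b \<in> car A \<Longrightarrow> e (plus_of A a b) = e a \<union> e b"
    "a \<in> car A \<Longrightarrow> b \<in> car A \<Longrightarrow> e (times_of A a b) = e a \<inter> e b"
    "a \<in> car A \<Longrightarrow> e (compl_of A a) = D - e a" "e (zero_of A) = {}" "e (one_of A) = D"
    "i \<in> J \<Longrightarrow> a \<in> car A \<Longrightarrow> e (cyl A i a) = cl (\<iota> i) (e a)"
    "i \<in> J \<Longrightarrow> j \<in> J \<Longrightarrow> e (diag A i j) = D \<inter> E (\<iota> i) (\<iota> j)"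
  using assms unfolding represents_def by (simp_all add: image_subset_iff)

context cyl_frame_interpolants
begin

lemma sat_cong:
  assumes "henkin (tests \<X>) F" "\<And>i. i \<in> \<Gamma> \<Longrightarrow> q i = q' i"
  shows "sat F q X \<longleftrightarrow> sat F q' X"
proof -
  have "sim q \<Gamma> = sim q' \<Gamma>" by (intro ext sim_cong) (simp_all add: assms(2))
  then show ?thesis by (simp add: sat_def pre_def)
qed

text \<open>
  Every valuation satisfies the unit \<open>D\<close> of \<open>A\<close>, because \<open>D\<close> is closed for all indices and belongs to \<open>F\<close>;
  relative to \<open>D\<close>, the clauses are those for \<open>sat\<close>.
\<close>

theorem local_model_sat:
  fixes J :: "'i set"
  assumes F: "henkin (tests \<X>) F" and e: "represents J \<iota> A D e" and D: "D \<in> F"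
    and P: "P \<subseteq> car A" "e ` P \<subseteq> \<X>" and \<Gamma>': "\<Gamma>' \<subseteq> J" "\<Gamma> = \<iota> ` \<Gamma>'" and inv: "\<And>i. i \<in> J \<Longrightarrow> \<iota>' (\<iota> i) = i"
  shows "local_model \<Gamma>' P A (eqv F) (\<lambda>q a. sat F (q \<circ> \<iota>') (e a))"
proof -
  note r = representsD[OF e]
  have PX: "e a \<in> \<X>" "a \<in> car A" "e a \<subseteq> \<Omega>" if "a \<in> P" for a
    using that P r(1,4) by blast+
  have satD: "sat F q D" for q
    using sat_closed[OF F D subset_refl r(1)] r(2) \<Gamma>_simps(1) by blast
  have \<Gamma>'_inv: "\<iota>' v \<in> \<Gamma>'" "\<iota> (\<iota>' v) = v" if "v \<in> \<Gamma>" for v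
    using that \<Gamma>' inv by auto
  show ?thesis
    unfolding local_model_def
  proof (intro conjI ballI allI impI)
    fix a q q' assume a: "a \<in> P" and eq: "\<forall>i\<in>\<Gamma>'. eqv F (q i) (q' i)" and s: "sat F (q \<circ> \<iota>') (e a)"
    show "sat F (q' \<circ> \<iota>') (e a)"
      by (rule sat_eqv[OF F _ s]) (use eq \<Gamma>'_inv in simp)
  next
    fix a b q assume a: "a \<in> P" and b: "b \<in> P"
    show "sat F (q \<circ> \<iota>') (e (plus_of A a b)) = (sat F (q \<circ> \<iota>') (e a) \<or> sat F (q \<circ> \<iota>') (e b))"
      using r(5)[OF PX(2)[OF a] PX(2)[OF b]] sat_Un[OF F PX(1)[OF a]] by simp
    show "sat F (q \<circ> \<iota>') (e (times_of A a b)) = (sat F (q \<circ> \<iota>') (e a) \<and> sat F (q \<circ> \<iota>') (e b))"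
      using r(6)[OF PX(2)[OF a] PX(2)[OF b]] sat_Int[OF F] by simp
  next
    fix a q assume a: "a \<in> P"
    have "e (compl_of A a) = D \<inter> (\<Omega> - e a)" using r(7)[OF PX(2)[OF a]] r(1) by blast
    then show "sat F (q \<circ> \<iota>') (e (compl_of A a)) = (\<not> sat F (q \<circ> \<iota>') (e a))"
      using sat_Int[OF F] satD sat_compl[OF F PX(1)[OF a]] by simp
  next
    fix q
    show "\<not> sat F (q \<circ> \<iota>') (e (zero_of A))" using sat_empty[OF F] r(8) by simp
    show "sat F (q \<circ> \<iota>') (e (one_of A))" using satD r(9) by simp
  next
    fix a i q assume a: "a \<in> P" and i: "i \<in> \<Gamma>'"
    have iJ: "i \<in> J" "\<iota> i \<in> \<Gamma>" using i \<Gamma>' by auto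
    have "sat F ((q \<circ> \<iota>')(\<iota> i := n)) (e a) = sat F (q(i := n) \<circ> \<iota>') (e a)" for n
    proof (rule sat_cong[OF F])
      fix v assume v: "v \<in> \<Gamma>"
      have "v = \<iota> i \<longleftrightarrow> \<iota>' v = i" using \<Gamma>'_inv[OF v] inv[OF iJ(1)] by auto
      then show "((q \<circ> \<iota>')(\<iota> i := n)) v = (q(i := n) \<circ> \<iota>') v" by simp
    qed
    then show "sat F (q \<circ> \<iota>') (e (cyl A i a)) = (\<exists>n. sat F (q(i := n) \<circ> \<iota>') (e a))"
      using r(10)[OF iJ(1) PX(2)[OF a]] sat_cl[OF F PX(1)[OF a] PX(3)[OF a] iJ(2)] by simp
  next
    fix i j q assume ij: "i \<in> \<Gamma>'" "j \<in> \<Gamma>'"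
    have ijJ: "i \<in> J" "j \<in> J" "\<iota> i \<in> \<Gamma>" "\<iota> j \<in> \<Gamma>" using ij \<Gamma>' by auto
    show "sat F (q \<circ> \<iota>') (e (diag A i j)) = eqv F (q i) (q j)"
      using r(11)[OF ijJ(1,2)] sat_Int[OF F] satD sat_E[OF F ijJ(3,4)] inv ijJ by simp
  qed
qed

end

section \<open>Dimension complemented algebras are representable\<close>

lemma (in cyl_alg) represents_stone: "represents J id A \<Omega> stone"
  unfolding represents_def using stone_simps stone_sub closed_space
  by (auto simp: E_def stone_def \<Omega>_def)

text \<open>
  Names are indices of the algebra itself that are free for all elements involved.  Every set
  is admitted as a separator, so that no nonempty set is separated from itself, and the first of
  the two filters is the one to use.
\<close>

lemma Dc_local_model:
  assumes D: "A \<in> Dc J" and J: "infinite J" and P: "finite P" "P \<subseteq> car A" and \<Gamma>: "finite \<Gamma>" "\<Gamma> \<subseteq> J"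
    and x: "x \<in> car A" "x \<noteq> zero_of A"
  shows "\<exists>eq g q. equivp eq \<and> local_model \<Gamma> P A eq g \<and> g q x"
proof -
  interpret cyl_alg J A using D by unfold_locales (simp add: Dc_def)
  have "infinite ({i \<in> J. \<forall>a\<in>insert x P. cyl A i a = a} - \<Gamma>)"
    using Dc_infinite_common_fixed[OF D J, of "insert x P"] P \<Gamma> x by simp
  then obtain \<nu> :: "nat \<Rightarrow> 'a" where \<nu>: "inj \<nu>" "range \<nu> \<subseteq> {i \<in> J. \<forall>a\<in>insert x P. cyl A i a = a} - \<Gamma>"
    by (meson infinite_countable_subset)
  have \<nu>': "\<nu> n \<in> J" "\<nu> n \<notin> \<Gamma>" "a \<in> insert x P \<Longrightarrow> cyl A (\<nu> n) a = a" for n a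
    using \<nu>(2) by auto
  interpret N: cyl_frame_interpolants J \<Omega> T E \<Gamma> \<nu> "Pow \<Omega>"
  proof
    show "v \<in> \<Gamma> \<union> range \<nu> \<Longrightarrow> w \<in> \<Gamma> \<union> range \<nu> \<Longrightarrow> E v w \<in> Pow \<Omega>" for v w
      using E_sub[of v w] \<Gamma>(2) \<nu>'(1) by auto
    show "r \<in> Pow \<Omega> \<Longrightarrow> cl (\<nu> n) r \<in> Pow \<Omega>" for r n using cl_sub[OF \<nu>'(1)] by simp
  qed (use \<Gamma> \<nu> \<nu>' in auto)
  have free: "N.cofree (stone a)" if "a \<in> insert x P" for a
  proof (rule N.cofreeI[of _ "{}"])
    show "closed (\<nu> n) (stone a)" for n
      using closed_stone[OF \<nu>'(1)] \<nu>'(3)[OF that] that x P by auto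
  qed (use stone_sub in auto)
  have ns: "\<not> N.sep (stone x) (stone x)"
    using stone_nonempty[OF x] by (auto simp: N.sep_def)
  have 1: "countable (stone ` P)" using P(1) by (simp add: countable_finite)
  have 2: "X \<in> stone ` P \<Longrightarrow> N.cofree X" for X using free by auto
  have 3: "N.cofree (stone x)" using free by simp
  obtain F G q where F: "N.henkin (N.tests (stone ` P)) F" "N.sat F q (stone x)" "stone x \<in> F"
    using N.joint_model[OF 1 2 3 3 ns] by blast
  have "\<Omega> \<in> F" using N.F_up[OF F(1,3) stone_sub] .
  then have "local_model \<Gamma> P A (N.eqv F) (\<lambda>q a. N.sat F (q \<circ> id) (stone a))"
    using P \<Gamma> by (intro N.local_model_sat[OF F(1) represents_stone]) auto
  then show ?thesis using N.eqv_equivp[OF F(1)] F(2)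
    by (intro exI[of _ "N.eqv F"] exI[of _ "\<lambda>q a. N.sat F (q \<circ> id) (stone a)"] exI[of _ q]) simp
qed

theorem Dc_representation:
  fixes code :: "(('i + 'a) set \<Rightarrow> nat) \<Rightarrow> 'u" and A :: "('i, 'a) cyl_algebra"
  assumes D: "A \<in> Dc J" and J: "infinite J" and code: "inj code" and x: "x \<in> car A" "x \<noteq> zero_of A"
  shows "\<exists>W h. is_hom J A (full_cs J (W :: 'u set)) h \<and> h x \<noteq> {}"
proof -
  from ex_fine_ultrafilter[where 'k = "'i + 'a"] obtain U :: "('i + 'a) set filter" where
    U': "\<forall>Q. eventually Q U \<or> eventually (\<lambda>k. \<not> Q k) U" "U \<noteq> bot" "eventually finite U"
      "\<forall>e. eventually (\<lambda>k. e \<in> k) U"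
    by (elim exE conjE)
  note U = U'(1)[THEN spec] U'(2,3) U'(4)[THEN spec]
  define \<Gamma> where "\<Gamma> = (\<lambda>k :: ('i + 'a) set. {i \<in> J. Inl i \<in> k})"
  define P where "P = (\<lambda>k :: ('i + 'a) set. {a \<in> car A. Inr a \<in> k})"
  have fin: "finite (\<Gamma> k)" "finite (P k)" if "finite k" for k
  proof -
    have "finite (Inl -` k)" "finite (Inr -` k)" using that by (auto intro: finite_vimageI)
    moreover have "\<Gamma> k \<subseteq> Inl -` k" "P k \<subseteq> Inr -` k" by (auto simp: \<Gamma>_def P_def)
    ultimately show "finite (\<Gamma> k)" "finite (P k)" by (simp_all add: finite_subset)
  qed
  have "\<forall>k. \<exists>m. finite k \<longrightarrow> equivp (fst m) \<and> local_model (\<Gamma> k) (P k) A (fst m) (fst (snd m)) \<and>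
      fst (snd m) (snd (snd m)) x"
  proof
    fix k
    have "P k \<subseteq> car A" "\<Gamma> k \<subseteq> J" by (auto simp: P_def \<Gamma>_def)
    then have "\<exists>eq g q. equivp eq \<and> local_model (\<Gamma> k) (P k) A eq g \<and> g q x" if "finite k"
      using Dc_local_model[OF D J fin(2)[OF that] _ fin(1)[OF that] _ x] by simp
    then show "\<exists>m. finite k \<longrightarrow> equivp (fst m) \<and> local_model (\<Gamma> k) (P k) A (fst m) (fst (snd m)) \<and>
      fst (snd m) (snd (snd m)) x"
      by (cases "finite k") (simp_all add: split_paired_Ex)
  qed
  then obtain m where M: "\<forall>k. finite k \<longrightarrow> equivp (fst (m k)) \<and>
      local_model (\<Gamma> k) (P k) A (fst (m k)) (fst (snd (m k))) \<and>
      fst (snd (m k)) (snd (snd (m k))) x"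
    by (rule exE[OF choice])
  have m: "\<And>k. finite k \<Longrightarrow> equivp (fst (m k))"
    "\<And>k. finite k \<Longrightarrow> local_model (\<Gamma> k) (P k) A (fst (m k)) (fst (snd (m k)))"
    "\<And>k. finite k \<Longrightarrow> fst (snd (m k)) (snd (snd (m k))) x"
    by (simp_all add: M)
  interpret ultraproduct U J \<Gamma> "\<lambda>k. fst (m k)" "\<lambda>k. snd (snd (m k))" code
  proof
    show "eventually (\<lambda>k. equivp (fst (m k))) U" using U(3) m(1) by (rule eventually_mono)
    show "i \<in> J \<Longrightarrow> eventually (\<lambda>k. i \<in> \<Gamma> k) U" for i using U(4)[of "Inl i"] by (simp add: \<Gamma>_def)
  qed (use U code in \<open>auto simp: \<Gamma>_def\<close>)
  have lm: "eventually (\<lambda>k. local_model (\<Gamma> k) (P k) A (fst (m k)) (fst (snd (m k)))) U"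
    using U(3) m(2) by (rule eventually_mono)
  have P: "eventually (\<lambda>k. a \<in> P k) U" if "a \<in> car A" for a using U(4)[of "Inr a"] that by (simp add: P_def)
  have alg: "is_algebra J A" using D by (simp add: Dc_def CA_def)
  have "eventually (\<lambda>k. fst (snd (m k)) (snd (snd (m k))) x) U"
    using U(3) m(3) by (rule eventually_mono)
  then have "base_point \<in> interp (\<lambda>k. fst (snd (m k))) x"
    using base_point_interp[OF lm P[OF x(1)]] by simp
  moreover have "is_hom J A (full_cs J W) (interp (\<lambda>k. fst (snd (m k))))"
    using interp_hom[OF alg lm P] .
  ultimately show ?thesis by blast
qed

theorem Dc_RCA:
  fixes code :: "(('i + 'a) set \<Rightarrow> nat) \<Rightarrow> 'u" and A :: "('i, 'a) cyl_algebra" and name :: "'a \<Rightarrow> 'u"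
  assumes D: "A \<in> Dc J" and J: "infinite J" and code: "inj code" and name: "inj name"
  shows "A \<in> RCA TYPE('u) J"
proof -
  interpret cyl_alg J A using D by unfold_locales (simp add: Dc_def)
  have "\<forall>x. \<exists>m. x \<in> car A \<longrightarrow> x \<noteq> zero_of A \<longrightarrow>
      is_hom J A (full_cs J (fst m :: 'u set)) (snd m) \<and> snd m x \<noteq> {}"
    using Dc_representation[OF D J code] by (simp add: split_paired_Ex) 
  then obtain m where M: "\<forall>x. x \<in> car A \<longrightarrow> x \<noteq> zero_of A \<longrightarrow>
      is_hom J A (full_cs J (fst (m x) :: 'u set)) (snd (m x)) \<and> snd (m x) x \<noteq> {}"
    by (rule exE[OF choice])
  have m: "\<And>x. x \<in> car A \<Longrightarrow> x \<noteq> zero_of A \<Longrightarrow> is_hom J A (full_cs J (fst (m x) :: 'u set)) (snd (m x))"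
    "\<And>x. x \<in> car A \<Longrightarrow> x \<noteq> zero_of A \<Longrightarrow> snd (m x) x \<noteq> {}"
    by (simp_all add: M)
  let ?I = "name ` {x \<in> car A. x \<noteq> zero_of A}"
  have inv: "inv name (name x) = x" for x using name by simp
  show ?thesis
  proof (rule RCA_I[where I = ?I and U = "\<lambda>k. fst (m (inv name k))" and h = "\<lambda>k. snd (m (inv name k))"])
    show "is_algebra J A" by (rule algebra)
    show "is_hom J A (full_cs J (fst (m (inv name k)))) (snd (m (inv name k)))" if "k \<in> ?I" for k
      using that m(1) inv by auto
    note hom = this
    show "a = b" if "a \<in> car A" "b \<in> car A"
      "\<And>k. k \<in> ?I \<Longrightarrow> snd (m (inv name k)) a = snd (m (inv name k)) b" for a b
    proof (rule separating_homs[OF hom _ that])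
      show "\<exists>k\<in>?I. snd (m (inv name k)) x \<noteq> {}" if "x \<in> C" "x \<noteq> O'" for x
        using m(2)[OF that] that inv by (intro bexI[of _ "name x"]) auto
    qed
  qed
qed

section \<open>Frames of sequences\<close>

text \<open>
  Sequences over the base \<open>B k\<close>, tagged with \<open>k\<close>: the atom structure of a product of full set
  algebras.  The coordinates \<open>K\<close> carry the algebras, those in \<open>N\<close> are the names.  Values outside
  \<open>K \<union> N\<close> are arbitrary, and no step changes them.
\<close>

locale seq_frame =
  fixes K N :: "'v set" and I :: "'k set" and B :: "'k \<Rightarrow> 'u set"
  assumes KN: "K \<inter> N = {}"
begin

abbreviation "V \<equiv> K \<union> N"

definition \<Omega> :: "('k \<times> ('v \<Rightarrow> 'u)) set" where
  "\<Omega> = {(k, t). k \<in> I \<and> (\<forall>v\<in>V. t v \<in> B k)}"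

definition T :: "'v \<Rightarrow> 'k \<times> ('v \<Rightarrow> 'u) \<Rightarrow> 'k \<times> ('v \<Rightarrow> 'u) \<Rightarrow> bool" where
  "T v p p' \<longleftrightarrow> p \<in> \<Omega> \<and> p' \<in> \<Omega> \<and> fst p = fst p' \<and> (\<forall>w. w \<noteq> v \<longrightarrow> snd p w = snd p' w)"

definition E :: "'v \<Rightarrow> 'v \<Rightarrow> ('k \<times> ('v \<Rightarrow> 'u)) set" where
  "E v w = {p \<in> \<Omega>. snd p v = snd p w}"

lemma \<Omega>_iff: "(k, t) \<in> \<Omega> \<longleftrightarrow> k \<in> I \<and> (\<forall>v\<in>V. t v \<in> B k)"
  by (simp add: \<Omega>_def)

lemma \<Omega>_upd: "(k, t) \<in> \<Omega> \<Longrightarrow> u \<in> B k \<Longrightarrow> (k, t(v := u)) \<in> \<Omega>"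
  by (simp add: \<Omega>_iff)

lemma T_iff: "T v (k, t) (k', t') \<longleftrightarrow> (k, t) \<in> \<Omega> \<and> (k', t') \<in> \<Omega> \<and> k = k' \<and> (\<forall>w. w \<noteq> v \<longrightarrow> t w = t' w)"
  by (simp add: T_def)

sublocale cyl_frame V \<Omega> T E
proof
  show "T v a b \<Longrightarrow> a \<in> \<Omega> \<and> b \<in> \<Omega>" for v a b by (simp add: T_def)
  show "a \<in> \<Omega> \<Longrightarrow> T v a a" for v a by (simp add: T_def)
  show "T v a b \<Longrightarrow> T v b a" for v a b by (simp add: T_def)
  show "T v a b \<Longrightarrow> T v b c \<Longrightarrow> T v a c" for v a b c by (simp add: T_def)
  show "\<exists>b'. T w a b' \<and> T v b' c" if v: "v \<in> V" "w \<in> V" and T: "T v a b" "T w b c" for v w a b c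
  proof (cases "v = w")
    case True
    show ?thesis by (rule exI[of _ b]) (use T True in simp)
  next
    case False
    obtain k t where a: "a = (k, t)" by (cases a)
    obtain t' where b: "b = (k, t')" using T(1) a by (cases b) (simp add: T_def)
    obtain t'' where c: "c = (k, t'')" using T(2) b by (cases c) (simp add: T_def)
    note abc = a b c
    have o: "(k, t) \<in> \<Omega>" "(k, t'') \<in> \<Omega>" using T abc by (auto simp: T_iff)
    let ?b = "(k, t(w := t'' w))"
    have "?b \<in> \<Omega>" using o v by (intro \<Omega>_upd) (auto simp: \<Omega>_iff)
    moreover have "t x = t' x" if "x \<noteq> v" for x using T(1) that by (simp add: abc T_iff)
    moreover have "t' x = t'' x" if "x \<noteq> w" for x using T(2) that by (simp add: abc T_iff)
    ultimately have "T w a ?b" "T v ?b c" using o False by (simp_all add: abc T_iff)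
    then show ?thesis by (intro exI[of _ ?b] conjI)
  qed
  show "E v w \<subseteq> \<Omega>" for v w by (auto simp: E_def)
  show "E v v = \<Omega>" for v by (auto simp: E_def)
  show "E i j = {a. \<exists>b\<in>E i m \<inter> E m j. T m a b}"
    if i: "i \<in> V" "j \<in> V" "m \<in> V" "m \<noteq> i" "m \<noteq> j" for i j m
  proof (intro equalityI subsetI)
    fix a assume "a \<in> E i j"
    then obtain k t where a: "a = (k, t)" "(k, t) \<in> \<Omega>" "t i = t j" by (cases a) (auto simp: E_def)
    let ?b = "(k, t(m := t i))"
    have "?b \<in> \<Omega>" using a i by (intro \<Omega>_upd) (auto simp: \<Omega>_iff)
    then have "?b \<in> E i m \<inter> E m j" "T m a ?b" using a i by (auto simp: E_def T_iff)
    then show "a \<in> {a. \<exists>b\<in>E i m \<inter> E m j. T m a b}" by blast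
  qed (use i in \<open>auto simp: E_def T_def\<close>)
  show "T i a b \<Longrightarrow> a \<in> E i j \<Longrightarrow> b \<in> E i j \<Longrightarrow> i \<noteq> j \<Longrightarrow> a = b" for i j a b
    by (cases a, cases b) (auto simp: T_def E_def fun_eq_iff, metis)
qed

lemma repl_seq:
  assumes "i \<in> V" "n \<in> V" "i \<noteq> n" "(k, t) \<in> \<Omega>"
  shows "repl i n (k, t) = (k, t(i := t n))"
proof (rule repl_eq[OF assms(1-3)])
  have "(k, t(i := t n)) \<in> \<Omega>" using assms by (intro \<Omega>_upd) (auto simp: \<Omega>_iff)
  then show "T i (k, t) (k, t(i := t n))" "(k, t(i := t n)) \<in> E i n"
    using assms by (auto simp: T_iff E_def)
qed

definition admissible :: "('v \<Rightarrow> 'v) \<Rightarrow> bool" where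
  "admissible f \<longleftrightarrow> f ` V \<subseteq> V \<and> finite {v. f v \<noteq> v}"

text \<open>The substitution instance of \<open>X\<close> in which each variable \<open>v\<close> is replaced by \<open>f v\<close>.\<close>

definition pull :: "('v \<Rightarrow> 'v) \<Rightarrow> ('k \<times> ('v \<Rightarrow> 'u)) set \<Rightarrow> ('k \<times> ('v \<Rightarrow> 'u)) set" where
  "pull f X = {p \<in> \<Omega>. (fst p, snd p \<circ> f) \<in> X}"

lemma pull_iff: "(k, t) \<in> pull f X \<longleftrightarrow> (k, t) \<in> \<Omega> \<and> (k, t \<circ> f) \<in> X"
  by (simp add: pull_def)

lemma \<Omega>_comp: "f ` V \<subseteq> V \<Longrightarrow> (k, t) \<in> \<Omega> \<Longrightarrow> (k, t \<circ> f) \<in> \<Omega>"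
  unfolding \<Omega>_iff by (metis comp_apply image_subset_iff)

lemma pull_sub: "pull f X \<subseteq> \<Omega>"
  by (auto simp: pull_def)

lemma pull_comp: "f ` V \<subseteq> V \<Longrightarrow> pull f (pull g X) = pull (f \<circ> g) X"
  using \<Omega>_comp by (auto simp: pull_iff comp_assoc)

lemma pull_id: "X \<subseteq> \<Omega> \<Longrightarrow> pull id X = X"
  by (auto simp: pull_iff)

lemma pull_Un: "pull f (X \<union> Y) = pull f X \<union> pull f Y"
  by (auto simp: pull_iff)

lemma pull_Compl: "f ` V \<subseteq> V \<Longrightarrow> pull f (\<Omega> - X) = \<Omega> - pull f X"
  using \<Omega>_comp by (auto simp: pull_iff)

lemma pull_repl:
  assumes "i \<in> V" "n \<in> V" "i \<noteq> n"
  shows "pull (id(i := n)) X = {a \<in> \<Omega>. repl i n a \<in> X}"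
proof -
  have "t \<circ> id(i := n) = t(i := t n)" for t :: "'v \<Rightarrow> 'u" by (auto simp: fun_eq_iff)
  then show ?thesis using repl_seq[OF assms] by (auto simp: pull_def)
qed

lemma admissible_comp: "admissible f \<Longrightarrow> admissible g \<Longrightarrow> admissible (f \<circ> g)"
proof -
  assume a: "admissible f" "admissible g"
  have "{v. (f \<circ> g) v \<noteq> v} \<subseteq> {v. f v \<noteq> v} \<union> {v. g v \<noteq> v}" by auto
  moreover have "finite ({v. f v \<noteq> v} \<union> {v. g v \<noteq> v})" using a by (simp add: admissible_def)
  ultimately have "finite {v. (f \<circ> g) v \<noteq> v}" by (rule finite_subset)
  moreover have "(f \<circ> g) ` V \<subseteq> V" using a unfolding admissible_def image_comp[symmetric] by blast
  ultimately show ?thesis by (simp add: admissible_def)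
qed

lemma admissible_upd: "i \<in> V \<Longrightarrow> n \<in> V \<Longrightarrow> admissible (id(i := n))"
  unfolding admissible_def by (auto intro: finite_subset[of _ "{i}"])

lemma cl_pull:
  assumes h: "\<And>v. h (h v) = v" "h ` V \<subseteq> V" and X: "X \<subseteq> \<Omega>"
  shows "cl v (pull h X) = pull h (cl (h v) X)"
proof (intro equalityI subsetI)
  fix p assume "p \<in> cl v (pull h X)"
  then obtain q where q: "T v p q" "q \<in> pull h X" by (auto simp: cl_def)
  obtain k t t' where p: "p = (k, t)" "q = (k, t')" using q(1) by (cases p, cases q) (auto simp: T_def)
  have "T (h v) (k, t \<circ> h) (k, t' \<circ> h)"
    using q(1) h(1) \<Omega>_comp[OF h(2)] unfolding p T_iff by (metis comp_apply)
  then have "(k, t \<circ> h) \<in> cl (h v) X" using q(2) unfolding cl_def p pull_iff by blast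
  then show "p \<in> pull h (cl (h v) X)" using q(1) unfolding p pull_iff T_iff by blast
next
  fix p assume p: "p \<in> pull h (cl (h v) X)"
  obtain k t where kt: "p = (k, t)" by (cases p)
  then obtain q where q: "T (h v) (k, t \<circ> h) q" "q \<in> X" using p by (auto simp: pull_iff cl_def)
  obtain t' where t': "q = (k, t')" using q(1) by (cases q) (auto simp: T_def)
  have hh: "t' \<circ> h \<circ> h = t'" using h(1) by (auto simp: fun_eq_iff)
  have "t w = (t' \<circ> h) w" if "w \<noteq> v" for w
  proof -
    have "h w \<noteq> h v" using h(1) that by metis
    then have "(t \<circ> h) (h w) = t' (h w)" using q(1) unfolding t' T_iff by blast
    then show ?thesis using h(1) by simp
  qed
  moreover have "(k, t' \<circ> h) \<in> \<Omega>" using \<Omega>_comp[OF h(2)] q(2) X t' by blast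
  moreover have "(k, t) \<in> \<Omega>" using p kt by (simp add: pull_iff)
  ultimately have "T v p (k, t' \<circ> h)" unfolding kt T_iff by blast
  moreover have "(k, t' \<circ> h) \<in> pull h X" using \<open>(k, t' \<circ> h) \<in> \<Omega>\<close> q(2) hh t' by (simp add: pull_iff)
  ultimately show "p \<in> cl v (pull h X)" by (auto simp: cl_def)
qed

text \<open>
  Independence from all names simultaneously.  As \<open>N\<close> is infinite, this is stronger than independence
  from each single name.
\<close>

definition N_free :: "('k \<times> ('v \<Rightarrow> 'u)) set \<Rightarrow> bool" where
  "N_free X \<longleftrightarrow> X \<subseteq> \<Omega> \<and> (\<forall>k t t'. (k, t) \<in> X \<longrightarrow> (k, t') \<in> \<Omega> \<longrightarrow> (\<forall>v\<in>K. t v = t' v) \<longrightarrow> (k, t') \<in> X)"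

lemma N_freeD: "N_free X \<Longrightarrow> (k, t) \<in> X \<Longrightarrow> (k, t') \<in> \<Omega> \<Longrightarrow> (\<And>v. v \<in> K \<Longrightarrow> t v = t' v) \<Longrightarrow> (k, t') \<in> X"
  unfolding N_free_def by blast

lemma closed_N_free:
  assumes "N_free X" "n \<in> N" shows "closed n X"
  unfolding closed_def
proof (intro ballI allI impI)
  fix p q assume pq: "p \<in> X" "T n p q"
  obtain k t t' where p: "p = (k, t)" "q = (k, t')" using pq(2) by (cases p, cases q) (auto simp: T_def)
  have "v \<noteq> n" if "v \<in> K" for v using that assms(2) KN by blast
  then show "q \<in> X" using N_freeD[OF assms(1), of k t t'] pq unfolding p T_iff by blast
qed

lemma closed_finite:
  assumes "finite S" "\<And>v. v \<in> S \<Longrightarrow> closed v X" "(k, t) \<in> X" "(k, t) \<in> \<Omega>" "(k, t') \<in> \<Omega>"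
    "\<And>v. v \<notin> S \<Longrightarrow> t v = t' v"
  shows "(k, t') \<in> X"
  using assms
proof (induction S arbitrary: t' rule: finite_induct)
  case empty
  then have "t = t'" by auto
  then show ?case using empty by simp
next
  case (insert s S)
  let ?t = "t'(s := t s)"
  have o: "(k, ?t) \<in> \<Omega>" using insert.prems(3,4) by (auto simp: \<Omega>_iff)
  have "(k, ?t) \<in> X"
  proof (rule insert.IH)
    show "t v = ?t v" if "v \<notin> S" for v using insert.prems(5)[of v] that by simp
    show "(k, ?t) \<in> \<Omega>" by (rule o)
  qed (use insert.prems(1-3) in simp_all)
  moreover have "T s (k, ?t) (k, t')" using o insert.prems(4) by (auto simp: T_iff)
  ultimately show ?case using insert.prems(1)[of s] unfolding closed_def by blast
qed

text \<open>
  Independence from each index of a set gives joint independence only if the set is finite; this is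
  why substitutions are restricted to finitely many coordinates.
\<close>

lemma N_free_agree:
  assumes Z: "N_free Z" and S: "finite S" "\<And>v. v \<in> S \<Longrightarrow> closed v Z"
    and t: "(k, t) \<in> Z" "(k, t') \<in> \<Omega>" "\<And>v. v \<in> K - S \<Longrightarrow> t v = t' v"
  shows "(k, t') \<in> Z"
proof -
  let ?t = "\<lambda>v. if v \<in> S then t v else t' v"
  have kt: "(k, t) \<in> \<Omega>" using Z t(1) by (auto simp: N_free_def)
  then have o: "(k, ?t) \<in> \<Omega>" using t(2) by (auto simp: \<Omega>_iff)
  have "(k, ?t) \<in> Z" by (rule N_freeD[OF Z t(1) o]) (use t(3) in auto)
  show ?thesis
    by (rule closed_finite[of S Z k ?t t']) (use S o t(2) \<open>(k, ?t) \<in> Z\<close> in auto)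
qed

lemma pull_agree:
  assumes "N_free Z" "finite S" "\<And>v. v \<in> S \<Longrightarrow> closed v Z" "f ` V \<subseteq> V" "g ` V \<subseteq> V"
    "\<And>v. v \<in> K - S \<Longrightarrow> f v = g v"
  shows "pull f Z = pull g Z"
proof -
  have *: "pull f Z \<subseteq> pull g Z"
    if "f ` V \<subseteq> V" "g ` V \<subseteq> V" "\<And>v. v \<in> K - S \<Longrightarrow> f v = g v" for f g
  proof
    fix p assume p: "p \<in> pull f Z"
    obtain k t where kt: "p = (k, t)" by (cases p)
    have kt': "(k, t) \<in> \<Omega>" "(k, t \<circ> f) \<in> Z" using p kt by (auto simp: pull_iff)
    have "(k, t \<circ> g) \<in> Z"
      by (rule N_free_agree[OF assms(1,2,3) kt'(2) \<Omega>_comp[OF that(2) kt'(1)]]) (simp_all add: that(3))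
    then show "p \<in> pull g Z" using kt kt' by (simp add: pull_iff)
  qed
  show ?thesis using *[of f g] *[of g f] assms(4-6) by auto
qed

definition swap :: "('v \<Rightarrow> 'v) \<Rightarrow> 'v set \<Rightarrow> 'v set \<Rightarrow> bool" where
  "swap h L M \<longleftrightarrow> finite L \<and> finite M \<and> L \<subseteq> K \<and> M \<subseteq> N \<and> (\<forall>v. h (h v) = v) \<and>
     (\<forall>v. v \<notin> L \<union> M \<longrightarrow> h v = v) \<and> h ` L \<subseteq> M \<and> h ` M \<subseteq> L"

lemma swapD:
  assumes "swap h L M"
  shows "finite L" "finite M" "L \<subseteq> K" "M \<subseteq> N" "h (h v) = v" "v \<notin> L \<Longrightarrow> v \<notin> M \<Longrightarrow> h v = v"
    "v \<in> L \<Longrightarrow> h v \<in> M" "v \<in> M \<Longrightarrow> h v \<in> L"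
  using assms unfolding swap_def by blast+

lemma swap_admissible:
  assumes "swap h L M" shows "admissible h"
proof -
  have "{v. h v \<noteq> v} \<subseteq> L \<union> M" using swapD(6)[OF assms] by blast
  moreover have "finite (L \<union> M)" using swapD(1,2)[OF assms] by simp
  ultimately have "finite {v. h v \<noteq> v}" by (rule finite_subset)
  moreover have "h v \<in> V" if "v \<in> V" for v
  proof (cases "v \<in> L \<or> v \<in> M")
    case True
    then show ?thesis using swapD(3,4,7,8)[OF assms] by blast
  next
    case False
    then show ?thesis using swapD(6)[OF assms] that by simp
  qed
  ultimately show ?thesis by (auto simp: admissible_def)
qed

lemma ex_swap:
  assumes M: "finite M" "M \<subseteq> N" and Q: "infinite Q" "Q \<subseteq> K"
  shows "\<exists>h L. L \<subseteq> Q \<and> swap h L M"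
proof -
  obtain L where L: "finite L" "card L = card M" "L \<subseteq> Q"
    using infinite_arbitrarily_large[OF Q(1)] by blast
  obtain b where b: "bij_betw b L M" using finite_same_card_bij[OF L(1) M(1) L(2)] by blast
  let ?c = "inv_into L b"
  have d: "L \<inter> M = {}" using L Q M KN by blast
  have bc: "v \<in> L \<Longrightarrow> b v \<in> M" "v \<in> L \<Longrightarrow> ?c (b v) = v" "v \<in> M \<Longrightarrow> ?c v \<in> L" "v \<in> M \<Longrightarrow> b (?c v) = v" for v
    using b bij_betw_inv_into_left[OF b] bij_betw_inv_into_right[OF b] bij_betw_inv_into[OF b]
    by (auto simp: bij_betw_def)
  define h where "h = (\<lambda>v. if v \<in> L then b v else if v \<in> M then ?c v else v)"
  have h: "v \<in> L \<Longrightarrow> h v = b v" "v \<in> M \<Longrightarrow> h v = ?c v" "v \<notin> L \<Longrightarrow> v \<notin> M \<Longrightarrow> h v = v" for v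
    using d by (auto simp: h_def)
  have "h (h v) = v" for v
  proof -
    consider "v \<in> L" | "v \<in> M" | "v \<notin> L" "v \<notin> M" by blast
    then show ?thesis
    proof cases
      case 1
      then show ?thesis using h(1)[OF 1] h(2)[OF bc(1)[OF 1]] bc(2)[OF 1] by simp
    next
      case 2
      then show ?thesis using h(2)[OF 2] h(1)[OF bc(3)[OF 2]] bc(4)[OF 2] by simp
    next
      case 3
      then show ?thesis using h(3)[OF 3] by simp
    qed
  qed
  then have "swap h L M" unfolding swap_def
    using L(1) M L(3) Q(2) h bc by (auto simp: image_subset_iff)
  then show ?thesis using L(3) by blast
qed

end

section \<open>Separators and interpolants\<close>

locale seq_frame_family = seq_frame +
  fixes \<Z> :: "('b \<times> ('a \<Rightarrow> 'c)) set set"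
  assumes Z_free: "Z \<in> \<Z> \<Longrightarrow> N_free Z"
    and Z_Un: "Z \<in> \<Z> \<Longrightarrow> Z' \<in> \<Z> \<Longrightarrow> Z \<union> Z' \<in> \<Z>"
    and Z_Compl: "Z \<in> \<Z> \<Longrightarrow> \<Omega> - Z \<in> \<Z>"
    and Z_cl: "i \<in> K \<Longrightarrow> Z \<in> \<Z> \<Longrightarrow> cl i Z \<in> \<Z>"
    and Z_E: "i \<in> K \<Longrightarrow> j \<in> K \<Longrightarrow> E i j \<in> \<Z>"
    and Z_infinite: "Z \<in> \<Z> \<Longrightarrow> Z' \<in> \<Z> \<Longrightarrow> infinite {i \<in> K. closed i Z \<and> closed i Z'}"
begin

lemma Z_sub: "Z \<in> \<Z> \<Longrightarrow> Z \<subseteq> \<Omega>"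
  using Z_free by (simp add: N_free_def)

lemma Z_Int: "Z \<in> \<Z> \<Longrightarrow> Z' \<in> \<Z> \<Longrightarrow> Z \<inter> Z' \<in> \<Z>"
proof -
  assume ZZ: "Z \<in> \<Z>" "Z' \<in> \<Z>"
  then have "Z \<inter> Z' = \<Omega> - ((\<Omega> - Z) \<union> (\<Omega> - Z'))" using Z_sub[of Z] by blast
  then show ?thesis using ZZ Z_Un Z_Compl by simp
qed

lemma pull_upd_Z:
  assumes "i \<in> K" "n \<in> K" "i \<noteq> n" "Z \<in> \<Z>" shows "pull (id(i := n)) Z \<in> \<Z>"
proof -
  have "pull (id(i := n)) Z = cl i (E i n \<inter> Z)"
  proof (intro equalityI subsetI)
    fix a assume "a \<in> pull (id(i := n)) Z"
    then have a: "a \<in> \<Omega>" "repl i n a \<in> Z" using pull_repl[of i n Z] assms by auto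
    then show "a \<in> cl i (E i n \<inter> Z)" using repl[of i n a] assms by (auto simp: cl_def)
  next
    fix a assume "a \<in> cl i (E i n \<inter> Z)"
    then obtain b where b: "b \<in> E i n" "b \<in> Z" "T i a b" by (auto simp: cl_def)
    then have "repl i n a = b" using repl_eq[of i n a b] assms by auto
    then show "a \<in> pull (id(i := n)) Z"
      using pull_repl[of i n Z] b T_dom[of i a b] assms by auto
  qed
  then show ?thesis using Z_cl Z_Int Z_E assms by simp
qed

text \<open>
  Composition of single replacements.  Since a permutation is not such a composition by itself, an
  index \<open>m\<close> is first parked at a free index \<open>k\<close>, and is sent to its target after the others have moved.
\<close>

lemma pull_finite_Z:
  assumes "finite M" "M \<subseteq> K" "\<tau> ` K \<subseteq> K" "\<And>v. v \<notin> M \<Longrightarrow> \<tau> v = v" "Z \<in> \<Z>"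
  shows "pull \<tau> Z \<in> \<Z>"
  using assms
proof (induction M arbitrary: \<tau> Z rule: finite_induct)
  case empty
  then have \<tau>: "\<tau> = id" by (auto simp: fun_eq_iff)
  have "Z \<in> \<Z>" by (rule empty)
  then show ?case unfolding \<tau> pull_id[OF Z_sub[OF \<open>Z \<in> \<Z>\<close>]] .
next
  case (insert m M)
  have "finite (insert m M \<union> \<tau> ` insert m M)" using insert.hyps by simp
  then obtain k where k: "k \<in> K" "closed k Z" "k \<notin> insert m M \<union> \<tau> ` insert m M"
    using infinite_avoids[OF Z_infinite[OF insert.prems(4,4)]] by blast
  have mK: "m \<in> K" "k \<noteq> m" "\<tau> m \<in> K" "k \<noteq> \<tau> m" using insert.prems(1,2) k by auto
  define \<tau>' where "\<tau>' = \<tau>(m := m)"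
  have \<tau>V: "\<tau> v \<in> V" if v: "v \<in> V" for v
  proof (cases "v \<in> K")
    case True
    then show ?thesis using insert.prems(2) by blast
  next
    case False
    then have "v \<notin> insert m M" using insert.prems(1) by blast
    then show ?thesis using insert.prems(3)[of v] v by simp
  qed
  then have \<tau>': "\<tau>' v \<in> V" if "v \<in> V" for v using that mK(1) by (simp add: \<tau>'_def)
  have "pull \<tau>' (pull (id(m := k)) Z) \<in> \<Z>"
  proof (rule insert.IH)
    show "\<tau>' ` K \<subseteq> K" using insert.prems(2) mK(1) by (auto simp: \<tau>'_def)
    show "\<tau>' v = v" if "v \<notin> M" for v using insert.prems(3)[of v] that by (auto simp: \<tau>'_def)
    show "pull (id(m := k)) Z \<in> \<Z>" using pull_upd_Z mK k insert.prems(4) by auto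
  qed (use insert.prems(1) in simp)
  then have "pull (id(k := \<tau> m)) (pull \<tau>' (pull (id(m := k)) Z)) \<in> \<Z>"
    using pull_upd_Z mK k(1) by blast
  moreover have "pull (id(k := \<tau> m)) (pull \<tau>' (pull (id(m := k)) Z)) =
      pull (id(k := \<tau> m) \<circ> (\<tau>' \<circ> id(m := k))) Z"
  proof -
    have "(id(k := \<tau> m)) ` V \<subseteq> V" using mK by auto
    moreover have "\<tau>' ` V \<subseteq> V" using \<tau>' by (auto simp only: image_subset_iff)
    ultimately show ?thesis by (simp only: pull_comp)
  qed
  moreover have "pull (id(k := \<tau> m) \<circ> (\<tau>' \<circ> id(m := k))) Z = pull \<tau> Z"
  proof (rule pull_agree[OF Z_free[OF insert.prems(4)], of "{k}"])
    show "(id(k := \<tau> m) \<circ> (\<tau>' \<circ> id(m := k))) v = \<tau> v" if v: "v \<in> K - {k}" for v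
    proof (cases "v = m")
      case True
      have "\<tau>' k = k" using insert.prems(3)[of k] k(3) by (simp add: \<tau>'_def)
      then show ?thesis using True by simp
    next
      case False
      have "\<tau> v \<noteq> k"
      proof (cases "v \<in> M")
        case True
        then show ?thesis using k(3) by auto
      next
        case out: False
        then show ?thesis using insert.prems(3)[of v] v False by simp
      qed
      then show ?thesis using False by (simp add: \<tau>'_def)
    qed
    show "(id(k := \<tau> m) \<circ> (\<tau>' \<circ> id(m := k))) ` V \<subseteq> V"
    proof (intro image_subsetI)
      fix v assume v: "v \<in> V"
      have "(id(m := k)) v \<in> V" using v k(1) by simp
      from \<tau>'[OF this] show "(id(k := \<tau> m) \<circ> (\<tau>' \<circ> id(m := k))) v \<in> V" using mK by auto
    qed
    show "\<tau> ` V \<subseteq> V" using \<tau>V by (intro image_subsetI)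
  qed (use k in auto)
  ultimately show ?case by simp
qed

text \<open>
  The involution \<open>h\<close> exchanges the names occurring in the instance \<open>pull g Z\<close> with free indices from \<open>L\<close>.
  Then \<open>h \<circ> g\<close> agrees, on the indices on which \<open>Z\<close> depends, with a substitution inside \<open>K\<close>.
\<close>

lemma pull_swap_Z:
  assumes sw: "swap h L M" and g: "admissible g" and Z: "Z \<in> \<Z>"
    and S: "finite S" "\<And>v. v \<notin> S \<Longrightarrow> g v = v" "L \<inter> (S \<union> g ` S) = {}" "N \<inter> g ` S \<subseteq> M"
    and L: "\<And>v. v \<in> L \<Longrightarrow> closed v Z"
  shows "pull h (pull g Z) \<in> \<Z>" "pull g Z = pull h (pull h (pull g Z))"
proof -
  note h = swapD[OF sw]
  have hV: "h ` V \<subseteq> V" and gV: "g ` V \<subseteq> V" using swap_admissible[OF sw] g by (auto simp: admissible_def)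
  have "h \<circ> h = id" using h(5) by auto
  then show "pull g Z = pull h (pull h (pull g Z))" using pull_comp[OF hV, of h "pull g Z"] pull_id[OF pull_sub, of g Z] by simp
  define \<tau> where "\<tau> = (\<lambda>v. if v \<in> K - L then h (g v) else v)"
  have \<tau>K: "\<tau> v \<in> K" "v \<notin> S \<Longrightarrow> \<tau> v = v" if v: "v \<in> K" for v
  proof -
    have "\<tau> v \<in> K \<and> (v \<notin> S \<longrightarrow> \<tau> v = v)"
    proof (cases "v \<in> L")
      case True
      then show ?thesis using v by (simp add: \<tau>_def)
    next
      case vL: False
      then have \<tau>v: "\<tau> v = h (g v)" using v by (simp add: \<tau>_def)
      show ?thesis
      proof (cases "v \<in> S")
        case False
        have "v \<notin> M" using v h(4) KN by blast
        then have "h (g v) = v" using S(2)[OF False] h(6)[OF vL] by simp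
        then show ?thesis using \<tau>v v by simp
      next
        case True
        have "g v \<in> V" "g v \<in> g ` S" using gV v True by blast+
        then consider "g v \<in> M" | "g v \<in> K" "g v \<notin> L" "g v \<notin> M" using S(3,4) h(4) KN by blast
        then have "h (g v) \<in> K" using h(8)[of "g v"] h(3) h(6)[of "g v"] by cases auto
        then show ?thesis using \<tau>v True by simp
      qed
    qed
    then show "\<tau> v \<in> K" "v \<notin> S \<Longrightarrow> \<tau> v = v" by auto
  qed
  have "pull \<tau> Z \<in> \<Z>"
  proof (rule pull_finite_Z[of "S \<inter> K"])
    show "\<tau> v = v" if "v \<notin> S \<inter> K" for v
      using that \<tau>K(2)[of v] by (cases "v \<in> K") (auto simp: \<tau>_def)
    show "\<tau> ` K \<subseteq> K" using \<tau>K(1) by (intro image_subsetI)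
  qed (use S(1) Z in auto)
  moreover have "pull (h \<circ> g) Z = pull \<tau> Z"
  proof (rule pull_agree[OF Z_free[OF Z] h(1) L])
    show "(h \<circ> g) ` V \<subseteq> V" using hV gV by (simp only: image_comp[symmetric]) blast
    have "\<tau> v \<in> V" if v: "v \<in> V" for v
    proof (cases "v \<in> K")
      case False
      then show ?thesis using v by (simp add: \<tau>_def)
    qed (use \<tau>K(1) in simp)
    then show "\<tau> ` V \<subseteq> V" by (intro image_subsetI)
  qed (simp_all add: \<tau>_def)
  ultimately show "pull h (pull g Z) \<in> \<Z>" using pull_comp[OF hV] by simp
qed

text \<open>
  Two separators become instances under one and the same involution, so that Boolean operations and
  cylindrifications on separators reduce to those on \<open>\<Z>\<close>.
\<close>

lemma normal_form:
  assumes g: "admissible g" "admissible g'" and Z: "Z \<in> \<Z>" "Z' \<in> \<Z>"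
  shows "\<exists>h L M Y Y'. swap h L M \<and> Y \<in> \<Z> \<and> Y' \<in> \<Z> \<and> pull g Z = pull h Y \<and> pull g' Z' = pull h Y'"
proof -
  define S where "S = {v. g v \<noteq> v} \<union> {v. g' v \<noteq> v}"
  have S: "finite S" "v \<notin> S \<Longrightarrow> g v = v" "v \<notin> S \<Longrightarrow> g' v = v" for v
    using g by (auto simp: S_def admissible_def)
  let ?M = "N \<inter> (g ` S \<union> g' ` S)"
  let ?F = "S \<union> g ` S \<union> g' ` S"
  have fin: "finite ?M" "finite ?F" using S(1) by auto
  have Q: "infinite ({i \<in> K. closed i Z \<and> closed i Z'} - ?F)"
    using Z_infinite[OF Z] fin(2) by (rule Diff_infinite_finite[rotated])
  obtain h L where hL: "L \<subseteq> {i \<in> K. closed i Z \<and> closed i Z'} - ?F" "swap h L ?M"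
    using ex_swap[OF fin(1) _ Q] by blast
  have L: "L \<inter> (S \<union> g ` S) = {}" "L \<inter> (S \<union> g' ` S) = {}"
    "v \<in> L \<Longrightarrow> closed v Z" "v \<in> L \<Longrightarrow> closed v Z'" for v
    using hL(1) by blast+
  have M: "N \<inter> g ` S \<subseteq> ?M" "N \<inter> g' ` S \<subseteq> ?M" by blast+
  note 1 = pull_swap_Z[OF hL(2) g(1) Z(1) S(1) S(2) L(1) M(1) L(3)]
  note 2 = pull_swap_Z[OF hL(2) g(2) Z(2) S(1) S(3) L(2) M(2) L(4)]
  show ?thesis using hL(2) 1 2 by blast
qed

definition R :: "('b \<times> ('a \<Rightarrow> 'c)) set set" where
  "R = {pull g Z | g Z. admissible g \<and> Z \<in> \<Z>}"

lemma R_I: "admissible g \<Longrightarrow> Z \<in> \<Z> \<Longrightarrow> pull g Z \<in> R"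
  unfolding R_def by blast

lemma Z_R: "Z \<in> \<Z> \<Longrightarrow> Z \<in> R"
  using R_I[of id Z] pull_id[OF Z_sub] by (simp add: admissible_def)

lemma R_sub: "r \<in> R \<Longrightarrow> r \<subseteq> \<Omega>"
  using pull_sub by (auto simp: R_def)

lemma R_Un: assumes "r \<in> R" "s \<in> R" shows "r \<union> s \<in> R"
proof -
  obtain g Z g' Z' where gZ: "admissible g" "Z \<in> \<Z>" "r = pull g Z" "admissible g'" "Z' \<in> \<Z>" "s = pull g' Z'"
    using assms by (auto simp: R_def)
  obtain h L M Y Y' where h: "swap h L M" "Y \<in> \<Z>" "Y' \<in> \<Z>" "r = pull h Y" "s = pull h Y'"
    using normal_form[OF gZ(1,4,2,5)] gZ(3,6) by auto
  then have "r \<union> s = pull h (Y \<union> Y')" by (simp add: pull_Un)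
  then show ?thesis using R_I[OF swap_admissible[OF h(1)] Z_Un[OF h(2,3)]] by simp
qed

lemma R_Compl: assumes "r \<in> R" shows "\<Omega> - r \<in> R"
proof -
  obtain g Z where gZ: "admissible g" "Z \<in> \<Z>" "r = pull g Z" using assms by (auto simp: R_def)
  then have "\<Omega> - r = pull g (\<Omega> - Z)" using pull_Compl[of g Z] by (simp add: admissible_def)
  then show ?thesis using R_I[OF gZ(1) Z_Compl[OF gZ(2)]] by simp
qed

lemma cl_N: "Z \<in> \<Z> \<Longrightarrow> n \<in> N \<Longrightarrow> cl n Z = Z"
proof -
  assume Z: "Z \<in> \<Z>" "n \<in> N"
  have nV: "n \<in> V" using Z(2) by simp
  have "cl n Z \<subseteq> Z" using closed_iff[OF nV closed_N_free[OF Z_free[OF Z(1)] Z(2)]] unfolding cl_def by blast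
  then show ?thesis using subset_cl[OF nV Z_sub[OF Z(1)]] by blast
qed

lemma R_cl: assumes r: "r \<in> R" and n: "n \<in> N" shows "cl n r \<in> R"
proof -
  obtain g Z where gZ: "admissible g" "Z \<in> \<Z>" "r = pull g Z" using assms by (auto simp: R_def)
  obtain h L M Y where h: "swap h L M" "Y \<in> \<Z>" "r = pull h Y"
    using normal_form[OF gZ(1,1,2,2)] gZ(3) by auto
  have hV: "h ` V \<subseteq> V" using swap_admissible[OF h(1)] by (simp add: admissible_def)
  have "cl n r = pull h (cl (h n) Y)" using cl_pull[OF swapD(5)[OF h(1)] hV Z_sub[OF h(2)]] h(3) by simp
  moreover have "h n \<in> V" using hV n by blast
  then have "cl (h n) Y \<in> \<Z>" using Z_cl[OF _ h(2)] cl_N[OF h(2)] h(2) by (cases "h n \<in> K") auto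
  ultimately show ?thesis using R_I[OF swap_admissible[OF h(1)]] by simp
qed

lemma R_repl:
  assumes i: "i \<in> V" "n \<in> V" "i \<noteq> n" and r: "r \<in> R" shows "{a \<in> \<Omega>. repl i n a \<in> r} \<in> R"
proof -
  obtain g Z where gZ: "admissible g" "Z \<in> \<Z>" "r = pull g Z" using assms by (auto simp: R_def)
  have u: "admissible (id(i := n))" using admissible_upd i by blast
  have "{a \<in> \<Omega>. repl i n a \<in> r} = pull (id(i := n)) (pull g Z)" using pull_repl[OF i] gZ(3) by simp
  also have "\<dots> = pull (id(i := n) \<circ> g) Z" using u by (intro pull_comp) (simp add: admissible_def)
  finally show ?thesis using R_I[OF admissible_comp[OF u gZ(1)] gZ(2)] by simp
qed

lemma R_E:
  assumes K: "infinite K" and vw: "v \<in> V" "w \<in> V" shows "E v w \<in> R"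
proof -
  obtain k where k: "k \<in> K" using infinite_avoids[OF K, of "{}"] by auto
  obtain l where l: "l \<in> K" "l \<noteq> k" using infinite_avoids[OF K, of "{k}"] by auto
  let ?g = "id(k := v, l := w)"
  have "{u. ?g u \<noteq> u} \<subseteq> {k, l}" by auto
  then have "finite {u. ?g u \<noteq> u}" by (rule finite_subset) simp
  moreover have gV: "?g ` V \<subseteq> V" using vw by auto
  ultimately have "admissible ?g" by (simp add: admissible_def)
  moreover have "pull ?g (E k l) = E v w"
  proof (intro set_eqI)
    fix p :: "'b \<times> ('a \<Rightarrow> 'c)"
    obtain m t where p: "p = (m, t)" by (cases p)
    show "p \<in> pull ?g (E k l) \<longleftrightarrow> p \<in> E v w"
      using l(2) \<Omega>_comp[OF gV, of m t] by (auto simp: p pull_iff E_def)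
  qed
  ultimately show ?thesis using R_I[of ?g "E k l"] Z_E k l by simp
qed

lemma ex_finite_cl:
  assumes "finite S" "S \<subseteq> K" "Z \<in> \<Z>"
  shows "{(k, t). (k, t) \<in> \<Omega> \<and> (\<exists>t'. (k, t') \<in> Z \<and> (\<forall>v. v \<notin> S \<longrightarrow> t v = t' v))} \<in> \<Z>"
  using assms
proof (induction S rule: finite_induct)
  case empty
  have "{(k, t). (k, t) \<in> \<Omega> \<and> (\<exists>t'. (k, t') \<in> Z \<and> (\<forall>v. v \<notin> {} \<longrightarrow> t v = t' v))} = Z"
    using Z_sub[OF empty(2)] by (auto simp: fun_eq_iff[symmetric])
  then show ?case using empty by simp
next
  case (insert s S)
  let ?Y = "\<lambda>S. {(k, t). (k, t) \<in> \<Omega> \<and> (\<exists>t'. (k, t') \<in> Z \<and> (\<forall>v. v \<notin> S \<longrightarrow> t v = t' v))}"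
  have "?Y (insert s S) = cl s (?Y S)"
  proof (intro set_eqI)
    fix p :: "'b \<times> ('a \<Rightarrow> 'c)"
    obtain k t where p: "p = (k, t)" by (cases p)
    show "p \<in> ?Y (insert s S) \<longleftrightarrow> p \<in> cl s (?Y S)"
    proof
      assume "p \<in> ?Y (insert s S)"
      then obtain t' where t': "(k, t) \<in> \<Omega>" "(k, t') \<in> Z" "\<forall>v. v \<notin> insert s S \<longrightarrow> t v = t' v"
        by (auto simp: p)
      have "(k, t') \<in> \<Omega>" using Z_sub[OF insert.prems(2)] t'(2) by blast
      then have o: "(k, t(s := t' s)) \<in> \<Omega>" using t'(1) by (simp add: \<Omega>_iff)
      have "(k, t(s := t' s)) \<in> ?Y S" using o t'(2,3) by auto
      moreover have "T s p (k, t(s := t' s))" using o t'(1) by (simp add: p T_iff)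
      ultimately show "p \<in> cl s (?Y S)" unfolding cl_def by blast
    next
      assume "p \<in> cl s (?Y S)"
      then obtain q where q: "q \<in> ?Y S" "T s p q" unfolding cl_def by blast
      obtain t1 where t1: "q = (k, t1)" using q(2) by (cases q) (simp add: p T_iff)
      then obtain t' where t': "(k, t') \<in> Z" "\<forall>v. v \<notin> S \<longrightarrow> t1 v = t' v" using q(1) by auto
      have "(k, t) \<in> \<Omega>" "\<forall>w. w \<noteq> s \<longrightarrow> t w = t1 w" using q(2) by (simp_all add: p t1 T_iff)
      then show "p \<in> ?Y (insert s S)" using t' by (auto simp: p)
    qed
  qed
  then show ?case using Z_cl insert by simp
qed

text \<open>
  Write \<open>r = pull h Y\<close> with \<open>h\<close> exchanging \<open>L\<close> and \<open>M\<close>.  The interpolant is \<open>\<exists>L. Y\<close>: since \<open>x\<close> and \<open>y\<close> do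
  not depend on the names in \<open>M\<close>, these can be quantified away in \<open>r\<close>, and in \<open>Y\<close> they are the indices \<open>L\<close>.
\<close>

theorem N_free_interpolation:
  assumes x: "N_free x" and y: "N_free y" and r: "r \<in> R" "x \<subseteq> r" "y \<inter> r = {}"
  shows "\<exists>Z\<in>\<Z>. x \<subseteq> Z \<and> y \<inter> Z = {}"
proof -
  obtain g Z where gZ: "admissible g" "Z \<in> \<Z>" "r = pull g Z" using r(1) by (auto simp: R_def)
  obtain h L M Y where h: "swap h L M" "Y \<in> \<Z>" "r = pull h Y"
    using normal_form[OF gZ(1,1,2,2)] gZ(3) by auto
  note hs = swapD[OF h(1)]
  have hV: "h ` V \<subseteq> V" using swap_admissible[OF h(1)] by (simp add: admissible_def)
  let ?Z = "{(k, t). (k, t) \<in> \<Omega> \<and> (\<exists>t'. (k, t') \<in> Y \<and> (\<forall>v. v \<notin> L \<longrightarrow> t v = t' v))}"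
  have hK: "h v = v" if "v \<in> K" "v \<notin> L" for v using that hs(4,6) KN by blast
  have "?Z \<in> \<Z>" by (rule ex_finite_cl[OF hs(1,3) h(2)])
  moreover have "p \<in> ?Z" if p: "p \<in> x" for p
  proof -
    obtain k t where kt: "p = (k, t)" by (cases p)
    then have th: "(k, t) \<in> \<Omega>" "(k, t \<circ> h) \<in> Y" using p r(2) h(3) by (auto simp: pull_iff)
    let ?t = "\<lambda>v. if v \<in> K then t (h v) else t v"
    have o: "(k, ?t) \<in> \<Omega>" using th(1) \<Omega>_comp[OF hV th(1)] by (auto simp: \<Omega>_iff)
    have "(k, ?t) \<in> Y" by (rule N_freeD[OF Z_free[OF h(2)] th(2) o]) simp
    moreover have "\<forall>v. v \<notin> L \<longrightarrow> t v = ?t v" using hK by simp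
    ultimately show ?thesis using th(1) unfolding kt by blast
  qed
  then have "x \<subseteq> ?Z" by blast
  moreover have "p \<notin> ?Z" if p: "p \<in> y" for p
  proof
    assume "p \<in> ?Z"
    obtain k t where kt: "p = (k, t)" by (cases p)
    then obtain t' where t': "(k, t) \<in> \<Omega>" "(k, t') \<in> Y" "\<forall>v. v \<notin> L \<longrightarrow> t v = t' v"
      using \<open>p \<in> ?Z\<close> by auto
    have o': "(k, t') \<in> \<Omega>" using Z_sub[OF h(2)] t'(2) by blast
    let ?t = "\<lambda>v. if v \<in> M then t' (h v) else t v"
    have o: "(k, ?t) \<in> \<Omega>" using t'(1) \<Omega>_comp[OF hV o'] by (auto simp: \<Omega>_iff)
    have ty: "(k, ?t) \<in> y"
      by (rule N_freeD[OF y p[unfolded kt] o]) (use hs(4) KN in auto)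
    have "(?t \<circ> h) v = t' v" if v: "v \<in> K" for v
    proof (cases "v \<in> L")
      case True
      then show ?thesis using hs(7)[OF True] hs(5)[of v] by simp
    next
      case False
      then have "h v = v" "v \<notin> M" using hK v hs(4) KN by auto
      then show ?thesis using t'(3) False by simp
    qed
    then have "(k, ?t \<circ> h) \<in> Y"
      by (intro N_freeD[OF Z_free[OF h(2)] t'(2) \<Omega>_comp[OF hV o]]) simp
    then have "(k, ?t) \<in> r" using o h(3) by (simp add: pull_iff)
    then show False using ty r(3) by blast
  qed
  then have "y \<inter> ?Z = {}" by blast
  ultimately show ?thesis by blast
qed

end

section \<open>Two representable algebras in one frame\<close>

lemma RCA_E:
  assumes "A \<in> RCA TYPE('x) J"
  obtains I :: "'x set" and U :: "'x \<Rightarrow> 'x set" and f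
  where "is_hom J A (prod_alg I (\<lambda>k. full_cs J (U k))) f" "inj_on f (car A)" "is_algebra J A"
proof -
  obtain I :: "'x set" and U :: "'x \<Rightarrow> 'x set" and S where S: "is_algebra J A"
    "is_subuniverse J S (prod_alg I (\<lambda>k. full_cs J (U k)))"
    "isomorphic J A (prod_alg I (\<lambda>k. full_cs J (U k)) \<lparr>car := S\<rparr>)"
    using assms unfolding RCA_def by blast
  then obtain f where f: "is_hom J A (prod_alg I (\<lambda>k. full_cs J (U k)) \<lparr>car := S\<rparr>) f"
    "bij_betw f (car A) S" unfolding isomorphic_def by auto
  have "S \<subseteq> car (prod_alg I (\<lambda>k. full_cs J (U k)))" using S(2) by (simp add: is_subuniverse_def)
  then have "is_hom J A (prod_alg I (\<lambda>k. full_cs J (U k))) f"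
    using f(1) unfolding is_hom_def by (simp add: Pi_iff subset_iff)
  then show ?thesis using that[of I U f] f(2) S(1) by (simp add: bij_betw_def)
qed

context seq_frame
begin

definition over :: "'k set \<Rightarrow> ('k \<times> ('v \<Rightarrow> 'u)) set" where
  "over Q = {(z, t). (z, t) \<in> \<Omega> \<and> z \<in> Q}"

context
  fixes J :: "'i set" and \<iota> :: "'i \<Rightarrow> 'v" and A :: "('i, 'd) cyl_algebra"
    and I1 :: "'x set" and U :: "'x \<Rightarrow> 'x set" and f :: "'d \<Rightarrow> 'x \<Rightarrow> ('i \<Rightarrow> 'x) set"
    and \<phi> :: "'x \<Rightarrow> 'k" and \<psi> :: "'x \<Rightarrow> 'u" and \<psi>' :: "'u \<Rightarrow> 'x"
  assumes f: "is_hom J A (prod_alg I1 (\<lambda>k. full_cs J (U k))) f" and f_inj: "inj_on f (car A)"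
    and K: "K = \<iota> ` J" and \<iota>: "inj_on \<iota> J" and J: "J \<noteq> {}" and alg: "is_algebra J A"
    and \<phi>: "inj \<phi>" "\<phi> ` I1 \<subseteq> I" and \<psi>: "\<And>u. \<psi>' (\<psi> u) = u" and B: "\<And>k. k \<in> I1 \<Longrightarrow> B (\<phi> k) = \<psi> ` U k"
begin

definition read :: "('v \<Rightarrow> 'u) \<Rightarrow> 'i \<Rightarrow> 'x" where
  "read t = (\<lambda>i\<in>J. \<psi>' (t (\<iota> i)))"

abbreviation part :: "('k \<times> ('v \<Rightarrow> 'u)) set" where
  "part \<equiv> over (\<phi> ` I1)"

definition lift :: "'d \<Rightarrow> ('k \<times> ('v \<Rightarrow> 'u)) set" where
  "lift a = {(z, t). (z, t) \<in> \<Omega> \<and> (\<exists>k\<in>I1. z = \<phi> k \<and> read t \<in> f a k)}"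

lemma lift_iff: "k \<in> I1 \<Longrightarrow> (\<phi> k, t) \<in> lift a \<longleftrightarrow> (\<phi> k, t) \<in> \<Omega> \<and> read t \<in> f a k"
  using \<phi>(1) by (auto simp: lift_def inj_def)

lemma part_iff: "k \<in> I1 \<Longrightarrow> (\<phi> k, t) \<in> part \<longleftrightarrow> (\<phi> k, t) \<in> \<Omega>"
  by (auto simp: over_def)

lemma lift_sub: "lift a \<subseteq> part"
  by (auto simp: lift_def over_def)

lemma part_eqI:
  assumes "X \<subseteq> part" "Y \<subseteq> part"
    "\<And>k t. k \<in> I1 \<Longrightarrow> (\<phi> k, t) \<in> \<Omega> \<Longrightarrow> (\<phi> k, t) \<in> X \<longleftrightarrow> (\<phi> k, t) \<in> Y"
  shows "X = Y"
proof (intro set_eqI)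
  fix p
  show "p \<in> X \<longleftrightarrow> p \<in> Y"
  proof (cases "p \<in> part")
    case True
    then obtain k t where "p = (\<phi> k, t)" "k \<in> I1" "(\<phi> k, t) \<in> \<Omega>" by (auto simp: over_def)
    then show ?thesis using assms(3) by blast
  qed (use assms in blast)
qed

lemma \<psi>_coord: "k \<in> I1 \<Longrightarrow> (\<phi> k, t) \<in> \<Omega> \<Longrightarrow> v \<in> V \<Longrightarrow> \<psi>' (t v) \<in> U k \<and> \<psi> (\<psi>' (t v)) = t v"
proof -
  assume k: "k \<in> I1" "(\<phi> k, t) \<in> \<Omega>" "v \<in> V"
  then have "t v \<in> \<psi> ` U k" using B[OF k(1)] unfolding \<Omega>_iff by blast
  then show ?thesis using \<psi> by auto
qed

lemma read_in: "k \<in> I1 \<Longrightarrow> (\<phi> k, t) \<in> \<Omega> \<Longrightarrow> read t \<in> J \<rightarrow>\<^sub>E U k"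
  using \<psi>_coord K by (auto simp: read_def)

lemma closed_part: "v \<in> V \<Longrightarrow> closed v part"
  unfolding closed_def by (auto simp: over_def T_def \<Omega>_def)

lemma N_free_lift: "N_free (lift a)"
  unfolding N_free_def
proof (intro conjI allI impI)
  show "lift a \<subseteq> \<Omega>" by (auto simp: lift_def)
  fix z t t' assume t: "(z, t) \<in> lift a" "(z, t') \<in> \<Omega>" "\<forall>v\<in>K. t v = t' v"
  have "read t = read t'" using t(3) K by (auto simp: read_def)
  then show "(z, t') \<in> lift a" using t by (auto simp: lift_def)
qed

lemma f_in: "a \<in> car A \<Longrightarrow> k \<in> I1 \<Longrightarrow> f a k \<subseteq> J \<rightarrow>\<^sub>E U k"
  using is_homD(1)[OF f, of a] by (auto simp: PiE_iff)

lemma lift_cyl: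
  assumes i: "i \<in> J" and a: "a \<in> car A"
  shows "lift (cyl A i a) = cl (\<iota> i) (lift a)"
proof (rule part_eqI)
  have iV: "\<iota> i \<in> V" using i K by blast
  show "cl (\<iota> i) (lift a) \<subseteq> part"
  proof
    fix p assume "p \<in> cl (\<iota> i) (lift a)"
    then obtain q where "q \<in> part" "T (\<iota> i) p q" using lift_sub unfolding cl_def by blast
    then show "p \<in> part" using closed_iff[OF iV closed_part[OF iV]] by blast
  qed
  fix k t assume k: "k \<in> I1" and t: "(\<phi> k, t) \<in> \<Omega>"
  have fc: "f (cyl A i a) k = {s \<in> J \<rightarrow>\<^sub>E U k. \<exists>t\<in>f a k. \<forall>j\<in>J. j \<noteq> i \<longrightarrow> t j = s j}"
    using is_homD(7)[OF f i a] k by simp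
  show "(\<phi> k, t) \<in> lift (cyl A i a) \<longleftrightarrow> (\<phi> k, t) \<in> cl (\<iota> i) (lift a)"
  proof
    assume "(\<phi> k, t) \<in> lift (cyl A i a)"
    then obtain s where s: "s \<in> f a k" "\<And>j. j \<in> J \<Longrightarrow> j \<noteq> i \<Longrightarrow> s j = read t j"
      using lift_iff[OF k] fc by auto
    have sU: "s \<in> J \<rightarrow>\<^sub>E U k" using f_in[OF a k] s(1) by blast
    let ?t = "t(\<iota> i := \<psi> (s i))"
    have "\<psi> (s i) \<in> B (\<phi> k)" using B[OF k] sU i by auto
    then have o: "(\<phi> k, ?t) \<in> \<Omega>" using \<Omega>_upd[OF t] by blast
    have "read ?t = s"
    proof
      fix j
      show "read ?t j = s j"
      proof (cases "j \<in> J")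
        case True
        then have "\<iota> j = \<iota> i \<longleftrightarrow> j = i" using \<iota> i by (auto simp: inj_on_def)
        then show ?thesis using True s(2)[of j] \<psi> by (auto simp: read_def)
      next
        case False
        then show ?thesis using sU by (auto simp: read_def PiE_iff extensional_def)
      qed
    qed
    then have "(\<phi> k, ?t) \<in> lift a" using lift_iff[OF k] o s(1) by simp
    moreover have "T (\<iota> i) (\<phi> k, t) (\<phi> k, ?t)" using t o by (simp add: T_iff)
    ultimately show "(\<phi> k, t) \<in> cl (\<iota> i) (lift a)" unfolding cl_def by blast
  next
    assume "(\<phi> k, t) \<in> cl (\<iota> i) (lift a)"
    then obtain q where q: "q \<in> lift a" "T (\<iota> i) (\<phi> k, t) q" unfolding cl_def by blast
    obtain t' where t': "q = (\<phi> k, t')" using q(2) by (cases q) (simp add: T_iff)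
    have r': "read t' \<in> f a k" using q(1) lift_iff[OF k] t' by blast
    have "read t' j = read t j" if j: "j \<in> J" "j \<noteq> i" for j
    proof -
      have "\<iota> j \<noteq> \<iota> i" using \<iota> i j by (auto simp: inj_on_def)
      then show ?thesis using q(2) j by (simp add: t' T_iff read_def)
    qed
    then show "(\<phi> k, t) \<in> lift (cyl A i a)"
      using lift_iff[OF k] fc r' read_in[OF k t] t by auto
  qed
qed (rule lift_sub)

lemma lift_diag:
  assumes ij: "i \<in> J" "j \<in> J"
  shows "lift (diag A i j) = part \<inter> E (\<iota> i) (\<iota> j)"
proof (rule part_eqI)
  fix k t assume k: "k \<in> I1" and t: "(\<phi> k, t) \<in> \<Omega>"
  have fd: "f (diag A i j) k = {s \<in> J \<rightarrow>\<^sub>E U k. s i = s j}" using is_homD(8)[OF f ij] k by simp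
  have "\<iota> i \<in> V" "\<iota> j \<in> V" using ij K by auto
  then have "\<psi>' (t (\<iota> i)) = \<psi>' (t (\<iota> j)) \<longleftrightarrow> t (\<iota> i) = t (\<iota> j)"
    using \<psi>_coord[OF k t, of "\<iota> i"] \<psi>_coord[OF k t, of "\<iota> j"] by metis
  then show "(\<phi> k, t) \<in> lift (diag A i j) \<longleftrightarrow> (\<phi> k, t) \<in> part \<inter> E (\<iota> i) (\<iota> j)"
    using lift_iff[OF k, of t "diag A i j"] fd read_in[OF k t] t ij part_iff[OF k, of t]
    by (simp add: read_def E_def)
qed (use lift_sub in auto)

lemma represents_lift: "represents J \<iota> A part lift"
proof -
  have plus: "lift (plus_of A a b) = lift a \<union> lift b" if ab: "a \<in> car A" "b \<in> car A" for a b
  proof (rule part_eqI)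
    fix k t assume k: "k \<in> I1"
    show "(\<phi> k, t) \<in> lift (plus_of A a b) \<longleftrightarrow> (\<phi> k, t) \<in> lift a \<union> lift b"
      using lift_iff[OF k] is_homD(2)[OF f ab] k by auto
  qed (use lift_sub in auto)
  have times: "lift (times_of A a b) = lift a \<inter> lift b" if ab: "a \<in> car A" "b \<in> car A" for a b
  proof (rule part_eqI)
    fix k t assume k: "k \<in> I1"
    show "(\<phi> k, t) \<in> lift (times_of A a b) \<longleftrightarrow> (\<phi> k, t) \<in> lift a \<inter> lift b"
      using lift_iff[OF k] is_homD(3)[OF f ab] k by auto
  qed (use lift_sub in auto)
  have compl: "lift (compl_of A a) = part - lift a" if a: "a \<in> car A" for a
  proof (rule part_eqI)
    fix k t assume k: "k \<in> I1" and t: "(\<phi> k, t) \<in> \<Omega>"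
    have "f (compl_of A a) k = (J \<rightarrow>\<^sub>E U k) - f a k" using is_homD(4)[OF f a] k by simp
    then show "(\<phi> k, t) \<in> lift (compl_of A a) \<longleftrightarrow> (\<phi> k, t) \<in> part - lift a"
      using lift_iff[OF k, of t a] lift_iff[OF k, of t "compl_of A a"] part_iff[OF k, of t]
        read_in[OF k t] t by simp
  qed (use lift_sub in auto)
  have zero: "lift (zero_of A) = {}"
  proof (rule part_eqI)
    fix k t assume k: "k \<in> I1"
    show "(\<phi> k, t) \<in> lift (zero_of A) \<longleftrightarrow> (\<phi> k, t) \<in> {}"
      using lift_iff[OF k] is_homD(5)[OF f] k by auto
  qed (use lift_sub in auto)
  have one: "lift (one_of A) = part"
  proof (rule part_eqI)
    fix k t assume k: "k \<in> I1" and t: "(\<phi> k, t) \<in> \<Omega>"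
    have "f (one_of A) k = J \<rightarrow>\<^sub>E U k" using is_homD(6)[OF f] k by simp
    then show "(\<phi> k, t) \<in> lift (one_of A) \<longleftrightarrow> (\<phi> k, t) \<in> part"
      using lift_iff[OF k, of t "one_of A"] part_iff[OF k, of t] read_in[OF k t] t by simp
  qed (use lift_sub in auto)
  have "part \<subseteq> \<Omega>" by (auto simp: over_def)
  moreover have "\<iota> ` J \<subseteq> V" using K by blast
  ultimately show ?thesis
    unfolding represents_def using plus times compl zero one lift_cyl lift_diag lift_sub closed_part
    by (intro conjI ballI) simp_all
qed

lemma inj_on_lift: "inj_on lift (car A)"
proof (rule inj_onI)
  fix a b assume ab: "a \<in> car A" "b \<in> car A" and eq: "lift a = lift b"
  obtain i0 where i0: "i0 \<in> J" using J by blast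
  have sub: "f a k \<subseteq> f b k" if ab: "a \<in> car A" "b \<in> car A" and eq: "lift a = lift b" and k: "k \<in> I1" for a b k
  proof
    fix s assume s: "s \<in> f a k"
    then have sU: "s \<in> J \<rightarrow>\<^sub>E U k" using f_in[OF ab(1) k] by blast
    \<comment> \<open>The names may take any value; \<open>s i0\<close> shows that the base is not empty.\<close>
    define t where "t = (\<lambda>v. if v \<in> \<iota> ` J then \<psi> (s (inv_into J \<iota> v)) else \<psi> (s i0))"
    have "t v \<in> B (\<phi> k)" for v
    proof -
      have "inv_into J \<iota> v \<in> J" if "v \<in> \<iota> ` J" using inv_into_into[OF that] .
      then show ?thesis using B[OF k] sU i0 by (auto simp: t_def)
    qed
    then have o: "(\<phi> k, t) \<in> \<Omega>" using \<phi>(2) k by (auto simp: \<Omega>_iff)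
    have "read t = s"
    proof
      fix i
      show "read t i = s i"
        using sU \<psi> inv_into_f_f[OF \<iota>] by (cases "i \<in> J") (auto simp: read_def t_def PiE_iff extensional_def)
    qed
    then have "(\<phi> k, t) \<in> lift a" using lift_iff[OF k] o s by simp
    then have "(\<phi> k, t) \<in> lift b" using eq by simp
    then show "s \<in> f b k" using lift_iff[OF k] \<open>read t = s\<close> by simp
  qed
  have "f a = f b"
  proof (rule PiE_ext[of _ I1 "\<lambda>k. Pow (J \<rightarrow>\<^sub>E U k)"])
    show "f a \<in> (\<Pi>\<^sub>E k\<in>I1. Pow (J \<rightarrow>\<^sub>E U k))" "f b \<in> (\<Pi>\<^sub>E k\<in>I1. Pow (J \<rightarrow>\<^sub>E U k))"
      using is_homD(1)[OF f] ab by simp_all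
    show "f a k = f b k" if "k \<in> I1" for k using sub[OF ab eq that] sub[OF ab(2,1) eq[symmetric] that] by blast
  qed
  then show "a = b" using f_inj ab by (simp add: inj_on_def)
qed

end

end

lemma RCA_boolean:
  assumes "A \<in> RCA TYPE('x) J" shows "boolean_carrier A"
proof -
  obtain I :: "'x set" and U :: "'x \<Rightarrow> 'x set" and f where
    f: "is_hom J A (prod_alg I (\<lambda>k. full_cs J (U k))) f" "inj_on f (car A)" "is_algebra J A"
    using assms by (rule RCA_E)
  define e where "e = (\<lambda>a. Sigma I (f a))"
  have fU: "f a k \<subseteq> J \<rightarrow>\<^sub>E U k" if "a \<in> car A" "k \<in> I" for a k
    using is_homD(1)[OF f(1) that(1)] that(2) by (auto simp: PiE_iff)
  have e: "e (plus_of A a b) = e a \<union> e b" "e (times_of A a b) = e a \<inter> e b"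
    if "a \<in> car A" "b \<in> car A" for a b
    using is_homD(2,3)[OF f(1) that] by (auto simp: e_def)
  have e': "e (compl_of A a) = e (one_of A) - e a" "e a \<subseteq> e (one_of A)" if "a \<in> car A" for a
  proof -
    have k: "f (compl_of A a) k = f (one_of A) k - f a k" "f a k \<subseteq> f (one_of A) k" if "k \<in> I" for k
      using is_homD(4)[OF f(1) \<open>a \<in> car A\<close>] is_homD(6)[OF f(1)] fU[OF \<open>a \<in> car A\<close> that] that by simp_all
    show "e (compl_of A a) = e (one_of A) - e a" unfolding e_def using k(1) by auto
    show "e a \<subseteq> e (one_of A)" unfolding e_def using k(2) by auto
  qed
  have e0: "e (zero_of A) = {}" using is_homD(5)[OF f(1)] by (auto simp: e_def)
  have cl: "closed_under_ops J (car A) A" using f(3) by (simp add: is_algebra_def)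
  have C: "zero_of A \<in> car A" "one_of A \<in> car A" "a \<in> car A \<Longrightarrow> compl_of A a \<in> car A"
    "a \<in> car A \<Longrightarrow> b \<in> car A \<Longrightarrow> plus_of A a b \<in> car A"
    "a \<in> car A \<Longrightarrow> b \<in> car A \<Longrightarrow> times_of A a b \<in> car A" for a b
    using cl by (simp_all add: closed_under_ops_def)
  have inj: "a = b" if "e a = e b" "a \<in> car A" "b \<in> car A" for a b
  proof -
    have "f a = f b"
    proof (rule PiE_ext[of _ I "\<lambda>k. Pow (J \<rightarrow>\<^sub>E U k)"])
      show "f a \<in> (\<Pi>\<^sub>E k\<in>I. Pow (J \<rightarrow>\<^sub>E U k))" "f b \<in> (\<Pi>\<^sub>E k\<in>I. Pow (J \<rightarrow>\<^sub>E U k))"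
        using is_homD(1)[OF f(1)] that by simp_all
      show "f a k = f b k" if k: "k \<in> I" for k
      proof -
        have "f c k = {s. (k, s) \<in> e c}" for c using k by (simp add: e_def)
        then show ?thesis using \<open>e a = e b\<close> by simp
      qed
    qed
    then show ?thesis using f(2) that by (simp add: inj_on_def)
  qed
  show ?thesis
  proof
    show "closed_under_ops {} (car A) A" using cl by (simp add: closed_under_ops_def)
    show "boolean_reduct A"
      unfolding boolean_reduct_def
      by (intro conjI ballI; rule inj) (use e' in \<open>auto simp: C e e0 e'(1)\<close>)
  qed
qed

lemma (in seq_frame) ex_represents:
  fixes A :: "('i, 'd) cyl_algebra" and I1 :: "'x set" and U :: "'x \<Rightarrow> 'x set"
  assumes "is_hom J A (prod_alg I1 (\<lambda>k. full_cs J (U k))) f" "inj_on f (car A)"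
    "K = \<iota> ` J" "inj_on \<iota> J" "J \<noteq> {}" "is_algebra J A" "inj \<phi>" "\<phi> ` I1 \<subseteq> I"
    "\<And>u. \<psi>' (\<psi> u) = u" "\<And>k. k \<in> I1 \<Longrightarrow> B (\<phi> k) = \<psi> ` U k"
  shows "\<exists>e. represents J \<iota> A (over (\<phi> ` I1)) e \<and> inj_on e (car A) \<and> (\<forall>a. N_free (e a))"
  using represents_lift[OF assms] inj_on_lift[OF assms] N_free_lift[OF assms] by blast

lemma le_of_iff:
  assumes "cyl_frame.represents V \<Omega> T E J \<iota> A D e" "cyl_frame V \<Omega> T E" "inj_on e (car A)"
    "is_algebra J A" "a \<in> car A" "b \<in> car A"
  shows "le_of A a b \<longleftrightarrow> e a \<subseteq> e b"
proof -
  have "plus_of A a b \<in> car A" using assms(4-6) by (simp add: is_algebra_def closed_under_ops_def)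
  then have "plus_of A a b = b \<longleftrightarrow> e (plus_of A a b) = e b" using assms(3,6) by (auto simp: inj_on_def)
  also have "e (plus_of A a b) = e a \<union> e b" using cyl_frame.representsD(5)[OF assms(2,1,5,6)] .
  finally show ?thesis by (auto simp: le_of_def)
qed

text \<open>
  Both algebras live in one sequence frame, on the disjoint parts \<open>D1\<close> and \<open>D2\<close>, and the unions \<open>Z z\<close>
  of the two images of \<open>z\<close> generate the separators.  A separator of \<open>x\<close> from the complement of
  \<open>y\<close> would yield an interpolant; so \<open>joint_model\<close> applies, and agreement of the two filters on
  \<open>Z z\<close> is agreement of the two models on \<open>z\<close>.
\<close>

theorem joint_local_model:
  fixes A0 :: "('i, 'a) cyl_algebra" and A1 :: "('i, 'b) cyl_algebra" and A2 :: "('i, 'c) cyl_algebra"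
  assumes A0: "A0 \<in> Dc J" and J: "infinite J"
    and A1: "A1 \<in> RCA TYPE('x) J" and A2: "A2 \<in> RCA TYPE('y) J"
    and i1: "is_mono J A0 A1 i1" and i2: "is_mono J A0 A2 i2"
    and x: "x \<in> car A1" and y: "y \<in> car A2"
    and no: "\<not> (\<exists>z\<in>car A0. le_of A1 x (i1 z) \<and> le_of A2 (i2 z) y)"
    and P1: "finite P1" "P1 \<subseteq> car A1" and P2: "finite P2" "P2 \<subseteq> car A2"
    and \<Gamma>: "finite \<Gamma>" "\<Gamma> \<subseteq> J"
  shows "\<exists>eq g1 g2 q. equivp eq \<and> local_model \<Gamma> P1 A1 eq g1 \<and> local_model \<Gamma> P2 A2 eq g2 \<and>
     (\<forall>z\<in>car A0. i1 z \<in> P1 \<longrightarrow> (\<forall>q. g1 q (i1 z) \<longleftrightarrow> g2 q (i2 z))) \<and> g1 q x \<and> \<not> g2 q y"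
proof -
  obtain I1 :: "'x set" and U1 :: "'x \<Rightarrow> 'x set" and f1 where
    f1: "is_hom J A1 (prod_alg I1 (\<lambda>k. full_cs J (U1 k))) f1" "inj_on f1 (car A1)" "is_algebra J A1"
    using A1 by (rule RCA_E)
  obtain I2 :: "'y set" and U2 :: "'y \<Rightarrow> 'y set" and f2 where
    f2: "is_hom J A2 (prod_alg I2 (\<lambda>k. full_cs J (U2 k))) f2" "inj_on f2 (car A2)" "is_algebra J A2"
    using A2 by (rule RCA_E)
  define K :: "('i + nat) set" where "K = Inl ` J"
  define N :: "('i + nat) set" where "N = range Inr"
  define I :: "('x + 'y) set" where "I = Inl ` I1 \<union> Inr ` I2"
  define B :: "'x + 'y \<Rightarrow> ('x + 'y) set" where
    "B = (\<lambda>k. case k of Inl k \<Rightarrow> Inl ` U1 k | Inr k \<Rightarrow> Inr ` U2 k)"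
  interpret S: seq_frame K N I B by unfold_locales (auto simp: K_def N_def)
  have Jne: "J \<noteq> {}" using J by auto
  define D1 where "D1 = S.over (Inl ` I1)"
  define D2 where "D2 = S.over (Inr ` I2)"
  have "\<exists>e. S.represents J Inl A1 D1 e \<and> inj_on e (car A1) \<and> (\<forall>a. S.N_free (e a))"
    unfolding D1_def
    by (rule S.ex_represents[OF f1(1,2) K_def _ Jne f1(3), where \<psi> = Inl and \<psi>' = projl])
      (simp_all add: I_def B_def)
  then obtain e1 where e1: "S.represents J Inl A1 D1 e1" "inj_on e1 (car A1)" "\<And>a. S.N_free (e1 a)"
    by (elim exE conjE) simp
  have "\<exists>e. S.represents J Inl A2 D2 e \<and> inj_on e (car A2) \<and> (\<forall>a. S.N_free (e a))"
    unfolding D2_def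
    by (rule S.ex_represents[OF f2(1,2) K_def _ Jne f2(3), where \<psi> = Inr and \<psi>' = projr])
      (simp_all add: I_def B_def)
  then obtain e2 where e2: "S.represents J Inl A2 D2 e2" "inj_on e2 (car A2)" "\<And>a. S.N_free (e2 a)"
    by (elim exE conjE) simp
  note r1 = S.representsD[OF e1(1)] and r2 = S.representsD[OF e2(1)]
  have "z \<in> Inl ` I1 \<union> Inr ` I2" if "(z, t) \<in> S.\<Omega>" for z t
    using that unfolding S.\<Omega>_iff unfolding I_def by blast
  then have D12: "D1 \<inter> D2 = {}" "D1 \<union> D2 = S.\<Omega>"
    unfolding D1_def D2_def S.over_def by auto
  have h1: "is_hom J A0 A1 i1" and h2: "is_hom J A0 A2 i2" and inj1: "inj_on i1 (car A0)"
    using i1 i2 by (simp_all add: is_mono_def)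
  note m1 = is_homD[OF h1] and m2 = is_homD[OF h2]
  have alg0: "closed_under_ops J (car A0) A0" using A0 by (simp add: Dc_def CA_def is_algebra_def)
  have C0: "z \<in> car A0 \<Longrightarrow> z' \<in> car A0 \<Longrightarrow> plus_of A0 z z' \<in> car A0"
    "z \<in> car A0 \<Longrightarrow> compl_of A0 z \<in> car A0" "i \<in> J \<Longrightarrow> z \<in> car A0 \<Longrightarrow> cyl A0 i z \<in> car A0"
    "i \<in> J \<Longrightarrow> j \<in> J \<Longrightarrow> diag A0 i j \<in> car A0" for z z' i j
    using alg0 by (simp_all add: closed_under_ops_def)
  define Z where "Z = (\<lambda>z. e1 (i1 z) \<union> e2 (i2 z))"
  have Z1: "Z z \<inter> D1 = e1 (i1 z)" "Z z \<inter> D2 = e2 (i2 z)" if "z \<in> car A0" for z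
    using r1(4)[OF m1(1)[OF that]] r2(4)[OF m2(1)[OF that]] D12(1) unfolding Z_def by blast+
  have Z_plus: "Z z \<union> Z z' = Z (plus_of A0 z z')" if z: "z \<in> car A0" "z' \<in> car A0" for z z'
    using r1(5)[OF m1(1)[OF z(1)] m1(1)[OF z(2)]] r2(5)[OF m2(1)[OF z(1)] m2(1)[OF z(2)]] m1(2)[OF z] m2(2)[OF z]
    by (auto simp: Z_def)
  have Z_compl: "S.\<Omega> - Z z = Z (compl_of A0 z)" if z: "z \<in> car A0" for z
  proof -
    have "Z (compl_of A0 z) = (D1 - e1 (i1 z)) \<union> (D2 - e2 (i2 z))"
      using r1(7)[OF m1(1)[OF z]] r2(7)[OF m2(1)[OF z]] m1(4)[OF z] m2(4)[OF z] by (simp add: Z_def)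
    then show ?thesis
      using D12 r1(4)[OF m1(1)[OF z]] r2(4)[OF m2(1)[OF z]] unfolding Z_def by blast
  qed
  have Z_cyl: "S.cl (Inl i) (Z z) = Z (cyl A0 i z)" if i: "i \<in> J" and z: "z \<in> car A0" for i z
  proof -
    have "Z (cyl A0 i z) = S.cl (Inl i) (e1 (i1 z)) \<union> S.cl (Inl i) (e2 (i2 z))"
      using r1(10)[OF i m1(1)[OF z]] r2(10)[OF i m2(1)[OF z]] m1(7)[OF i z] m2(7)[OF i z] by (simp add: Z_def)
    then show ?thesis unfolding Z_def S.cl_def by blast
  qed
  have Z_diag: "S.E (Inl i) (Inl j) = Z (diag A0 i j)" if ij: "i \<in> J" "j \<in> J" for i j
  proof -
    have "Z (diag A0 i j) = (D1 \<union> D2) \<inter> S.E (Inl i) (Inl j)"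
      using r1(11)[OF ij] r2(11)[OF ij] m1(8)[OF ij] m2(8)[OF ij] by (auto simp: Z_def)
    then show ?thesis using D12(2) by (auto simp: S.E_def)
  qed
  have Z_free: "S.N_free (Z z)" for z
    using e1(3)[of "i1 z"] e2(3)[of "i2 z"] unfolding Z_def S.N_free_def by blast
  interpret F: seq_frame_family K N I B "Z ` car A0"
  proof
    show "X \<in> Z ` car A0 \<Longrightarrow> S.N_free X" for X using Z_free by blast
    show "X \<in> Z ` car A0 \<Longrightarrow> Y \<in> Z ` car A0 \<Longrightarrow> X \<union> Y \<in> Z ` car A0" for X Y
      using Z_plus C0(1) by auto
    show "X \<in> Z ` car A0 \<Longrightarrow> S.\<Omega> - X \<in> Z ` car A0" for X using Z_compl C0(2) by auto
    show "i \<in> K \<Longrightarrow> X \<in> Z ` car A0 \<Longrightarrow> S.cl i X \<in> Z ` car A0" for i X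
      using Z_cyl C0(3) by (auto simp: K_def)
    show "i \<in> K \<Longrightarrow> j \<in> K \<Longrightarrow> S.E i j \<in> Z ` car A0" for i j
      using Z_diag C0(4) by (auto simp: K_def)
    show "infinite {i \<in> K. S.closed i X \<and> S.closed i Y}" if XY: "X \<in> Z ` car A0" "Y \<in> Z ` car A0" for X Y
    proof -
      obtain z w where zw: "z \<in> car A0" "w \<in> car A0" "X = Z z" "Y = Z w" using XY by blast
      have "infinite {i \<in> J. \<forall>a\<in>{z, w}. cyl A0 i a = a}"
        by (rule Dc_infinite_common_fixed[OF A0 J]) (use zw in auto)
      then have "infinite ((Inl :: 'i \<Rightarrow> 'i + nat) ` {i \<in> J. \<forall>a\<in>{z, w}. cyl A0 i a = a})"
        by (simp add: finite_image_iff)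
      moreover have "S.closed (Inl i) (Z a)" if "i \<in> J" "a \<in> car A0" "cyl A0 i a = a" for i a
      proof -
        have "Inl i \<in> K \<union> N" using that(1) by (simp add: K_def)
        then have "S.closed (Inl i) (S.cl (Inl i) (Z a))" by (rule S.closed_cl_self)
        then show ?thesis using Z_cyl[OF that(1,2)] that(3) by simp
      qed
      then have "Inl ` {i \<in> J. \<forall>a\<in>{z, w}. cyl A0 i a = a} \<subseteq> {i \<in> K. S.closed i X \<and> S.closed i Y}"
        using zw by (auto simp: K_def)
      ultimately show ?thesis using finite_subset by blast
    qed
  qed
  have infK: "infinite K" using J by (simp add: K_def finite_image_iff)
  interpret M: cyl_frame_interpolants "K \<union> N" S.\<Omega> S.T S.E "Inl ` \<Gamma>" Inr F.R
  proof
    show "Inl ` \<Gamma> \<subseteq> K \<union> N" using \<Gamma>(2) by (auto simp: K_def)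
    show "v \<in> Inl ` \<Gamma> \<union> range Inr \<Longrightarrow> w \<in> Inl ` \<Gamma> \<union> range Inr \<Longrightarrow> S.E v w \<in> F.R" for v w
      using F.R_E[OF infK, of v w] \<Gamma>(2) by (auto simp: K_def N_def)
    show "r \<in> F.R \<Longrightarrow> S.cl (Inr n) r \<in> F.R" for r n using F.R_cl[of r "Inr n"] by (simp add: N_def)
    show "i \<in> Inl ` \<Gamma> \<Longrightarrow> r \<in> F.R \<Longrightarrow> {a \<in> S.\<Omega>. S.repl i (Inr n) a \<in> r} \<in> F.R" for i r n
      using F.R_repl[of i "Inr n" r] \<Gamma>(2) by (auto simp: K_def N_def)
  qed (use \<Gamma>(1) F.R_sub F.R_Un F.R_Compl in \<open>auto simp: N_def\<close>)
  have cofree: "M.cofree X" if "S.N_free X" for X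
  proof (rule M.cofreeI[of _ "{}"])
    show "X \<subseteq> S.\<Omega>" using that by (simp add: S.N_free_def)
    have "Inr n \<in> N" for n :: nat by (simp add: N_def)
    then show "S.closed (Inr n) X" for n using S.closed_N_free[OF that] by blast
  qed simp
  define \<X> where "\<X> = e1 ` P1 \<union> e2 ` P2 \<union> Z ` {z \<in> car A0. i1 z \<in> P1}"
  have "finite {z \<in> car A0. i1 z \<in> P1}"
    using finite_vimage_IntI[OF P1(1) inj1] by (rule rev_finite_subset) auto
  then have X: "countable \<X>" using P1(1) P2(1) by (simp add: \<X>_def countable_finite)
  have Xf: "M.cofree Y" if "Y \<in> \<X>" for Y
    using that cofree e1(3) e2(3) Z_free by (auto simp: \<X>_def)
  have ycompl: "D2 - e2 y = e2 (compl_of A2 y)" using r2(7)[OF y] by simp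
  have b: "M.cofree (e1 x)" "M.cofree (D2 - e2 y)" using cofree e1(3) e2(3) by (simp_all add: ycompl)
  have fr: "cyl_frame (K \<union> N) S.\<Omega> S.T S.E" by unfold_locales
  have nsep: "\<not> M.sep (e1 x) (D2 - e2 y)"
  proof
    assume "M.sep (e1 x) (D2 - e2 y)"
    then obtain r where r: "r \<in> F.R" "e1 x \<subseteq> r" "(D2 - e2 y) \<inter> r = {}" by (auto simp: M.sep_def)
    then have "\<exists>X\<in>Z ` car A0. e1 x \<subseteq> X \<and> (D2 - e2 y) \<inter> X = {}"
      using e1(3) e2(3) by (intro F.N_free_interpolation) (simp_all add: ycompl)
    then obtain z where z: "z \<in> car A0" "e1 x \<subseteq> Z z" "(D2 - e2 y) \<inter> Z z = {}" by blast
    have "e1 x \<subseteq> e1 (i1 z)" using z(2) Z1(1)[OF z(1)] r1(4)[OF x] by blast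
    then have "le_of A1 x (i1 z)" using le_of_iff[OF e1(1) fr e1(2) f1(3) x m1(1)[OF z(1)]] by simp
    moreover have "e2 (i2 z) \<subseteq> e2 y" using z(3) Z1(2)[OF z(1)] r2(4)[OF m2(1)[OF z(1)]] by blast
    then have "le_of A2 (i2 z) y" using le_of_iff[OF e2(1) fr e2(2) f2(3) m2(1)[OF z(1)] y] by simp
    ultimately show False using no z(1) by blast
  qed
  have "\<exists>F G q. M.henkin (M.tests \<X>) F \<and> M.henkin (M.tests \<X>) G \<and> M.sat F q (e1 x) \<and>
      M.sat G q (D2 - e2 y) \<and> e1 x \<in> F \<and> D2 - e2 y \<in> G \<and> M.eqv F = M.eqv G \<and>
      (\<forall>r\<in>F.R \<inter> \<X>. \<forall>q. M.sat F q r \<longleftrightarrow> M.sat G q r)"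
    by (rule M.joint_model[OF X Xf b nsep])
  then obtain F G q where FG:
    "M.henkin (M.tests \<X>) F" "M.henkin (M.tests \<X>) G" "M.sat F q (e1 x)"
    "M.sat G q (D2 - e2 y)" "e1 x \<in> F" "D2 - e2 y \<in> G" "M.eqv F = M.eqv G"
    "\<forall>r\<in>F.R \<inter> \<X>. \<forall>q. M.sat F q r \<longleftrightarrow> M.sat G q r"
    by (elim exE conjE)
  have D1F: "D1 \<in> F" using M.F_up[OF FG(1) FG(5) r1(4)[OF x]] .
  have D2G: "D2 \<in> G" using M.F_up[OF FG(2) FG(6)] by blast
  have satD1: "M.sat F p D1" for p
    using M.sat_closed[OF FG(1) D1F subset_refl r1(1)] r1(2) M.\<Gamma>_simps(1) by blast
  have satD2: "M.sat G p D2" for p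
    using M.sat_closed[OF FG(2) D2G subset_refl r2(1)] r2(2) M.\<Gamma>_simps(1) by blast
  define g1 where "g1 = (\<lambda>p a. M.sat F (p \<circ> projl) (e1 a))"
  define g2 where "g2 = (\<lambda>p a. M.sat G (p \<circ> projl) (e2 a))"
  have "local_model \<Gamma> P1 A1 (M.eqv F) g1" unfolding g1_def
    by (rule M.local_model_sat[OF FG(1) e1(1) D1F P1(2) _ \<Gamma>(2)]) (auto simp: \<X>_def)
  moreover have "local_model \<Gamma> P2 A2 (M.eqv G) g2" unfolding g2_def
    by (rule M.local_model_sat[OF FG(2) e2(1) D2G P2(2) _ \<Gamma>(2)]) (auto simp: \<X>_def)
  moreover have "g1 p (i1 z) \<longleftrightarrow> g2 p (i2 z)" if z: "z \<in> car A0" "i1 z \<in> P1" for z p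
  proof -
    have "Z z \<in> F.R \<inter> \<X>" using z F.Z_R[of "Z z"] by (auto simp: \<X>_def)
    then have "M.sat F (p \<circ> projl) (Z z) \<longleftrightarrow> M.sat G (p \<circ> projl) (Z z)" using FG(8) by blast
    then show ?thesis
      using M.sat_Int[OF FG(1), of _ "Z z" D1] M.sat_Int[OF FG(2), of _ "Z z" D2] satD1 satD2 Z1[OF z(1)]
      by (simp add: g1_def g2_def)
  qed
  moreover have unread: "M.sat H (q \<circ> Inl \<circ> projl) Y \<longleftrightarrow> M.sat H q Y" if "M.henkin (M.tests \<X>) H" for H Y
    by (rule M.sat_cong[OF that]) auto
  have "g1 (q \<circ> Inl) x" using FG(3) unread[OF FG(1)] by (simp add: g1_def)
  moreover have "\<not> g2 (q \<circ> Inl) y"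
  proof
    assume "g2 (q \<circ> Inl) y"
    then have "M.sat G q (e2 y)" using unread[OF FG(2)] by (simp add: g2_def)
    then have "M.sat G q ((D2 - e2 y) \<inter> e2 y)" using FG(4) M.sat_Int[OF FG(2)] by blast
    moreover have "(D2 - e2 y) \<inter> e2 y = {}" by blast
    ultimately show False using M.sat_empty[OF FG(2)] by simp
  qed
  ultimately show ?thesis using M.eqv_equivp[OF FG(1)] FG(7)
    by (intro exI[of _ "M.eqv F"] exI[of _ g1] exI[of _ g2] exI[of _ "q \<circ> Inl"]) simp
qed


section \<open>Super amalgamation\<close>

text \<open>
  The ultraproduct of the joint local models, indexed by finite sets of indices and of elements of the two
  algebras.  The valuations at which \<open>x\<close> holds and \<open>y\<close> fails combine to a sequence in \<open>h1 x\<close> outside \<open>h2 y\<close>.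
\<close>

theorem separating_interpretations:
  fixes A0 :: "('i, 'a) cyl_algebra" and A1 :: "('i, 'b) cyl_algebra" and A2 :: "('i, 'c) cyl_algebra"
    and code :: "(('i + 'b + 'c) set \<Rightarrow> nat) \<Rightarrow> 'u"
  assumes A0: "A0 \<in> Dc J" and J: "infinite J"
    and A1: "A1 \<in> RCA TYPE('x) J" and A2: "A2 \<in> RCA TYPE('y) J"
    and i1: "is_mono J A0 A1 i1" and i2: "is_mono J A0 A2 i2"
    and x: "x \<in> car A1" and y: "y \<in> car A2"
    and no: "\<not> (\<exists>z\<in>car A0. le_of A1 x (i1 z) \<and> le_of A2 (i2 z) y)"
    and code: "inj code"
  shows "\<exists>W h1 h2. is_hom J A1 (full_cs J (W :: 'u set)) h1 \<and> is_hom J A2 (full_cs J W) h2 \<and>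
     (\<forall>z\<in>car A0. h1 (i1 z) = h2 (i2 z)) \<and> \<not> h1 x \<subseteq> h2 y"
proof -
  from ex_fine_ultrafilter[where 'k = "'i + 'b + 'c"] obtain U :: "('i + 'b + 'c) set filter" where
    U': "\<forall>Q. eventually Q U \<or> eventually (\<lambda>k. \<not> Q k) U" "U \<noteq> bot" "eventually finite U"
      "\<forall>e. eventually (\<lambda>k. e \<in> k) U"
    by (elim exE conjE)
  note U = U'(1)[THEN spec] U'(2,3) U'(4)[THEN spec]
  define \<Gamma> where "\<Gamma> = (\<lambda>k :: ('i + 'b + 'c) set. {i \<in> J. Inl i \<in> k})"
  define P1 where "P1 = (\<lambda>k :: ('i + 'b + 'c) set. {a \<in> car A1. Inr (Inl a) \<in> k})"
  define P2 where "P2 = (\<lambda>k :: ('i + 'b + 'c) set. {a \<in> car A2. Inr (Inr a) \<in> k})"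
  have fin: "finite (\<Gamma> k)" "finite (P1 k)" "finite (P2 k)" if "finite k" for k
  proof -
    have "finite (Inl -` k)" "finite ((\<lambda>a. Inr (Inl a)) -` k)" "finite ((\<lambda>a. Inr (Inr a)) -` k)"
      using that by (auto intro!: finite_vimageI injI)
    moreover have "\<Gamma> k \<subseteq> Inl -` k" "P1 k \<subseteq> (\<lambda>a. Inr (Inl a)) -` k" "P2 k \<subseteq> (\<lambda>a. Inr (Inr a)) -` k"
      by (auto simp: \<Gamma>_def P1_def P2_def)
    ultimately show "finite (\<Gamma> k)" "finite (P1 k)" "finite (P2 k)" by (simp_all add: finite_subset)
  qed
  let ?good = "\<lambda>k eq g1 g2 q. equivp eq \<and> local_model (\<Gamma> k) (P1 k) A1 eq g1 \<and> local_model (\<Gamma> k) (P2 k) A2 eq g2 \<and>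
     (\<forall>z\<in>car A0. i1 z \<in> P1 k \<longrightarrow> (\<forall>q. g1 q (i1 z) \<longleftrightarrow> g2 q (i2 z))) \<and> g1 q x \<and> \<not> g2 q y"
  have "\<forall>k. \<exists>m. finite k \<longrightarrow> ?good k (fst m) (fst (snd m)) (fst (snd (snd m))) (snd (snd (snd m)))"
  proof
    fix k
    have "P1 k \<subseteq> car A1" "P2 k \<subseteq> car A2" "\<Gamma> k \<subseteq> J" by (auto simp: P1_def P2_def \<Gamma>_def)
    then have "\<exists>eq g1 g2 q. ?good k eq g1 g2 q" if "finite k"
      by (rule joint_local_model[OF A0 J A1 A2 i1 i2 x y no fin(2)[OF that] _ fin(3)[OF that] _ fin(1)[OF that]])
    then show "\<exists>m. finite k \<longrightarrow> ?good k (fst m) (fst (snd m)) (fst (snd (snd m))) (snd (snd (snd m)))"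
      unfolding split_paired_Ex fst_conv snd_conv by (cases "finite k") simp_all
  qed
  then obtain m where M: "\<forall>k. finite k \<longrightarrow>
      ?good k (fst (m k)) (fst (snd (m k))) (fst (snd (snd (m k)))) (snd (snd (snd (m k))))"
    by (rule exE[OF choice])
  define eq where "eq = (\<lambda>k. fst (m k))"
  define g1 where "g1 = (\<lambda>k. fst (snd (m k)))"
  define g2 where "g2 = (\<lambda>k. fst (snd (snd (m k))))"
  define q where "q = (\<lambda>k. snd (snd (snd (m k))))"
  have m: "?good k (eq k) (g1 k) (g2 k) (q k)" if "finite k" for k
    unfolding eq_def g1_def g2_def q_def by (rule M[THEN spec, THEN mp, OF that])
  interpret ultraproduct U J \<Gamma> eq q code
  proof
    show "eventually (\<lambda>k. equivp (eq k)) U" using U(3) by (rule eventually_mono) (use m in blast)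
    show "i \<in> J \<Longrightarrow> eventually (\<lambda>k. i \<in> \<Gamma> k) U" for i using U(4)[of "Inl i"] by (simp add: \<Gamma>_def)
  qed (use U code in \<open>auto simp: \<Gamma>_def\<close>)
  have lm1: "eventually (\<lambda>k. local_model (\<Gamma> k) (P1 k) A1 (eq k) (g1 k)) U"
    using U(3) by (rule eventually_mono) (use m in blast)
  have lm2: "eventually (\<lambda>k. local_model (\<Gamma> k) (P2 k) A2 (eq k) (g2 k)) U"
    using U(3) by (rule eventually_mono) (use m in blast)
  have P1: "eventually (\<lambda>k. a \<in> P1 k) U" if "a \<in> car A1" for a
    using U(4)[of "Inr (Inl a)"] that by (simp add: P1_def)
  have P2: "eventually (\<lambda>k. a \<in> P2 k) U" if "a \<in> car A2" for a
    using U(4)[of "Inr (Inr a)"] that by (simp add: P2_def)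
  have alg: "is_algebra J A1" "is_algebra J A2" using A1 A2 by (simp_all add: RCA_def)
  have "interp g1 (i1 z) = interp g2 (i2 z)" if z: "z \<in> car A0" for z
  proof -
    have iz: "i1 z \<in> car A1" using i1 z by (auto simp: is_mono_def is_hom_def)
    have "eventually (\<lambda>k. g1 k (at s k) (i1 z) = g2 k (at s k) (i2 z)) U" for s
      using U(3) P1[OF iz]
    proof eventually_elim
      case (elim k)
      then show ?case using m[of k] z by blast
    qed
    from ev_cong[OF this] show ?thesis by (simp add: interp_def)
  qed
  moreover have "base_point \<in> interp g1 x"
  proof -
    have "eventually (\<lambda>k. g1 k (q k) x) U" using U(3) by (rule eventually_mono) (use m in blast)
    then show ?thesis using base_point_interp[OF lm1 P1[OF x]] by simp
  qed
  moreover have "base_point \<notin> interp g2 y"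
  proof -
    have "eventually (\<lambda>k. \<not> g2 k (q k) y) U" using U(3) by (rule eventually_mono) (use m in blast)
    then show ?thesis using base_point_interp[OF lm2 P2[OF y]] by (simp add: ev_not)
  qed
  ultimately show ?thesis using interp_hom[OF alg(1) lm1 P1] interp_hom[OF alg(2) lm2 P2] by blast
qed

text \<open>
  A function on \<open>'k set\<close> with values in \<open>nat\<close> is coded by its graph, since pairs \<open>(X, n)\<close> can be coded
  as subsets of the infinite type \<open>'k\<close>.
\<close>

lemma ex_code:
  assumes "infinite (UNIV :: 'k set)"
  shows "\<exists>code :: ('k set \<Rightarrow> nat) \<Rightarrow> 'k set set. inj code"
proof -
  have "|UNIV :: nat set| \<le>o |UNIV :: 'k set|"
    using assms by (simp add: infinite_iff_card_of_nat)
  then have "|(UNIV :: 'k set) <+> (UNIV :: nat set)| =o |UNIV :: 'k set|"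
    using card_of_Plus_infinite[OF assms] by blast
  then have "|(UNIV :: 'k set) <+> (UNIV :: nat set)| \<le>o |UNIV :: 'k set|"
    by (rule ordIso_imp_ordLeq)
  then obtain p :: "'k + nat \<Rightarrow> 'k" where p: "inj p"
    unfolding card_of_ordLeq[symmetric] by auto
  define pair where "pair = (\<lambda>(X :: 'k set, n :: nat). p ` (Inl ` X \<union> {Inr n}))"
  have "inj pair"
  proof (rule injI)
    fix u v assume eq: "pair u = pair v"
    obtain X n Y m where uv: "u = (X, n)" "v = (Y, m)" by (cases u, cases v)
    have e: "Inl ` X \<union> {Inr n} = Inl ` Y \<union> {Inr m}" using eq unfolding pair_def uv prod.case inj_image_eq_iff[OF p] .
    have "X = Inl -` (Inl ` X \<union> {Inr n})" "Y = Inl -` (Inl ` Y \<union> {Inr m})" by auto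
    then have "X = Y" using e by simp
    moreover have "n = m" using e by auto
    ultimately show "u = v" using uv by simp
  qed
  then have "inj (\<lambda>f :: 'k set \<Rightarrow> nat. pair ` range (\<lambda>X. (X, f X)))"
  proof -
    assume ip: "inj pair"
    show ?thesis
    proof (rule injI)
      fix f g :: "'k set \<Rightarrow> nat"
      assume "pair ` range (\<lambda>X. (X, f X)) = pair ` range (\<lambda>X. (X, g X))"
      then have "range (\<lambda>X. (X, f X)) = range (\<lambda>X. (X, g X))" unfolding inj_image_eq_iff[OF ip] .
      then have "(X, f X) \<in> range (\<lambda>X. (X, g X))" for X by blast
      then show "f = g" by auto
    qed
  qed
  then show ?thesis by blast
qed

lemma no_trivial_interpolant:
  assumes B: "boolean_carrier A1" "boolean_carrier A2"
    and i1: "is_mono J A0 A1 i1" and i2: "is_mono J A0 A2 i2" and zero: "zero_of A0 \<in> car A0"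
    and x: "x \<in> car A1" "x \<noteq> zero_of A1"
  shows "\<not> (\<exists>z\<in>car A0. le_of A1 x (i1 z) \<and> le_of A2 (i2 z) (zero_of A2))"
proof
  assume "\<exists>z\<in>car A0. le_of A1 x (i1 z) \<and> le_of A2 (i2 z) (zero_of A2)"
  then obtain z where z: "z \<in> car A0" "le_of A1 x (i1 z)" "le_of A2 (i2 z) (zero_of A2)" by blast
  have h: "is_hom J A0 A1 i1" "is_hom J A0 A2 i2" "inj_on i2 (car A0)"
    using i1 i2 by (simp_all add: is_mono_def)
  have "i2 z = zero_of A2"
    using z(3) boolean_carrier.bool(7)[OF B(2) is_homD(1)[OF h(2) z(1)]] by (simp add: le_of_def)
  then have "i2 z = i2 (zero_of A0)" using is_homD(5)[OF h(2)] by simp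
  then have "z = zero_of A0" using inj_onD[OF h(3) _ z(1) zero] by simp
  then have "i1 z = zero_of A1" using is_homD(5)[OF h(1)] by simp
  then show False
    using z(2) boolean_carrier.bool(7)[OF B(1) x(1)] x(2) by (simp add: le_of_def)
qed

text \<open>
  The factors of the product are indexed by \<open>bad\<close>, the pairs without an interpolant; the flag tells
  which of the two elements is to be the smaller one.
\<close>

theorem super_amalgam:
  fixes A0 :: "('i, 'a) cyl_algebra" and A1 :: "('i, 'b) cyl_algebra" and A2 :: "('i, 'c) cyl_algebra"
    and code1 :: "(('i + 'b + 'c) set \<Rightarrow> nat) \<Rightarrow> 'u" and code2 :: "(('i + 'c + 'b) set \<Rightarrow> nat) \<Rightarrow> 'u"
    and name :: "bool \<times> 'b \<times> 'c \<Rightarrow> 'u"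
  assumes A0: "A0 \<in> Dc J" and J: "infinite J"
    and A1: "A1 \<in> RCA TYPE('x) J" and A2: "A2 \<in> RCA TYPE('y) J"
    and i1: "is_mono J A0 A1 i1" and i2: "is_mono J A0 A2 i2"
    and code: "inj code1" "inj code2" and name: "inj name"
  shows "\<exists>D\<in>(RCA TYPE('u) J :: ('i, 'u \<Rightarrow> ('i \<Rightarrow> 'u) set) cyl_algebra set). \<exists>m1 m2.
     is_mono J A1 D m1 \<and> is_mono J A2 D m2 \<and> (\<forall>z\<in>car A0. m1 (i1 z) = m2 (i2 z)) \<and>
     (\<forall>x\<in>car A1. \<forall>y\<in>car A2. le_of D (m1 x) (m2 y) \<longrightarrow>
        (\<exists>z\<in>car A0. le_of A1 x (i1 z) \<and> le_of A2 (i2 z) y)) \<and>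
     (\<forall>x\<in>car A2. \<forall>y\<in>car A1. le_of D (m2 x) (m1 y) \<longrightarrow>
        (\<exists>z\<in>car A0. le_of A2 x (i2 z) \<and> le_of A1 (i1 z) y))"
proof -
  let ?i = "\<lambda>x y. \<exists>z\<in>car A0. le_of A1 x (i1 z) \<and> le_of A2 (i2 z) y"
  let ?j = "\<lambda>x y. \<exists>z\<in>car A0. le_of A2 y (i2 z) \<and> le_of A1 (i1 z) x"
  define bad where "bad = {(c, x, y). x \<in> car A1 \<and> y \<in> car A2 \<and> (if c then \<not> ?i x y else \<not> ?j x y)}"
  let ?good = "\<lambda>(p :: bool \<times> 'b \<times> 'c) W h1 h2. is_hom J A1 (full_cs J (W :: 'u set)) h1 \<and> is_hom J A2 (full_cs J W) h2 \<and>
     (\<forall>z\<in>car A0. h1 (i1 z) = h2 (i2 z)) \<and>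
     (case p of (c, x, y) \<Rightarrow> if c then \<not> h1 x \<subseteq> h2 y else \<not> h2 y \<subseteq> h1 x)"
  have "\<forall>p. \<exists>m. p \<in> bad \<longrightarrow> ?good p (fst m) (fst (snd m)) (snd (snd m))"
  proof
    fix p :: "bool \<times> 'b \<times> 'c"
    obtain c x y where p: "p = (c, x, y)" by (cases p)
    have "\<exists>W h1 h2. ?good p W h1 h2" if "p \<in> bad"
    proof (cases c)
      case True
      then have "x \<in> car A1" "y \<in> car A2" "\<not> ?i x y" using that by (simp_all add: bad_def p)
      from separating_interpretations[OF A0 J A1 A2 i1 i2 this code(1)] show ?thesis
        using True by (simp add: p)
    next
      case False
      then have "y \<in> car A2" "x \<in> car A1" "\<not> ?j x y" using that by (simp_all add: bad_def p)
      from separating_interpretations[OF A0 J A2 A1 i2 i1 this code(2)] obtain W h2 h1 where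
        "is_hom J A2 (full_cs J (W :: 'u set)) h2" "is_hom J A1 (full_cs J W) h1"
        "\<forall>z\<in>car A0. h2 (i2 z) = h1 (i1 z)" "\<not> h2 y \<subseteq> h1 x" by (elim exE conjE)
      then have "?good p W h1 h2" using False by (simp add: p)
      then show ?thesis by blast
    qed
    then show "\<exists>m. p \<in> bad \<longrightarrow> ?good p (fst m) (fst (snd m)) (snd (snd m))"
      unfolding split_paired_Ex fst_conv snd_conv by (cases "p \<in> bad") simp_all
  qed
  then obtain m where M: "\<forall>p. p \<in> bad \<longrightarrow> ?good p (fst (m p)) (fst (snd (m p))) (snd (snd (m p)))"
    by (rule exE[OF choice])
  define I where "I = name ` bad"
  define W where "W = (\<lambda>k. fst (m (inv name k)))"
  define h1 where "h1 = (\<lambda>k. fst (snd (m (inv name k))))"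
  define h2 where "h2 = (\<lambda>k. snd (snd (m (inv name k))))"
  have G: "?good p (W (name p)) (h1 (name p)) (h2 (name p))" if "p \<in> bad" for p
    unfolding W_def h1_def h2_def inv_f_f[OF name] by (rule M[THEN spec, THEN mp, OF that])
  have hom: "is_hom J A1 (full_cs J (W k)) (h1 k)" "is_hom J A2 (full_cs J (W k)) (h2 k)"
    "z \<in> car A0 \<Longrightarrow> h1 k (i1 z) = h2 k (i2 z)" if "k \<in> I" for k z
    using G that unfolding I_def by blast+
  define m1 where "m1 = (\<lambda>a. \<lambda>k\<in>I. h1 k a)"
  define m2 where "m2 = (\<lambda>a. \<lambda>k\<in>I. h2 k a)"
  let ?D = "prod_alg I (\<lambda>k. full_cs J (W k))"
  have B1: "boolean_carrier A1" and B2: "boolean_carrier A2" using RCA_boolean A1 A2 by blast+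
  have zero: "zero_of A0 \<in> car A0" using A0 by (simp add: Dc_def CA_def is_algebra_def closed_under_ops_def)
  have z1: "zero_of A1 \<in> car A1" and z2: "zero_of A2 \<in> car A2"
    using boolean_carrier.in_C(4) B1 B2 by blast+
  have mono1: "is_mono J A1 ?D m1"
  proof -
    have "inj_on m1 (car A1)"
    proof (rule inj_onI)
      fix a b assume ab: "a \<in> car A1" "b \<in> car A1" and eq: "m1 a = m1 b"
      show "a = b"
      proof (rule boolean_carrier.separating_homs[OF B1 hom(1) _ ab])
        show "\<exists>k\<in>I. h1 k x \<noteq> {}" if x: "x \<in> car A1" "x \<noteq> zero_of A1" for x
        proof -
          have "(True, x, zero_of A2) \<in> bad"
            using no_trivial_interpolant[OF B1 B2 i1 i2 zero x] x z2 by (simp add: bad_def)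
          moreover from this have "h1 (name (True, x, zero_of A2)) x \<noteq> {}" using G by fastforce
          ultimately show ?thesis unfolding I_def by blast
        qed
        show "h1 k a = h1 k b" if "k \<in> I" for k using fun_cong[OF eq, of k] that by (simp add: m1_def)
      qed
    qed
    then show ?thesis using is_hom_tuple[OF hom(1)] by (simp add: is_mono_def m1_def)
  qed
  have mono2: "is_mono J A2 ?D m2"
  proof -
    have "inj_on m2 (car A2)"
    proof (rule inj_onI)
      fix a b assume ab: "a \<in> car A2" "b \<in> car A2" and eq: "m2 a = m2 b"
      show "a = b"
      proof (rule boolean_carrier.separating_homs[OF B2 hom(2) _ ab])
        show "\<exists>k\<in>I. h2 k y \<noteq> {}" if y: "y \<in> car A2" "y \<noteq> zero_of A2" for y
        proof -
          have "(False, zero_of A1, y) \<in> bad"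
            using no_trivial_interpolant[OF B2 B1 i2 i1 zero y] y z1 by (simp add: bad_def)
          moreover from this have "h2 (name (False, zero_of A1, y)) y \<noteq> {}" using G by fastforce
          ultimately show ?thesis unfolding I_def by blast
        qed
        show "h2 k a = h2 k b" if "k \<in> I" for k using fun_cong[OF eq, of k] that by (simp add: m2_def)
      qed
    qed
    then show ?thesis using is_hom_tuple[OF hom(2)] by (simp add: is_mono_def m2_def)
  qed
  have "m1 (i1 z) = m2 (i2 z)" if "z \<in> car A0" for z
    unfolding m1_def m2_def by (rule restrict_ext) (rule hom(3)[OF _ that])
  moreover have "?i x y" if xy: "x \<in> car A1" "y \<in> car A2" and le: "le_of ?D (m1 x) (m2 y)" for x y
  proof (rule ccontr)
    assume "\<not> ?i x y"
    then have b: "(True, x, y) \<in> bad" using xy by (simp add: bad_def)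
    let ?k = "name (True, x, y)"
    have "?k \<in> I" using b unfolding I_def by (rule imageI)
    then have "h1 ?k x \<union> h2 ?k y = h2 ?k y"
      using fun_cong[OF le[unfolded le_of_def], of ?k] by (simp add: m1_def m2_def)
    moreover have "\<not> h1 ?k x \<subseteq> h2 ?k y" using G[OF b] by simp
    ultimately show False by blast
  qed
  moreover have "?j x y" if xy: "x \<in> car A1" "y \<in> car A2" and le: "le_of ?D (m2 y) (m1 x)" for x y
  proof (rule ccontr)
    assume "\<not> ?j x y"
    then have b: "(False, x, y) \<in> bad" using xy by (simp add: bad_def)
    let ?k = "name (False, x, y)"
    have "?k \<in> I" using b unfolding I_def by (rule imageI)
    then have "h2 ?k y \<union> h1 ?k x = h1 ?k x"
      using fun_cong[OF le[unfolded le_of_def], of ?k] by (simp add: m1_def m2_def)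
    moreover have "\<not> h2 ?k y \<subseteq> h1 ?k x" using G[OF b] by simp
    ultimately show False by blast
  qed
  ultimately show ?thesis using mono1 mono2 prod_full_cs_RCA[of I J W]
    by (intro bexI[of _ ?D] exI[of _ m1] exI[of _ m2] conjI ballI impI)
qed

theorem corollary1p14:
  fixes \<alpha> :: "'i rel"
  assumes "Well_order \<alpha>" and "natLeq \<le>o \<alpha>"
  shows "(Dc (Field \<alpha>) :: ('i, 'a) cyl_algebra set) \<subseteq>
    super_amalgamation_base (Field \<alpha>)
      (RCA TYPE(('i + 'a) big) (Field \<alpha>))
      (RCA TYPE('x) (Field \<alpha>) :: ('i, 'b) cyl_algebra set)
      (RCA TYPE('y) (Field \<alpha>) :: ('i, 'c) cyl_algebra set)
      (RCA TYPE(('i + 'b + 'c) big) (Field \<alpha>)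
         :: ('i, ('i, ('i + 'b + 'c) big) prod_elem) cyl_algebra set)"
proof
  let ?J = "Field \<alpha>"
  have "|UNIV :: nat set| \<le>o |?J|" using card_of_mono2[OF assms(2)] by (simp add: Field_natLeq)
  then have J: "infinite ?J" by (simp add: infinite_iff_card_of_nat)
  have i: "infinite (UNIV :: 'i set)" using infinite_super[OF subset_UNIV J] .
  fix A0 :: "('i, 'a) cyl_algebra" assume A0: "A0 \<in> Dc ?J"
  obtain code0 :: "(('i + 'a) set \<Rightarrow> nat) \<Rightarrow> ('i + 'a) big" where "inj code0"
    using ex_code[where 'k = "'i + 'a"] i by (auto simp: finite_Plus_UNIV_iff)
  moreover have "inj (\<lambda>a :: 'a. {{Inr a :: 'i + 'a}})" by (auto simp: inj_def)
  ultimately have rep: "A0 \<in> RCA TYPE(('i + 'a) big) ?J" by (rule Dc_RCA[OF A0 J])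
  obtain code1 :: "(('i + 'b + 'c) set \<Rightarrow> nat) \<Rightarrow> ('i + 'b + 'c) big" where code1: "inj code1"
    using ex_code[where 'k = "'i + 'b + 'c"] i by (auto simp: finite_Plus_UNIV_iff)
  \<comment> \<open>For the inequalities in the other direction, \<open>A1\<close> and \<open>A2\<close> exchange their roles in
    \<open>separating_interpretations\<close>, and with them the summands of the index type.\<close>
  define twist :: "'i + 'c + 'b \<Rightarrow> 'i + 'b + 'c" where
    "twist = (\<lambda>s. case s of Inl i \<Rightarrow> Inl i | Inr (Inl c) \<Rightarrow> Inr (Inr c) | Inr (Inr b) \<Rightarrow> Inr (Inl b))"
  have twist: "inj twist"
    by (auto simp: inj_def twist_def split: sum.splits)
  have code2: "inj (\<lambda>f :: ('i + 'c + 'b) set \<Rightarrow> nat. code1 (\<lambda>S. f (twist -` S)))"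
  proof (rule injI)
    fix f g :: "('i + 'c + 'b) set \<Rightarrow> nat"
    assume "code1 (\<lambda>S. f (twist -` S)) = code1 (\<lambda>S. g (twist -` S))"
    then have "(\<lambda>S. f (twist -` S)) = (\<lambda>S. g (twist -` S))" by (rule injD[OF code1])
    then have "f (twist -` twist ` S) = g (twist -` twist ` S)" for S by (rule fun_cong)
    then show "f = g" by (simp add: inj_vimage_image_eq[OF twist] fun_eq_iff)
  qed
  have name: "inj (\<lambda>(c, x :: 'b, y :: 'c).
      if c then {{Inr (Inl x), Inr (Inr y) :: 'i + 'b + 'c}} else {{Inr (Inl x), Inr (Inr y)}, {}})"
    by (auto simp: inj_def doubleton_eq_iff insert_eq_iff)
  have "\<exists>D\<in>(RCA TYPE(('i + 'b + 'c) big) ?J :: ('i, ('i, ('i + 'b + 'c) big) prod_elem) cyl_algebra set).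
      \<exists>m1 m2. is_mono ?J A1 D m1 \<and> is_mono ?J A2 D m2 \<and>
        (\<forall>z\<in>car A0. m1 (i1 z) = m2 (i2 z)) \<and>
        (\<forall>x\<in>car A1. \<forall>y\<in>car A2. le_of D (m1 x) (m2 y) \<longrightarrow>
           (\<exists>z\<in>car A0. le_of A1 x (i1 z) \<and> le_of A2 (i2 z) y)) \<and>
        (\<forall>x\<in>car A2. \<forall>y\<in>car A1. le_of D (m2 x) (m1 y) \<longrightarrow>
           (\<exists>z\<in>car A0. le_of A2 x (i2 z) \<and> le_of A1 (i1 z) y))"
    if A1: "A1 \<in> RCA TYPE('x) ?J" and A2: "A2 \<in> RCA TYPE('y) ?J"
      and i1: "is_mono ?J A0 A1 i1" and i2: "is_mono ?J A0 A2 i2"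
    for A1 :: "('i, 'b) cyl_algebra" and A2 :: "('i, 'c) cyl_algebra" and i1 i2
    by (rule super_amalgam[OF A0 J that code1 code2 name])
  then show "A0 \<in> super_amalgamation_base ?J
      (RCA TYPE(('i + 'a) big) ?J)
      (RCA TYPE('x) ?J :: ('i, 'b) cyl_algebra set)
      (RCA TYPE('y) ?J :: ('i, 'c) cyl_algebra set)
      (RCA TYPE(('i + 'b + 'c) big) ?J
         :: ('i, ('i, ('i + 'b + 'c) big) prod_elem) cyl_algebra set)"
    using rep unfolding super_amalgamation_base_def by blast
qed

end
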